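(* Let $U\subseteq\operatorname{Aut}(\mathbb A^n)$ be a nested unipotent subgroup which has a dense orbit in $\mathbb A^n$. Then $U$ acts transitively on $\mathbb A^n$ and $U$ is triangulable, i.e. $U$ is conjugate in $\operatorname{Aut}(\mathbb A^n)$ to a subgroup of the de Jonquières subgroup $\operatorname{Jonq}(n)$.
   Context: $\Bbbk$ is an algebraically closed field of characteristic zero and $\mathbb A^n$ is affine $n$-space over $\Bbbk$; $\operatorname{Aut}(\mathbb A^n)$ is the group of regular (polynomial) automorphisms. An algebraic subgroup of $\operatorname{Aut}(\mathbb A^n)$ is a subgroup which is the image of a linear algebraic group acting regularly on $\mathbb A^n$. A nested unipotent subgroup is a subgroup which is a union $U=\bigcup_iU_i$ of an ascending sequence $U_1\subseteq U_2\subseteq\cdots$ of unipotent algebraic subgroups. The de Jonquières subgroup $\operatorname{Jonq}(n)\subset\operatorname{Aut}(\mathbb A^n)$ consists of the automorphisms of the form $(a_1x_1+f_1,\ a_2x_2+f_2(x_1),\ \ldots,\ a_nx_n+f_n(x_1,\ldots,x_{n-1}))$ with $a_i\in\Bbbk^*$ and $f_i\in\Bbbk[x_1,\ldots,x_{i-1}]$. *)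

theory Defs
  imports
    "HOL-Algebra.Group_Action"
    "HOL-Library.Poly_Mapping"
    "Jordan_Normal_Form.Determinant"
begin

section \<open>Polynomials in several variables\<close>

text \<open>The multiplication of \<^type>\<open>poly_mapping\<close> is convolution, so finitely supported
  functions on the finitely supported exponent vectors \<open>'v \<Rightarrow>\<^sub>0 nat\<close> form the polynomial ring
  over \<open>'a\<close> with variables indexed by \<open>'v\<close>.\<close>

type_synonym ('v, 'a) mpoly = "('v \<Rightarrow>\<^sub>0 nat) \<Rightarrow>\<^sub>0 'a"

definition mpolys :: "'v set \<Rightarrow> ('v, 'a::zero) mpoly set"
  where "mpolys V = {p. \<forall>e \<in> Poly_Mapping.keys p. Poly_Mapping.keys e \<subseteq> V}"

definition mpoly_eval :: "('v, 'a::comm_ring_1) mpoly \<Rightarrow> ('v \<Rightarrow> 'a) \<Rightarrow> 'a"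
  where "mpoly_eval p x =
    (\<Sum>e \<in> Poly_Mapping.keys p. Poly_Mapping.lookup p e *
    (\<Prod>i \<in> Poly_Mapping.keys e. x i ^ Poly_Mapping.lookup e i))"


section \<open>Affine space\<close>

text \<open>Affine \<open>n\<close>-space is \<^term>\<open>carrier_vec n\<close>; the coordinates are numbered from \<open>0\<close>.\<close>

definition zariski_closed :: "nat \<Rightarrow> 'a::field vec set \<Rightarrow> bool"
  where "zariski_closed n Z \<longleftrightarrow>
    (\<exists>P \<subseteq> mpolys {..<n}. Z = {x \<in> carrier_vec n. \<forall>p \<in> P. mpoly_eval p (\<lambda>i. x $ i) = 0})"

definition zariski_closure :: "nat \<Rightarrow> 'a::field vec set \<Rightarrow> 'a vec set"
  where "zariski_closure n S = \<Inter>{Z. zariski_closed n Z \<and> S \<subseteq> Z}"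

definition zariski_dense :: "nat \<Rightarrow> 'a::field vec set \<Rightarrow> bool"
  where "zariski_dense n S \<longleftrightarrow> S \<subseteq> carrier_vec n \<and> zariski_closure n S = carrier_vec n"

definition polynomial_map :: "nat \<Rightarrow> ('a::field vec \<Rightarrow> 'a vec) \<Rightarrow> bool"
  where "polynomial_map n f \<longleftrightarrow>
    (\<forall>i < n. \<exists>p \<in> mpolys {..<n}. \<forall>x \<in> carrier_vec n. f x $ i = mpoly_eval p (\<lambda>j. x $ j))"

text \<open>An automorphism is represented by its (extensional) function on points. Over an infinite
  field this determines the polynomials.\<close>

definition Aut :: "nat \<Rightarrow> ('a::field vec \<Rightarrow> 'a vec) monoid"
  where "Aut n = (BijGroup (carrier_vec n))
    \<lparr>carrier := {f \<in> Bij (carrier_vec n).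
       polynomial_map n f \<and> polynomial_map n (inv\<^bsub>BijGroup (carrier_vec n)\<^esub> f)}\<rparr>"

definition Jonq :: "nat \<Rightarrow> ('a::field vec \<Rightarrow> 'a vec) set"
  where "Jonq n = {\<phi> \<in> carrier (Aut n). \<exists>a f. (\<forall>i < n. a i \<noteq> 0 \<and> f i \<in> mpolys {..<i}) \<and>
    (\<forall>x \<in> carrier_vec n. \<phi> x = vec n (\<lambda>i. a i * x $ i + mpoly_eval (f i) (\<lambda>j. x $ j)))}"


section \<open>Algebraic subgroups\<close>

definition GL :: "nat \<Rightarrow> 'a::field mat monoid"
  where "GL m = units_of (ring_mat TYPE('a) m ())"

text \<open>Admitting \<open>1/det\<close> in the defining equations would give the same closed subsets of the
  general linear group, since denominators can be cleared.\<close>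

definition linear_algebraic_group :: "nat \<Rightarrow> 'a::field mat set \<Rightarrow> bool"
  where "linear_algebraic_group m G \<longleftrightarrow> subgroup G (GL m) \<and>
    (\<exists>P \<subseteq> mpolys ({..<m} \<times> {..<m}).
       G = {g \<in> carrier (GL m). \<forall>p \<in> P. mpoly_eval p (\<lambda>ij. g $$ ij) = 0})"

definition unipotent_mat :: "nat \<Rightarrow> 'a::field mat \<Rightarrow> bool"
  where "unipotent_mat m g \<longleftrightarrow> g \<in> carrier_mat m m \<and> (\<exists>k. (g - 1\<^sub>m m) ^\<^sub>m k = 0\<^sub>m m m)"

datatype act_var = Entry nat nat | Inv_Det | Coord nat

text \<open>An action \<open>G \<times> \<bbbA>\<^sup>n \<rightarrow> \<bbbA>\<^sup>n\<close> is regular if it is a morphism of varieties. As \<open>G\<close> is closed in the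
  general linear group, the regular functions on \<open>G \<times> \<bbbA>\<^sup>n\<close> are the polynomials in the matrix
  entries, \<open>1/det\<close>, and the coordinates of the point.\<close>

definition regular_action ::
    "nat \<Rightarrow> nat \<Rightarrow> 'a::field mat set \<Rightarrow> ('a mat \<Rightarrow> 'a vec \<Rightarrow> 'a vec) \<Rightarrow> bool"
  where "regular_action n m G \<rho> \<longleftrightarrow>
    group_action ((GL m)\<lparr>carrier := G\<rparr>) (carrier_vec n) \<rho> \<and>
    (\<forall>i < n.
      \<exists>p \<in> mpolys ({Entry j k | j k. j < m \<and> k < m} \<union> {Inv_Det} \<union> {Coord j | j. j < n}).
        \<forall>g \<in> G. \<forall>x \<in> carrier_vec n. \<rho> g x $ i =
          mpoly_eval p (case_act_var (\<lambda>j k. g $$ (j, k)) (inverse (det g)) (\<lambda>j. x $ j)))"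

definition unipotent_algebraic_subgroup :: "nat \<Rightarrow> ('a::field vec \<Rightarrow> 'a vec) set \<Rightarrow> bool"
  where "unipotent_algebraic_subgroup n H \<longleftrightarrow> subgroup H (Aut n) \<and>
    (\<exists>m G \<rho>. linear_algebraic_group m G \<and> (\<forall>g \<in> G. unipotent_mat m g) \<and>
       regular_action n m G \<rho> \<and> H = \<rho> ` G)"

definition nested_unipotent_subgroup :: "nat \<Rightarrow> ('a::field vec \<Rightarrow> 'a vec) set \<Rightarrow> bool"
  where "nested_unipotent_subgroup n U \<longleftrightarrow> subgroup U (Aut n) \<and>
    (\<exists>Us :: nat \<Rightarrow> _. (\<forall>i. unipotent_algebraic_subgroup n (Us i)) \<and>
       (\<forall>i. Us i \<subseteq> Us (Suc i)) \<and> U = (\<Union>i. Us i))"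

definition triangulable :: "nat \<Rightarrow> ('a::field vec \<Rightarrow> 'a vec) set \<Rightarrow> bool"
  where "triangulable n U \<longleftrightarrow> (\<exists>g \<in> carrier (Aut n). \<exists>H. subgroup H (Aut n) \<and> H \<subseteq> Jonq n \<and>
    g <#\<^bsub>Aut n\<^esub> U #>\<^bsub>Aut n\<^esub> inv\<^bsub>Aut n\<^esub> g = H)"

end

theory Submission
  imports Defs "HOL-Library.Function_Algebras" "Jordan_Normal_Form.Char_Poly"
begin

text \<open>Write \<open>A\<close> for affine space, \<open>O\<close> for its ring of polynomial functions, \<open>U\<^sub>0 \<subseteq> U\<^sub>1 \<subseteq> \<dots>\<close> for
the unipotent algebraic groups with union \<open>U\<close>, and fix a point \<open>x\<^sub>0\<close> with dense orbit. The proof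
constructs polynomial coordinates \<open>x\<^sub>1, x\<^sub>2, \<dots>\<close> such that \<open>x\<^sub>j \<circ> u - x\<^sub>j\<close> is a polynomial in
\<open>x\<^sub>1, \<dots>, x\<^bsub>j-1\<^esub>\<close> for all \<open>u \<in> U\<close>. If these generate \<open>O\<close>, they form an automorphism of \<open>A\<close> that
conjugates \<open>U\<close> into the de Jonquieres group.

Three facts about a unipotent algebraic group \<open>H\<close> acting on \<open>A\<close> are needed. By Kolchin's theorem
(\<open>kolchin\<close>) iterated differences \<open>f \<circ> u - f\<close> of a polynomial function die out, so that every
proper \<open>H\<close>-stable subspace \<open>R\<close> of \<open>O\<close> admits an \<open>f \<notin> R\<close> that is invariant modulo \<open>R\<close>. In
characteristic zero every \<open>u \<in> H\<close> lies on a one-parameter subgroup \<open>u\<^sup>t\<close> of \<open>H\<close> that is polynomial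
in \<open>t\<close>. And the homomorphisms from a subgroup of \<open>H\<close> to the additive group of the form
\<open>u \<mapsto> f (u x\<^sub>0) - f x\<^sub>0\<close> span a finite-dimensional space, because they are the linear coefficients of
\<open>f (u\<^sup>t x\<^sub>0)\<close> (\<open>unipotent_algebraic_subgroup_flow\<close>).

Since orbits of unipotent groups are irreducible, the ideals of the orbits \<open>U\<^sub>i x\<^sub>0\<close> form a descending
chain of primes. Each strict step raises the number of algebraically independent functions by one, and
there are at most \<open>n\<close> of these; hence already some \<open>U\<^sub>i x\<^sub>0\<close> is dense (\<open>ex_dense_orbit\<close>).

Suppose that \<open>x\<^sub>1, \<dots>, x\<^sub>k\<close> have been found and generate a subring \<open>O\<^sub>k \<noteq> O\<close>. Along with them one keeps
a section: elements \<open>\<theta>\<^sub>p\<close> of this \<open>U\<^sub>i\<close>, depending polynomially on \<open>p\<close>, such that \<open>\<theta>\<^sub>p x\<^sub>0\<close> has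
coordinates \<open>p\<close>. If \<open>f\<close> is \<open>U\<^sub>i\<close>-invariant modulo \<open>O\<^sub>k\<close> and constant on the orbit of the stabiliser of
\<open>(x\<^sub>1(x\<^sub>0), \<dots>, x\<^sub>k(x\<^sub>0))\<close>, then \<open>f (y)\<close> equals \<open>f (\<theta>\<^bsub>x(y)\<^esub> x\<^sub>0)\<close> on a dense orbit, whence \<open>f \<in> O\<^sub>k\<close>
(\<open>in_gen_by\<close>). So the functions that are \<open>U\<^sub>i\<close>-invariant modulo \<open>O\<^sub>k\<close> embed, modulo \<open>O\<^sub>k\<close>, in a
finite-dimensional space of homomorphisms. Letting \<open>i\<close> grow one obtains a descending sequence of nonzero
finite-dimensional spaces; it becomes stationary, and this gives a function \<open>x\<^bsub>k+1\<^esub> \<notin> O\<^sub>k\<close> that is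
invariant modulo \<open>O\<^sub>k\<close> for all of \<open>U\<close> (\<open>ex_invariant_mod\<close>). It is not constant along the stabiliser,
and a one-parameter subgroup of the stabiliser extends the section.

A section shows that \<open>x\<^sub>1, \<dots>, x\<^sub>k\<close> are algebraically independent, so the construction stops with
\<open>O\<^sub>k = O\<close>, and then \<open>k = n\<close> by counting again. Now a point is determined by its coordinates, so
\<open>y = \<theta>\<^bsub>x(y)\<^esub> x\<^sub>0\<close> for all \<open>y\<close>: transitivity comes out of the same construction, and the section is the
inverse of the coordinate map.\<close>

section \<open>Algebras of functions on a set\<close>

text \<open>The last rule identifies functions that agree on \<open>X\<close>: automorphisms of affine space are specified on
the carrier only, and a composition with one of them is a polynomial function only there.\<close>

inductive_set fun_alg :: "'b set \<Rightarrow> ('b \<Rightarrow> 'a::comm_ring_1) set \<Rightarrow> ('b \<Rightarrow> 'a) set"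
  for X S where
  const: "(\<lambda>_. c) \<in> fun_alg X S"
| gen: "f \<in> S \<Longrightarrow> f \<in> fun_alg X S"
| add: "f \<in> fun_alg X S \<Longrightarrow> g \<in> fun_alg X S \<Longrightarrow> (\<lambda>x. f x + g x) \<in> fun_alg X S"
| mult: "f \<in> fun_alg X S \<Longrightarrow> g \<in> fun_alg X S \<Longrightarrow> (\<lambda>x. f x * g x) \<in> fun_alg X S"
| cong: "f \<in> fun_alg X S \<Longrightarrow> (\<And>x. x \<in> X \<Longrightarrow> f x = g x) \<Longrightarrow> g \<in> fun_alg X S"

lemma fun_alg_diff:
  assumes "f \<in> fun_alg X S" "g \<in> fun_alg X S"
  shows "(\<lambda>x. f x - g x) \<in> fun_alg X S"
  using fun_alg.add[OF assms(1) fun_alg.mult[OF fun_alg.const[of "-1"] assms(2)]] by simp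

lemma fun_alg_sum:
  assumes "\<And>i. i \<in> I \<Longrightarrow> f i \<in> fun_alg X S"
  shows "(\<lambda>x. \<Sum>i\<in>I. f i x) \<in> fun_alg X S"
  using assms by (induction I rule: infinite_finite_induct) (simp_all add: fun_alg.const fun_alg.add)

lemma fun_alg_prod:
  assumes "\<And>i. i \<in> I \<Longrightarrow> f i \<in> fun_alg X S"
  shows "(\<lambda>x. \<Prod>i\<in>I. f i x) \<in> fun_alg X S"
  using assms by (induction I rule: infinite_finite_induct) (simp_all add: fun_alg.const fun_alg.mult)

lemma fun_alg_power:
  assumes "f \<in> fun_alg X S"
  shows "(\<lambda>x. f x ^ k) \<in> fun_alg X S"
  using assms by (induction k) (simp_all add: fun_alg.const fun_alg.mult)

lemma fun_alg_comp:
  assumes "f \<in> fun_alg X S" "\<And>y. y \<in> Y \<Longrightarrow> \<phi> y \<in> X"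
    and "\<And>s. s \<in> S \<Longrightarrow> (\<lambda>y. s (\<phi> y)) \<in> fun_alg Y T"
  shows "(\<lambda>y. f (\<phi> y)) \<in> fun_alg Y T"
  using assms(1)
proof induction
  case (cong f g)
  show ?case by (rule fun_alg.cong[OF cong.IH]) (use cong.hyps assms(2) in auto)
qed (simp_all add: fun_alg.const fun_alg.add fun_alg.mult assms(3))

lemma fun_alg_subset:
  assumes "f \<in> fun_alg X S" "S \<subseteq> fun_alg X T"
  shows "f \<in> fun_alg X T"
  using fun_alg_comp[OF assms(1), of X "\<lambda>x. x" T] assms(2) by auto

lemma fun_alg_const_on:
  assumes "f \<in> fun_alg X S" "x \<in> X" "y \<in> X" "\<And>s. s \<in> S \<Longrightarrow> s x = s y"
  shows "f x = f y"
  using assms(1) by induction (use assms in auto)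

lemma mpoly_eval_in_fun_alg:
  assumes "p \<in> mpolys V" "\<And>i. i \<in> V \<Longrightarrow> s i \<in> fun_alg X S"
  shows "(\<lambda>x. mpoly_eval p (\<lambda>i. s i x)) \<in> fun_alg X S"
  unfolding mpoly_eval_def
proof (rule fun_alg_sum, rule fun_alg.mult[OF fun_alg.const], rule fun_alg_prod, rule fun_alg_power)
  fix e i assume "e \<in> Poly_Mapping.keys p" "i \<in> Poly_Mapping.keys e"
  then show "s i \<in> fun_alg X S" using assms by (auto simp: mpolys_def)
qed

lemma mpoly_eval_superset:
  assumes "finite E" "Poly_Mapping.keys p \<subseteq> E"
  shows "mpoly_eval p x = (\<Sum>e\<in>E. Poly_Mapping.lookup p e *
    (\<Prod>i \<in> Poly_Mapping.keys e. x i ^ Poly_Mapping.lookup e i))"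
  unfolding mpoly_eval_def
  by (rule sum.mono_neutral_left) (use assms in \<open>auto simp: in_keys_iff\<close>)

lemma mpoly_eval_add: "mpoly_eval (p + q) x = mpoly_eval p x + mpoly_eval q x"
proof -
  let ?E = "Poly_Mapping.keys p \<union> Poly_Mapping.keys q"
  have "Poly_Mapping.keys (p + q) \<subseteq> ?E" by (rule Poly_Mapping.keys_add)
  then show ?thesis
    by (simp add: mpoly_eval_superset[of ?E] lookup_add algebra_simps sum.distrib)
qed

lemma mpoly_eval_zero [simp]: "mpoly_eval 0 x = 0"
  by (simp add: mpoly_eval_def)

lemma mpolys_add: "p \<in> mpolys V \<Longrightarrow> q \<in> mpolys V \<Longrightarrow> p + q \<in> mpolys V"
  using Poly_Mapping.keys_add[of p q] by (auto simp: mpolys_def)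

lemma mpolys_sum_ex:
  assumes "finite I" "\<And>i. i \<in> I \<Longrightarrow> \<exists>p\<in>mpolys V. \<forall>x. f i x = mpoly_eval p x"
  shows "\<exists>p\<in>mpolys V. \<forall>x. (\<Sum>i\<in>I. f i x) = mpoly_eval p x"
  using assms
proof (induction I rule: finite_induct)
  case empty
  show ?case by (rule bexI[of _ 0]) (auto simp: mpolys_def)
next
  case (insert i I)
  then obtain p q where "p \<in> mpolys V" "\<forall>x. f i x = mpoly_eval p x"
    "q \<in> mpolys V" "\<forall>x. (\<Sum>i\<in>I. f i x) = mpoly_eval q x" by (metis insertCI)
  then show ?case using insert(1,2)
    by (intro bexI[of _ "p + q"]) (auto simp: mpoly_eval_add mpolys_add)
qed

lemma mpoly_eval_monomial:
  "mpoly_eval (Poly_Mapping.single e c) x =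
    c * (\<Prod>i \<in> Poly_Mapping.keys e. x i ^ Poly_Mapping.lookup e i)"
  by (cases "c = 0") (auto simp: mpoly_eval_def)

lemma monomial_mult:
  fixes x :: "'v \<Rightarrow> 'a::comm_ring_1"
  shows "(\<Prod>i \<in> Poly_Mapping.keys d. x i ^ Poly_Mapping.lookup d i) *
    (\<Prod>i \<in> Poly_Mapping.keys e. x i ^ Poly_Mapping.lookup e i) =
    (\<Prod>i \<in> Poly_Mapping.keys (d + e). x i ^ Poly_Mapping.lookup (d + e) i)"
proof -
  let ?E = "Poly_Mapping.keys d \<union> Poly_Mapping.keys e"
  have *: "(\<Prod>i \<in> Poly_Mapping.keys f. x i ^ Poly_Mapping.lookup f i) =
     (\<Prod>i \<in> ?E. x i ^ Poly_Mapping.lookup f i)" if "Poly_Mapping.keys f \<subseteq> ?E" for f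
    by (rule prod.mono_neutral_left) (use that in \<open>auto simp: in_keys_iff\<close>)
  show ?thesis
    using Poly_Mapping.keys_add[of d e]
    by (subst (1 2 3) *) (auto simp: prod.distrib[symmetric] power_add lookup_add)
qed

text \<open>Expand both factors: a product of monomials is a monomial.\<close>

lemma mpoly_eval_mult_ex:
  assumes "p \<in> mpolys V" "q \<in> mpolys V"
  shows "\<exists>r\<in>mpolys V. \<forall>x. mpoly_eval p x * mpoly_eval q x = mpoly_eval r x"
proof -
  let ?m = "\<lambda>e x. \<Prod>i \<in> Poly_Mapping.keys e. x i ^ Poly_Mapping.lookup e i"
  have "\<exists>r\<in>mpolys V. \<forall>x. (\<Sum>d\<in>Poly_Mapping.keys p. \<Sum>e\<in>Poly_Mapping.keys q.
      (Poly_Mapping.lookup p d * Poly_Mapping.lookup q e) * ?m (d + e) x) = mpoly_eval r x"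
  proof (rule mpolys_sum_ex[OF finite_keys], rule mpolys_sum_ex[OF finite_keys])
    fix d e assume "d \<in> Poly_Mapping.keys p" "e \<in> Poly_Mapping.keys q"
    then have "Poly_Mapping.keys (d + e) \<subseteq> V"
      using assms Poly_Mapping.keys_add[of d e] unfolding mpolys_def by blast
    then show "\<exists>r\<in>mpolys V. \<forall>x. Poly_Mapping.lookup p d * Poly_Mapping.lookup q e * ?m (d + e) x
        = mpoly_eval r x"
      by (intro bexI[of _ "Poly_Mapping.single (d + e) (Poly_Mapping.lookup p d * Poly_Mapping.lookup q e)"])
        (auto simp: mpoly_eval_monomial mpolys_def split: if_splits)
  qed
  then show ?thesis
    by (simp add: mpoly_eval_def sum_product monomial_mult[symmetric] mult_ac)
qed

text \<open>With \<open>mpoly_eval_in_fun_alg\<close> this says that polynomial functions are the algebra generated by the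
coordinates, which lets rule induction take the place of computations with coefficients.\<close>

lemma fun_alg_imp_mpoly:
  assumes "f \<in> fun_alg X (s ` V)"
  shows "\<exists>p\<in>mpolys V. \<forall>x\<in>X. f x = mpoly_eval p (\<lambda>i. s i x)"
  using assms
proof induction
  case (const c)
  show ?case by (rule bexI[of _ "Poly_Mapping.single 0 c"]) (auto simp: mpoly_eval_monomial mpolys_def)
next
  case (gen f)
  then obtain i where "i \<in> V" "f = s i" by auto
  then show ?case
    by (intro bexI[of _ "Poly_Mapping.single (Poly_Mapping.single i 1) 1"])
      (auto simp: mpoly_eval_monomial mpolys_def)
next
  case (add f g)
  then show ?case by (metis mpoly_eval_add mpolys_add)
next
  case (mult f g)
  then obtain p q where "p \<in> mpolys V" "\<forall>x\<in>X. f x = mpoly_eval p (\<lambda>i. s i x)"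
    "q \<in> mpolys V" "\<forall>x\<in>X. g x = mpoly_eval q (\<lambda>i. s i x)" by blast
  then show ?case using mpoly_eval_mult_ex[of p V q] by metis
next
  case (cong f g)
  then show ?case by auto
qed

section \<open>Linear algebra of functions\<close>

interpretation fv: vector_space "\<lambda>(c::'a::field) (f::'b \<Rightarrow> 'a) x. c * f x"
  by unfold_locales (auto simp: fun_eq_iff algebra_simps)

lemma sum_fun_apply: "(\<Sum>i\<in>I. f i) x = (\<Sum>i\<in>I. f i x)"
  for f :: "'i \<Rightarrow> 'b \<Rightarrow> 'a::comm_monoid_add"
  by (induction I rule: infinite_finite_induct) auto

lemma finite_span_dependent:
  fixes f :: "nat \<Rightarrow> 'b \<Rightarrow> 'a::field"
  assumes "finite T" "\<And>k. k < K \<Longrightarrow> f k \<in> fv.span T" "card T < K"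
  obtains c where "\<exists>k<K. c k \<noteq> 0" "\<And>x. (\<Sum>k<K. c k * f k x) = 0"
proof (cases "inj_on f {..<K}")
  case True
  let ?S = "f ` {..<K}"
  have "\<not> fv.independent ?S"
    using fv.independent_span_bound[of T ?S] assms True by (auto simp: card_image)
  then obtain u where u: "\<exists>v\<in>?S. u v \<noteq> 0" "(\<Sum>v\<in>?S. (\<lambda>x. u v * v x)) = 0"
    by (subst (asm) fv.dependent_finite) auto
  have "(\<Sum>k<K. u (f k) * f k x) = 0" for x
    using fun_cong[OF u(2), of x] by (simp add: sum_fun_apply sum.reindex[OF True])
  then show ?thesis using u(1) that[of "\<lambda>k. u (f k)"] by auto
next
  case False
  then obtain i j where ij: "i < K" "j < K" "i \<noteq> j" "f i = f j" by (auto simp: inj_on_def)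
  define c where "c = (\<lambda>k. if k = i then 1 else if k = j then -1 else 0 :: 'a)"
  have "(\<Sum>k<K. c k * f k x) = 0" for x
  proof -
    have "(\<Sum>k<K. c k * f k x) = (\<Sum>k\<in>{i,j}. c k * f k x)"
      by (rule sum.mono_neutral_right) (use ij in \<open>auto simp: c_def\<close>)
    then show ?thesis using ij by (simp add: c_def)
  qed
  moreover have "\<exists>k<K. c k \<noteq> 0" using ij(1) by (auto simp: c_def)
  ultimately show ?thesis using that by blast
qed

text \<open>Choose an index where the cardinality of a basis is minimal: a later space that were properly smaller
would have a basis that extends to a larger independent subset.\<close>

lemma descending_subspaces_stabilise:
  fixes W :: "nat \<Rightarrow> ('b \<Rightarrow> 'a::field) set"
  assumes "finite T" "\<And>i. fv.subspace (W i)" "\<And>i. W i \<subseteq> fv.span T" "\<And>i. W (Suc i) \<subseteq> W i"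
  obtains i where "\<And>j. i \<le> j \<Longrightarrow> W j = W i"
proof -
  have "\<exists>B. B \<subseteq> W i \<and> fv.independent B \<and> W i \<subseteq> fv.span B" for i
    by (rule fv.maximal_independent_subset[of "W i"]) blast
  then obtain B where B: "\<And>i. B i \<subseteq> W i" "\<And>i. fv.independent (B i)" "\<And>i. W i \<subseteq> fv.span (B i)"
    by metis
  define i where "i = arg_min (\<lambda>i. card (B i)) (\<lambda>_. True)"
  have i: "card (B i) \<le> card (B j)" for j
    unfolding i_def by (rule arg_min_nat_le) simp
  have fin: "finite (B j)" for j
    using fv.independent_span_bound[OF assms(1) B(2)] B(1) assms(3) by blast
  have anti: "W j \<subseteq> W i" if "i \<le> j" for i j
    using lift_Suc_antimono_le[of W] assms(4) that by blast
  have "W j = W i" if ij: "i \<le> j" for j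
  proof (rule ccontr)
    assume "W j \<noteq> W i"
    then obtain x where x: "x \<in> W i" "x \<notin> W j" using anti[OF ij] by blast
    have "fv.span (B j) \<subseteq> W j" using B(1) assms(2) by (simp add: fv.span_minimal)
    then have x': "x \<notin> fv.span (B j)" using x by blast
    then have "fv.independent (insert x (B j))" using B(2) by (simp add: fv.independent_insertI)
    moreover have "insert x (B j) \<subseteq> fv.span (B i)" using x B anti[OF ij] by blast
    ultimately have "card (insert x (B j)) \<le> card (B i)" using fv.independent_span_bound[OF fin] by blast
    moreover have "x \<notin> B j" using x' fv.span_base by blast
    ultimately show False using fin[of j] i[of j] by simp
  qed
  then show ?thesis using that by blast
qed

section \<open>Algebraic independence\<close>

abbreviation poly_funs :: "nat \<Rightarrow> ((nat \<Rightarrow> 'a::comm_ring_1) \<Rightarrow> 'a) set"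
  where "poly_funs d \<equiv> fun_alg UNIV ((\<lambda>i v. v i) ` {..<d})"

text \<open>Over an infinite field polynomials may be identified with the functions that they define, and a
polynomial relation is trivial if it vanishes identically as a function.\<close>

definition alg_indep_on :: "'b set \<Rightarrow> nat \<Rightarrow> (nat \<Rightarrow> 'b \<Rightarrow> 'a::comm_ring_1) \<Rightarrow> bool"
  where "alg_indep_on X d y \<longleftrightarrow>
    (\<forall>F \<in> poly_funs d. (\<forall>x\<in>X. F (\<lambda>i. y i x) = 0) \<longrightarrow> (\<forall>v. F v = 0))"

lemma sum_digits: "(\<Sum>i<d. k div N ^ i mod N * N ^ i) = k mod N ^ d" for k N :: nat
proof (induction d)
  case (Suc d)
  have "k mod N ^ Suc d = N ^ d * (k div N ^ d mod N) + k mod N ^ d"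
    unfolding power_Suc2 by (rule mod_mult2_eq)
  then show ?case using Suc by (simp add: mult.commute)
qed simp

text \<open>Kronecker's substitution \<open>v\<^sub>i = t^(N^i)\<close> turns the monomials with exponents below \<open>N\<close> into distinct
powers of one variable, the digits of \<open>k\<close> in base \<open>N\<close> being the exponents of the \<open>k\<close>-th monomial.\<close>

lemma monomials_independent:
  fixes c :: "nat \<Rightarrow> 'a::{field_char_0}"
  assumes "\<And>v. (\<Sum>k<N ^ d. c k * (\<Prod>i<d. v i ^ (k div N ^ i mod N))) = 0" "k < N ^ d"
  shows "c k = 0"
proof -
  let ?p = "\<Sum>k<N ^ d. monom (c k) k"
  have "poly ?p t = 0" for t
  proof -
    have "(\<Prod>i<d. (t ^ N ^ i) ^ (k div N ^ i mod N)) = t ^ k" if "k < N ^ d" for k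
    proof -
      have "(\<Prod>i<d. (t ^ N ^ i) ^ (k div N ^ i mod N)) = t ^ (\<Sum>i<d. k div N ^ i mod N * N ^ i)"
        by (simp add: power_mult[symmetric] power_sum mult.commute)
      then show ?thesis using that by (simp add: sum_digits)
    qed
    then have "poly ?p t = (\<Sum>k<N ^ d. c k * (\<Prod>i<d. (t ^ N ^ i) ^ (k div N ^ i mod N)))"
      by (simp add: poly_sum poly_monom)
    then show ?thesis using assms(1)[of "\<lambda>i. t ^ N ^ i"] by simp
  qed
  then have "?p = 0" using poly_all_0_iff_0 by blast
  then have "coeff ?p k = 0" by simp
  then show ?thesis using assms(2) by (simp add: coeff_sum)
qed

lemma span_mult:
  fixes f g :: "'b \<Rightarrow> 'a::field"
  assumes "f \<in> fv.span S" "g \<in> fv.span T"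
    and st: "\<And>s t. s \<in> S \<Longrightarrow> t \<in> T \<Longrightarrow> (\<lambda>x. s x * t x) \<in> fv.span R"
  shows "(\<lambda>x. f x * g x) \<in> fv.span R"
proof -
  have comb: "(\<lambda>x. a x + b x) \<in> fv.span R" if "a \<in> fv.span R" "b \<in> fv.span R" for a b
    using fv.span_add[OF that] by (simp add: plus_fun_def)
  have zero: "(\<lambda>x. 0) \<in> fv.span R" using fv.span_zero[of R] by (simp add: zero_fun_def)
  have 1: "(\<lambda>x. s x * g x) \<in> fv.span R" if "s \<in> S" for s
    using assms(2)
  proof (induction rule: fv.span_induct_alt)
    case base then show ?case using zero by simp
  next
    case (step c t h)
    have "(\<lambda>x. c * (s x * t x)) \<in> fv.span R" by (rule fv.span_scale[OF st[OF that step(1)]])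
    from comb[OF this step(2)] show ?case by (simp add: algebra_simps)
  qed
  show ?thesis using assms(1)
  proof (induction rule: fv.span_induct_alt)
    case base then show ?case using zero by simp
  next
    case (step c t h)
    have "(\<lambda>x. c * (t x * g x)) \<in> fv.span R" by (rule fv.span_scale[OF 1[OF step(1)]])
    from comb[OF this step(2)] show ?case by (simp add: algebra_simps)
  qed
qed

text \<open>Count monomials. The \<open>N^d\<close> monomials in the \<open>y\<^sub>i\<close> with exponents below \<open>N\<close> are linearly independent, but
they lie in the span of the monomials in the \<open>z\<^sub>i\<close> with exponents at most \<open>D d N\<close> for a constant \<open>D\<close>, and
there are only \<open>(D d N + 1)^n\<close> of these. This is impossible for large \<open>N\<close> if \<open>d > n\<close>.\<close>

theorem alg_indep_on_le:
  fixes y z :: "nat \<Rightarrow> 'b \<Rightarrow> 'a::field_char_0"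
  assumes indep: "alg_indep_on X d y" and y: "\<And>i. i < d \<Longrightarrow> y i \<in> fun_alg X (z ` {..<n})"
  shows "d \<le> n"
proof -
  \<comment> \<open>Cutting off outside \<open>X\<close> turns agreement on \<open>X\<close> into equality, as required for linear algebra.\<close>
  define R where "R = (\<lambda>(f :: 'b \<Rightarrow> 'a) x. if x \<in> X then f x else 0)"
  define M where "M = (\<lambda>e :: nat \<Rightarrow> nat. R (\<lambda>x. \<Prod>i<n. z i x ^ e i))"
  define T where "T = (\<lambda>D. M ` ({..<n} \<rightarrow>\<^sub>E {..D}))"
  have fin: "finite (T D)" for D
    unfolding T_def by (intro finite_imageI finite_PiE) auto
  have card: "card (T D) \<le> Suc D ^ n" for D
  proof -
    have "card (T D) \<le> card ({..<n} \<rightarrow>\<^sub>E {..D})"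
      unfolding T_def by (intro card_image_le finite_PiE) auto
    then show ?thesis by (simp add: card_PiE)
  qed
  have M: "M e \<in> T D" if "\<And>i. i < n \<Longrightarrow> e i \<le> D" for e D
    unfolding T_def
  proof (rule image_eqI)
    show "M e = M (restrict e {..<n})" by (simp add: M_def R_def fun_eq_iff)
    show "restrict e {..<n} \<in> {..<n} \<rightarrow>\<^sub>E {..D}" using that by auto
  qed
  have T_mono: "fv.span (T D) \<subseteq> fv.span (T E)" if "D \<le> E" for D E
    using that M unfolding T_def by (intro fv.span_mono image_mono PiE_mono) auto
  have R_mult: "R (\<lambda>x. f x * g x) \<in> fv.span (T (D + E))"
    if "R f \<in> fv.span (T D)" "R g \<in> fv.span (T E)" for f g D E
  proof -
    have "(\<lambda>x. s x * t x) \<in> fv.span (T (D + E))" if st: "s \<in> T D" "t \<in> T E" for s t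
    proof -
      obtain a b where ab: "s = M a" "a \<in> {..<n} \<rightarrow>\<^sub>E {..D}" "t = M b" "b \<in> {..<n} \<rightarrow>\<^sub>E {..E}"
        using st unfolding T_def by blast
      then have "(\<lambda>x. s x * t x) = M (\<lambda>i. a i + b i)"
        by (auto simp: M_def R_def fun_eq_iff power_add prod.distrib)
      moreover have "M (\<lambda>i. a i + b i) \<in> T (D + E)"
        using ab by (intro M add_mono) auto
      ultimately show ?thesis using fv.span_base by metis
    qed
    from span_mult[OF that this] have "(\<lambda>x. R f x * R g x) \<in> fv.span (T (D + E))" .
    moreover have "(\<lambda>x. R f x * R g x) = R (\<lambda>x. f x * g x)" by (auto simp: R_def)
    ultimately show ?thesis by simp
  qed
  have one: "R (\<lambda>_. 1) \<in> fv.span (T D)" for D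
  proof -
    have "R (\<lambda>_. 1) = M (\<lambda>_. 0)" by (simp add: M_def)
    then show ?thesis using M[of "\<lambda>_. 0" D] fv.span_base by auto
  qed
  have "\<exists>D. R f \<in> fv.span (T D)" if "f \<in> fun_alg X (z ` {..<n})" for f
    using that
  proof induction
    case (const c)
    have "R (\<lambda>_. c) = (\<lambda>x. c * R (\<lambda>_. 1) x)" by (auto simp: R_def)
    then show ?case using fv.span_scale[OF one] by metis
  next
    case (gen f)
    then obtain i where i: "i < n" "f = z i" by auto
    have "R f = M (\<lambda>j. if j = i then 1 else 0)"
      unfolding M_def using i by (auto intro!: arg_cong[of _ _ R] simp: if_distrib prod.delta cong: if_cong)
    moreover have "M (\<lambda>j. if j = i then 1 else 0) \<in> T 1" by (rule M) auto
    ultimately show ?case using fv.span_base by metis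
  next
    case (add f g)
    then obtain D E where "R f \<in> fv.span (T D)" "R g \<in> fv.span (T E)" by auto
    then have "R f + R g \<in> fv.span (T (D + E))"
      using T_mono[of D "D + E"] T_mono[of E "D + E"] by (intro fv.span_add) auto
    moreover have "R f + R g = R (\<lambda>x. f x + g x)" by (auto simp: R_def)
    ultimately show ?case by auto
  next
    case (mult f g)
    then show ?case using R_mult by blast
  next
    case (cong f g)
    then have "R f = R g" by (auto simp: R_def)
    then show ?case using cong by simp
  qed
  then have "\<forall>i\<in>{..<d}. \<exists>D. R (y i) \<in> fv.span (T D)" using y by blast
  then obtain Dy where Dy: "\<And>i. i < d \<Longrightarrow> R (y i) \<in> fv.span (T (Dy i))" by (metis lessThan_iff)
  define D where "D = (\<Sum>i<d. Dy i)"
  have D: "R (y i) \<in> fv.span (T D)" if "i < d" for i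
    using Dy[OF that] T_mono[of "Dy i" D] member_le_sum[of i "{..<d}" Dy] that by (auto simp: D_def)
  have pow: "R (\<lambda>x. y i x ^ j) \<in> fv.span (T (D * j))" if "i < d" for i j
  proof (induction j)
    case (Suc j)
    from R_mult[OF D[OF that] this] show ?case by simp
  qed (simp add: one)
  have mono: "R (\<lambda>x. \<Prod>i<d'. y i x ^ e i) \<in> fv.span (T (D * (\<Sum>i<d'. e i)))" if "d' \<le> d" for d' e
    using that
  proof (induction d')
    case (Suc d')
    from R_mult[OF Suc.IH pow[of d' "e d'"]] Suc.prems show ?case by (simp add: algebra_simps)
  qed (simp add: one)
  show ?thesis
  proof (rule ccontr)
    assume "\<not> d \<le> n"
    define C where "C = D * d + 1"
    \<comment> \<open>With this \<open>N\<close> one has \<open>(C N)^n = C^n N^n < N^(n+1) \<le> N^d\<close>.\<close>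
    define N where "N = C ^ n + 1"
    define f where "f = (\<lambda>k. R (\<lambda>x. \<Prod>i<d. y i x ^ (k div N ^ i mod N)))"
    have N0: "N > 0" by (simp add: N_def)
    have "f k \<in> fv.span (T (D * d * N))" for k
    proof -
      have "(\<Sum>i<d. k div N ^ i mod N) \<le> (\<Sum>i<d. N)"
        by (intro sum_mono) (simp add: N0 less_imp_le)
      then have "D * (\<Sum>i<d. k div N ^ i mod N) \<le> D * d * N" by (simp add: algebra_simps)
      then show ?thesis unfolding f_def using mono[of d] T_mono by blast
    qed
    moreover have "card (T (D * d * N)) < N ^ d"
    proof -
      have "Suc (D * d * N) \<le> C * N" using N0 by (simp add: C_def algebra_simps)
      then have "card (T (D * d * N)) \<le> (C * N) ^ n"
        using card[of "D * d * N"] by (meson order.trans power_mono zero_le)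
      also have "\<dots> = C ^ n * N ^ n" by (simp add: power_mult_distrib)
      also have "\<dots> < N * N ^ n" using N0 by (simp add: N_def)
      also have "\<dots> \<le> N ^ d" using \<open>\<not> d \<le> n\<close> N0 power_increasing[of "Suc n" d N] by simp
      finally show ?thesis .
    qed
    ultimately obtain c where c: "\<exists>k<N ^ d. c k \<noteq> 0" "\<And>x. (\<Sum>k<N ^ d. c k * f k x) = 0"
      using finite_span_dependent[OF fin, of "N ^ d" f "D * d * N"] by blast
    define F where "F = (\<lambda>v. \<Sum>k<N ^ d. c k * (\<Prod>i<d. v i ^ (k div N ^ i mod N)))"
    have "F \<in> poly_funs d"
      unfolding F_def
      by (intro fun_alg_sum fun_alg.mult fun_alg.const fun_alg_prod fun_alg_power fun_alg.gen) auto
    moreover have "F (\<lambda>i. y i x) = 0" if "x \<in> X" for x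
      using c(2)[of x] that by (simp add: F_def f_def R_def)
    ultimately have "F v = 0" for v using indep by (auto simp: alg_indep_on_def)
    then show False using monomials_independent[where N = N and d = d and c = c] c(1) unfolding F_def by blast
  qed
qed

lemma alg_indep_on_surj:
  assumes "\<And>v. \<exists>x\<in>X. \<forall>i<d. y i x = v i"
  shows "alg_indep_on X d y"
  unfolding alg_indep_on_def
proof (intro ballI impI allI)
  fix F :: "(nat \<Rightarrow> 'a) \<Rightarrow> 'a" and v assume F: "F \<in> poly_funs d" and 0: "\<forall>x\<in>X. F (\<lambda>i. y i x) = 0"
  obtain x where "x \<in> X" "\<forall>i<d. y i x = v i" using assms by blast
  then have "F v = F (\<lambda>i. y i x)" by (intro fun_alg_const_on[OF F]) auto
  then show "F v = 0" using 0 \<open>x \<in> X\<close> by simp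
qed

text \<open>The coefficients with respect to the last variable are needed to cancel powers of that variable from a
relation.\<close>

lemma poly_funs_Suc:
  assumes "F \<in> poly_funs (Suc d)"
  shows "\<exists>M G. (\<forall>j. G j \<in> poly_funs d) \<and> (\<forall>v. F v = (\<Sum>j<M. v d ^ j * G j v))"
  using assms
proof induction
  case (const c)
  show ?case by (rule exI[of _ 1], rule exI[of _ "\<lambda>_ _. c"]) (auto intro: fun_alg.const)
next
  case (gen f)
  then obtain i where i: "i \<le> d" "f = (\<lambda>v. v i)" using less_Suc_eq_le by blast
  show ?case
  proof (cases "i = d")
    case True
    show ?thesis
      by (rule exI[of _ 2], rule exI[of _ "\<lambda>j _. if j = 1 then 1 else 0"])
        (auto intro: fun_alg.const simp: i True numeral_2_eq_2)
  next
    case False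
    then show ?thesis using i
      by (intro exI[of _ 1] exI[of _ "\<lambda>_. f"]) (auto intro: fun_alg.gen)
  qed
next
  case (add f g)
  then obtain M G N H where
    G: "\<forall>j. G j \<in> poly_funs d" "\<forall>v. f v = (\<Sum>j<M. v d ^ j * G j v)" and
    H: "\<forall>j. H j \<in> poly_funs d" "\<forall>v. g v = (\<Sum>j<N. v d ^ j * H j v)" by blast
  define K where "K = (\<lambda>j v. (if j < M then G j v else 0) + (if j < N then H j v else 0))"
  have "K j \<in> poly_funs d" for j
    unfolding K_def using G(1) H(1)
    by (intro fun_alg.add) (cases "j < M"; cases "j < N"; auto intro: fun_alg.const)+
  moreover have "f v + g v = (\<Sum>j<max M N. v d ^ j * K j v)" for v
  proof -
    have "(\<Sum>j<M. v d ^ j * G j v) = (\<Sum>j<max M N. v d ^ j * (if j < M then G j v else 0))"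
      by (rule sum.mono_neutral_cong_left) auto
    moreover have "(\<Sum>j<N. v d ^ j * H j v) = (\<Sum>j<max M N. v d ^ j * (if j < N then H j v else 0))"
      by (rule sum.mono_neutral_cong_left) auto
    ultimately show ?thesis using G(2) H(2)
      by (simp add: K_def distrib_left sum.distrib)
  qed
  ultimately show ?case by blast
next
  case (mult f g)
  then obtain M G N H where
    G: "\<forall>j. G j \<in> poly_funs d" "\<forall>v. f v = (\<Sum>j<M. v d ^ j * G j v)" and
    H: "\<forall>j. H j \<in> poly_funs d" "\<forall>v. g v = (\<Sum>j<N. v d ^ j * H j v)" by blast
  define S where "S = {..<M} \<times> {..<N}"
  define K where "K = (\<lambda>j v. \<Sum>p\<in>{p\<in>S. fst p + snd p = j}. G (fst p) v * H (snd p) v)"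
  have "K j \<in> poly_funs d" for j
    unfolding K_def using G(1) H(1) by (intro fun_alg_sum fun_alg.mult) auto
  moreover have "f v * g v = (\<Sum>j<M + N. v d ^ j * K j v)" for v
  proof -
    have "f v * g v = (\<Sum>p\<in>S. v d ^ (fst p + snd p) * (G (fst p) v * H (snd p) v))"
      using G(2) H(2) by (simp add: S_def sum_product sum.cartesian_product power_add case_prod_unfold mult_ac)
    also have "\<dots> = (\<Sum>j<M + N. \<Sum>p\<in>{p\<in>S. fst p + snd p = j}. v d ^ (fst p + snd p) * (G (fst p) v * H (snd p) v))"
      by (rule sum.group[symmetric]) (auto simp: S_def)
    also have "\<dots> = (\<Sum>j<M + N. v d ^ j * K j v)"
      by (simp add: K_def sum_distrib_left)
    finally show ?thesis .
  qed
  ultimately show ?case by blast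
next
  case (cong f g)
  then show ?case by auto
qed

text \<open>This is the strict growth of the transcendence degree along a chain of primes. In a relation between \<open>q\<close>
and the \<open>y\<^sub>i\<close> on \<open>Y\<close>, a common power of \<open>q\<close> can be cancelled because \<open>Y\<close> is irreducible and \<open>q\<close> does not
vanish on it; restriction to \<open>X\<close>, where \<open>q\<close> vanishes, then leaves a relation between the \<open>y\<^sub>i\<close> alone, which
is the lowest coefficient.\<close>

lemma alg_indep_on_extend:
  fixes y :: "nat \<Rightarrow> 'b \<Rightarrow> 'a::idom"
  assumes indep: "alg_indep_on X d y" and "X \<subseteq> Y"
    and q: "\<And>x. x \<in> X \<Longrightarrow> q x = 0" "w \<in> Y" "q w \<noteq> 0"
    and alg: "\<And>i. i < d \<Longrightarrow> y i \<in> fun_alg Z S" "q \<in> fun_alg Z S"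
    and irred: "\<And>f g. f \<in> fun_alg Z S \<Longrightarrow> g \<in> fun_alg Z S \<Longrightarrow> (\<forall>x\<in>Y. f x * g x = 0) \<Longrightarrow>
      (\<forall>x\<in>Y. f x = 0) \<or> (\<forall>x\<in>Y. g x = 0)"
  shows "alg_indep_on Y (Suc d) (\<lambda>i. if i < d then y i else q)"
  unfolding alg_indep_on_def
proof (intro ballI impI)
  let ?y = "\<lambda>i. if i < d then y i else q"
  fix F :: "(nat \<Rightarrow> 'a) \<Rightarrow> 'a" assume F_in: "F \<in> poly_funs (Suc d)" and F0: "\<forall>x\<in>Y. F (\<lambda>i. ?y i x) = 0"
  obtain M G where "\<forall>j. G j \<in> poly_funs d" "\<forall>v. F v = (\<Sum>j<M. v d ^ j * G j v)"
    using poly_funs_Suc[OF F_in] by blast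
  then have G: "G j \<in> poly_funs d" and F: "F v = (\<Sum>j<M. v d ^ j * G j v)" for j v
    by blast+
  have alg': "(\<lambda>x. H (\<lambda>i. ?y i x)) \<in> fun_alg Z S" if "H \<in> poly_funs d" for H
    by (rule fun_alg_comp[OF that]) (use alg in auto)
  have "\<forall>v. G j v = 0" if "j < M" for j
    using that
  proof (induction j rule: less_induct)
    case (less j)
    \<comment> \<open>All coefficients below the \<open>j\<close>-th vanish, so the relation is \<open>q^j (G\<^sub>j + q P) = 0\<close>.\<close>
    define P where "P = (\<lambda>x. \<Sum>i<M - Suc j. q x ^ i * G (Suc j + i) (\<lambda>i. ?y i x))"
    define Q where "Q = (\<lambda>x. G j (\<lambda>i. ?y i x) + q x * P x)"
    have P: "P \<in> fun_alg Z S"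
      unfolding P_def using alg(2) alg' G by (intro fun_alg_sum fun_alg.mult fun_alg_power) auto
    have Q: "Q \<in> fun_alg Z S" unfolding Q_def
      using alg(2) alg' G P by (intro fun_alg.add fun_alg.mult) auto
    have split: "F (\<lambda>i. ?y i x) = q x ^ j * Q x" for x
    proof -
      let ?v = "\<lambda>i. ?y i x"
      have "F ?v = (\<Sum>i<M. q x ^ i * G i ?v)" by (simp add: F)
      also have "\<dots> = (\<Sum>i\<in>{j..<M}. q x ^ i * G i ?v)"
        using less by (intro sum.mono_neutral_right) auto
      also have "\<dots> = q x ^ j * G j ?v + (\<Sum>i\<in>{Suc j..<M}. q x ^ i * G i ?v)"
        using less.prems by (simp add: sum.atLeast_Suc_lessThan)
      also have "(\<Sum>i\<in>{Suc j..<M}. q x ^ i * G i ?v) =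
          (\<Sum>i<M - Suc j. q x ^ (Suc j + i) * G (Suc j + i) ?v)"
        by (rule sum.reindex_bij_witness[of _ "\<lambda>i. Suc j + i" "\<lambda>i. i - Suc j"]) auto
      also have "\<dots> = q x ^ j * (q x * P x)"
        by (simp add: P_def sum_distrib_left power_add mult_ac)
      finally show ?thesis by (simp add: Q_def algebra_simps)
    qed
    have "\<forall>x\<in>Y. (q x ^ k * Q x = 0) \<Longrightarrow> \<forall>x\<in>Y. Q x = 0" for k
    proof (induction k)
      case (Suc k)
      then have "\<forall>x\<in>Y. q x * (q x ^ k * Q x) = 0" by (simp add: mult.assoc)
      moreover have "(\<lambda>x. q x ^ k * Q x) \<in> fun_alg Z S"
        using alg(2) Q by (intro fun_alg.mult fun_alg_power)
      ultimately have "\<forall>x\<in>Y. q x ^ k * Q x = 0" using irred[OF alg(2)] q(2,3) by blast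
      then show ?case by (rule Suc.IH)
    qed simp
    then have "\<forall>x\<in>Y. Q x = 0" using F0 split by simp
    then have "G j (\<lambda>i. y i x) = 0" if "x \<in> X" for x
    proof -
      have "Q x = 0" "q x = 0" using \<open>\<forall>x\<in>Y. Q x = 0\<close> that q(1) \<open>X \<subseteq> Y\<close> by auto
      then have "G j (\<lambda>i. ?y i x) = 0" by (simp add: Q_def)
      moreover have "G j (\<lambda>i. ?y i x) = G j (\<lambda>i. y i x)"
        by (rule fun_alg_const_on[OF G]) auto
      ultimately show ?thesis by simp
    qed
    then show ?case using indep G unfolding alg_indep_on_def by blast
  qed
  then show "\<forall>v. F v = 0" by (simp add: F)
qed

section \<open>Algebras of nilpotent matrices\<close>

definition mat_trace :: "'a::comm_ring_1 mat \<Rightarrow> 'a"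
  where "mat_trace A = (\<Sum>i<dim_row A. A $$ (i, i))"

lemma mat_trace_add:
  "A \<in> carrier_mat m m \<Longrightarrow> B \<in> carrier_mat m m \<Longrightarrow> mat_trace (A + B) = mat_trace A + mat_trace B"
  by (auto simp: mat_trace_def sum.distrib)

lemma mat_trace_smult: "A \<in> carrier_mat m m \<Longrightarrow> mat_trace (c \<cdot>\<^sub>m A) = c * mat_trace A"
  by (auto simp: mat_trace_def sum_distrib_left)

lemma char_poly_matrix_mat_delete:
  assumes "A \<in> carrier_mat m m" "i < m"
  shows "char_poly_matrix (mat_delete A i i) = mat_delete (char_poly_matrix A) i i"
  by (rule eq_matI) (use assms in \<open>auto simp: char_poly_matrix_def mat_delete_def\<close>)

text \<open>Traces of powers determine the characteristic polynomial \<open>\<chi>\<close> of \<open>N\<close> in characteristic zero. The link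
is the sequence of polynomials \<open>tr (N^j adj (x - N))\<close>, called \<open>adj_trace\<close> below, whose first member is
the derivative of \<open>\<chi>\<close> and whose degrees stay below \<open>m\<close>.\<close>

locale char_adj =
  fixes m :: nat and N :: "'a::field_char_0 mat"
  assumes N: "N \<in> carrier_mat m m" and m: "m > 0"
begin

definition adj where "adj = adj_mat (char_poly_matrix N)"
definition Npow where "Npow j = map_mat (\<lambda>a. [:a:]) (N ^\<^sub>m j)"
definition adj_trace where "adj_trace j = mat_trace (Npow j * adj)"

lemma adj: "adj \<in> carrier_mat m m" "char_poly_matrix N * adj = char_poly N \<cdot>\<^sub>m 1\<^sub>m m"
  using adj_mat[of "char_poly_matrix N" m] N by (auto simp: adj_def char_poly_def)

lemma Npow: "Npow j \<in> carrier_mat m m"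
  using N by (simp add: Npow_def)

text \<open>Take the trace of \<open>N^j (x - N) adj (x - N) = \<chi> N^j\<close>.\<close>

lemma adj_trace_rec: "[:0, 1:] * adj_trace j = adj_trace (Suc j) + char_poly N * [:mat_trace (N ^\<^sub>m j):]"
proof -
  have dims: "N \<in> carrier_mat m m" "Npow j \<in> carrier_mat m m" "N ^\<^sub>m j \<in> carrier_mat m m"
    using N Npow by auto
  have C: "char_poly_matrix N = [:0, 1:] \<cdot>\<^sub>m 1\<^sub>m m + (-1) \<cdot>\<^sub>m map_mat (\<lambda>a. [:a:]) N"
    using N unfolding char_poly_matrix_def by (intro eq_matI) auto
  have NC: "Npow j * char_poly_matrix N = [:0, 1:] \<cdot>\<^sub>m Npow j + (-1) \<cdot>\<^sub>m Npow (Suc j)"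
  proof -
    have "Npow j * char_poly_matrix N = Npow j * ([:0, 1:] \<cdot>\<^sub>m 1\<^sub>m m) + Npow j * ((-1) \<cdot>\<^sub>m map_mat (\<lambda>a. [:a:]) N)"
      unfolding C by (rule mult_add_distrib_mat) (use dims in auto)
    also have "Npow j * ([:0, 1:] \<cdot>\<^sub>m 1\<^sub>m m) = [:0, 1:] \<cdot>\<^sub>m Npow j"
      using dims by (subst mult_smult_distrib) auto
    also have "Npow j * ((-1) \<cdot>\<^sub>m map_mat (\<lambda>a. [:a:]) N) = (-1) \<cdot>\<^sub>m (Npow j * map_mat (\<lambda>a. [:a:]) N)"
      using dims by (subst mult_smult_distrib) auto
    also have "Npow j * map_mat (\<lambda>a. [:a:]) N = Npow (Suc j)"
      unfolding Npow_def using map_poly_mult(1)[OF dims(3,1)] by simp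
    finally show ?thesis .
  qed
  have "char_poly N \<cdot>\<^sub>m Npow j = Npow j * (char_poly_matrix N * adj)"
    unfolding adj(2) using dims by (subst mult_smult_distrib) auto
  also have "\<dots> = Npow j * char_poly_matrix N * adj"
    by (rule assoc_mult_mat[symmetric]) (use dims adj in auto)
  also have "\<dots> = [:0, 1:] \<cdot>\<^sub>m Npow j * adj + (-1) \<cdot>\<^sub>m Npow (Suc j) * adj"
    unfolding NC by (rule add_mult_distrib_mat[of _ m m]) (use Npow adj in auto)
  also have "\<dots> = [:0, 1:] \<cdot>\<^sub>m (Npow j * adj) + (-1) \<cdot>\<^sub>m (Npow (Suc j) * adj)"
    using Npow adj by (subst (1 2) mult_smult_assoc_mat) auto
  finally have "mat_trace (char_poly N \<cdot>\<^sub>m Npow j) = [:0, 1:] * adj_trace j + (-1) * adj_trace (Suc j)"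
    using mult_carrier_mat[OF Npow adj(1)]
    by (simp only: mat_trace_add[where m = m] mat_trace_smult[where m = m] smult_carrier_mat adj_trace_def)
  moreover have "mat_trace (Npow j) = [:mat_trace (N ^\<^sub>m j):]"
  proof -
    have "(\<Sum>i\<in>I. [:f i:]) = [:\<Sum>i\<in>I. f i:]" for f :: "nat \<Rightarrow> 'a" and I
      by (induction I rule: infinite_finite_induct) auto
    then show ?thesis using N by (simp add: mat_trace_def Npow_def)
  qed
  ultimately show ?thesis using Npow by (simp add: mat_trace_smult[of _ m] algebra_simps)
qed

lemma degree_adj_trace: "degree (adj_trace j) \<le> m - 1"
proof -
  have deg: "degree (adj $$ (i, k)) \<le> m - 1" if "i < m" "k < m" for i k
  proof -
    have "degree (det (mat_delete (char_poly_matrix N) k i)) \<le> 1 * (m - 1)"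
    proof (rule degree_det_le)
      show "mat_delete (char_poly_matrix N) k i \<in> carrier_mat (m - 1) (m - 1)"
        by (rule mat_delete_carrier) (use N in auto)
      fix a b assume "a < m - 1" "b < m - 1"
      then show "degree (mat_delete (char_poly_matrix N) k i $$ (a, b)) \<le> 1"
        using N unfolding mat_delete_def char_poly_matrix_def by auto
    qed
    moreover have "adj $$ (i, k) = (-1) ^ (k + i) * det (mat_delete (char_poly_matrix N) k i)"
      using that N by (simp add: adj_def adj_mat_def cofactor_def char_poly_matrix_def)
    moreover have "degree ((-1) ^ l * p) = degree p" for l and p :: "'a poly"
      by (cases "even l") auto
    ultimately show ?thesis by simp
  qed
  have "adj_trace j = (\<Sum>i<m. \<Sum>k<m. Npow j $$ (i, k) * adj $$ (k, i))"
    using Npow[of j] adj(1) by (simp add: adj_trace_def mat_trace_def scalar_prod_def atLeast0LessThan)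
  moreover have "degree (Npow j $$ (i, k) * adj $$ (k, i)) \<le> m - 1" if "i < m" "k < m" for i k
    using degree_mult_le[of "Npow j $$ (i, k)" "adj $$ (k, i)"] deg that N by (auto simp: Npow_def intro: le_trans)
  ultimately show ?thesis by (auto intro!: degree_sum_le)
qed

lemma adj_trace_0: "adj_trace 0 = pderiv (char_poly N)"
proof -
  have "adj_trace 0 = (\<Sum>i<m. adj $$ (i, i))"
  proof -
    have "Npow 0 = 1\<^sub>m m" using N by (auto simp: Npow_def)
    then show ?thesis using adj by (simp add: adj_trace_def mat_trace_def)
  qed
  also have "\<dots> = (\<Sum>i<m. char_poly (mat_delete N i i))"
  proof (rule sum.cong)
    fix i assume "i \<in> {..<m}"
    then show "adj $$ (i, i) = char_poly (mat_delete N i i)"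
      using N by (simp add: adj_def adj_mat_def cofactor_def char_poly_def
          char_poly_matrix_mat_delete[of N m] carrier_matD[OF char_poly_matrix_closed[OF N]] power_add[symmetric])
  qed simp
  finally show ?thesis by (simp add: pderiv_char_poly[OF N])
qed

lemma adj_trace_0_imp:
  assumes "[:0, 1:] * adj_trace i = adj_trace j + char_poly N * [:c:]"
  shows "adj_trace i = 0 \<Longrightarrow> c = 0"
proof (rule ccontr)
  assume "adj_trace i = 0" "c \<noteq> 0"
  have "degree (char_poly N) = m" using degree_monic_char_poly[OF N] by simp
  then have "degree (char_poly N * [:c:]) = m" using \<open>c \<noteq> 0\<close> by simp
  moreover have "char_poly N * [:c:] = - adj_trace j" using assms \<open>adj_trace i = 0\<close> by (simp add: eq_neg_iff_add_eq_0 add.commute)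
  ultimately have "degree (adj_trace j) = m" by (metis degree_minus)
  then show False using degree_adj_trace[of j] m by linarith
qed

text \<open>The recursion becomes multiplication by \<open>x\<close>, which is compatible with the bound on the degrees only if
\<open>adj_trace 1 = 0\<close>. The recursion at \<open>0\<close> then reads \<open>x \<chi>' = m \<chi>\<close>, so all coefficients but the leading
one vanish.\<close>

lemma char_poly_if_traces_0:
  assumes "\<And>j. j \<ge> 1 \<Longrightarrow> mat_trace (N ^\<^sub>m j) = 0"
  shows "char_poly N = monom 1 m"
proof -
  have adj_trace_Suc: "adj_trace (Suc j) = monom 1 j * adj_trace 1" for j
  proof (induction j)
    case (Suc j)
    have "adj_trace (Suc (Suc j)) = [:0, 1:] * adj_trace (Suc j)" using adj_trace_rec[of "Suc j"] assms[of "Suc j"] by simp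
    also have "\<dots> = monom 1 (Suc j) * adj_trace 1" by (simp only: Suc monom_Suc) simp
    finally show ?case .
  qed simp
  have "degree (monom 1 m * adj_trace 1) \<le> m - 1"
    unfolding adj_trace_Suc[symmetric] by (rule degree_adj_trace)
  moreover have "degree (monom 1 m * adj_trace 1) = m + degree (adj_trace 1)" if "adj_trace 1 \<noteq> 0"
    using that by (subst degree_mult_eq) (auto simp: degree_monom_eq monom_eq_0_iff)
  ultimately have t1: "adj_trace 1 = 0" using m by (metis Nat.add_0_right add_leE diff_less leD less_one)
  have "mat_trace (N ^\<^sub>m 0) = of_nat m" using N by (simp add: mat_trace_def)
  then have eq: "[:0, 1:] * pderiv (char_poly N) = char_poly N * [:of_nat m:]"
    using adj_trace_rec[of 0] t1 by (simp add: adj_trace_0)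
  show ?thesis
  proof (rule poly_eqI)
    fix i
    have "coeff ([:0, 1:] * pderiv (char_poly N)) i = of_nat i * coeff (char_poly N) i"
      by (cases i) (simp_all add: coeff_pderiv)
    then have "of_nat i * coeff (char_poly N) i = of_nat m * coeff (char_poly N) i"
      unfolding eq by auto
    then have "coeff (char_poly N) i = 0 \<or> i = m" by (metis mult_cancel_right of_nat_eq_iff)
    then show "coeff (char_poly N) i = coeff (monom 1 m) i"
      using degree_monic_char_poly[OF N] by (metis coeff_monom)
  qed
qed

lemma trace_0_if_char_poly:
  assumes "char_poly N = monom 1 m"
  shows "mat_trace N = 0"
proof -
  have "mat_trace (N ^\<^sub>m 0) = of_nat m" using N by (simp add: mat_trace_def)
  moreover have "[:0, 1:] * pderiv (monom (1::'a) m) = monom 1 m * [:of_nat m:]"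
    using m by (intro poly_eqI) (auto simp: coeff_pderiv coeff_pCons split: nat.split)
  ultimately have t1: "adj_trace 1 = 0" using adj_trace_rec[of 0] by (simp add: adj_trace_0 assms)
  from adj_trace_0_imp[OF adj_trace_rec t1] have "mat_trace (N ^\<^sub>m 1) = 0" .
  then show ?thesis using N by simp
qed

end

lemma mat_pow_add: "A \<in> carrier_mat m m \<Longrightarrow> A ^\<^sub>m (i + j) = A ^\<^sub>m i * A ^\<^sub>m j"
proof (induction j)
  case (Suc j)
  then show ?case using assoc_mult_mat[of "A ^\<^sub>m i" m m "A ^\<^sub>m j" m A m] by simp
qed simp

text \<open>All eigenvalues vanish, and over an algebraically closed field these are all the roots.\<close>

lemma char_poly_nilpotent:
  fixes N :: "'a::{alg_closed_field, field_char_0} mat"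
  assumes N: "N \<in> carrier_mat m m" and nil: "N ^\<^sub>m k = 0\<^sub>m m m"
  shows "char_poly N = monom 1 m"
proof -
  have root: "c = 0" if "poly (char_poly N) c = 0" for c
  proof -
    from that obtain v where v: "eigenvector N v c"
      using eigenvalue_root_char_poly[OF N] by (auto simp: eigenvalue_def)
    have v': "v \<in> carrier_vec m" "v \<noteq> 0\<^sub>v m" using v N by (auto simp: eigenvector_def)
    have "0\<^sub>m m m *\<^sub>v v = 0\<^sub>v m" using v' by (intro eq_vecI) auto
    then have "c ^ k \<cdot>\<^sub>v v = 0\<^sub>v m" using eigenvector_pow[OF N v, of k] nil v' by simp
    moreover obtain i where "i < m" "v $ i \<noteq> 0"
    proof -
      have "\<exists>i<m. v $ i \<noteq> 0"
      proof (rule ccontr)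
        assume "\<not> (\<exists>i<m. v $ i \<noteq> 0)"
        then have "v = 0\<^sub>v m" using v' by (intro eq_vecI) auto
        then show False using v' by simp
      qed
      then show ?thesis using that by blast
    qed
    ultimately have "c ^ k * v $ i = 0" using v' by (metis index_smult_vec(1) index_zero_vec(1) carrier_vecD)
    then show ?thesis using \<open>v $ i \<noteq> 0\<close> by simp
  qed
  obtain A where A: "size A = degree (char_poly N)"
      "char_poly N = smult (lead_coeff (char_poly N)) (\<Prod>x\<in>#A. [:-x, 1:])"
    using alg_closed_imp_factorization[of "char_poly N"] degree_monic_char_poly[OF N] by fastforce
  then have A': "size A = m" "char_poly N = (\<Prod>x\<in>#A. [:-x, 1:])"
    using degree_monic_char_poly[OF N] by auto
  have "x = 0" if "x \<in># A" for x
  proof (rule root)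
    have "[:-x, 1:] dvd char_poly N" unfolding A'(2) by (rule dvd_prod_mset) (use that in auto)
    then show "poly (char_poly N) x = 0" by (simp add: poly_eq_0_iff_dvd)
  qed
  then have "image_mset (\<lambda>x. [:-x, 1:]) A = image_mset (\<lambda>x. [:0, 1:]) A" by (intro image_mset_cong) auto
  then have "char_poly N = [:0, 1:] ^ m" using A' by (simp add: prod_mset_constant)
  then show ?thesis by (simp add: monom_altdef)
qed

lemma trace_nilpotent:
  fixes N :: "'a::{alg_closed_field, field_char_0} mat"
  assumes N: "N \<in> carrier_mat m m" and nil: "N ^\<^sub>m k = 0\<^sub>m m m"
  shows "mat_trace N = 0"
proof (cases "m = 0")
  case True
  then show ?thesis using N by (simp add: mat_trace_def)
next
  case False
  then interpret char_adj m N using N by unfold_locales auto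
  show ?thesis by (rule trace_0_if_char_poly[OF char_poly_nilpotent[OF N nil]])
qed

text \<open>The span of the \<open>g - 1\<close> is closed under multiplication since
\<open>(g - 1)(h - 1) = (gh - 1) - (g - 1) - (h - 1)\<close>. As the trace is linear and vanishes on nilpotent
matrices, it vanishes on the whole span.\<close>

inductive_set augmentation :: "nat \<Rightarrow> 'a::field mat set \<Rightarrow> 'a mat set" for m G where
  gen: "g \<in> G \<Longrightarrow> g - 1\<^sub>m m \<in> augmentation m G"
| add: "a \<in> augmentation m G \<Longrightarrow> b \<in> augmentation m G \<Longrightarrow> a + b \<in> augmentation m G"
| smult: "a \<in> augmentation m G \<Longrightarrow> c \<cdot>\<^sub>m a \<in> augmentation m G"

locale unipotent_monoid =
  fixes m :: nat and G :: "'a::{alg_closed_field, field_char_0} mat set"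
  assumes unip: "\<And>g. g \<in> G \<Longrightarrow> unipotent_mat m g"
    and closed: "\<And>g h. g \<in> G \<Longrightarrow> h \<in> G \<Longrightarrow> g * h \<in> G"
    and one: "1\<^sub>m m \<in> G"
begin

lemma carrier: "g \<in> G \<Longrightarrow> g \<in> carrier_mat m m"
  using unip by (auto simp: unipotent_mat_def)

lemma aug_carrier: "a \<in> augmentation m G \<Longrightarrow> a \<in> carrier_mat m m"
  by (induction rule: augmentation.induct) (auto dest: carrier)

lemma aug_trace: "a \<in> augmentation m G \<Longrightarrow> mat_trace a = 0"
proof (induction rule: augmentation.induct)
  case (gen g)
  then obtain k where "(g - 1\<^sub>m m) ^\<^sub>m k = 0\<^sub>m m m" using unip by (auto simp: unipotent_mat_def)
  then show ?case using trace_nilpotent[of "g - 1\<^sub>m m" m k] minus_carrier_mat[OF one_carrier_mat] by blast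
next
  case (add a b)
  then show ?case using mat_trace_add[of a m b] aug_carrier by simp
next
  case (smult a c)
  then show ?case using mat_trace_smult[of a m c] aug_carrier by simp
qed

lemma aug_mult_gen:
  assumes "g \<in> G" "b \<in> augmentation m G"
  shows "(g - 1\<^sub>m m) * b \<in> augmentation m G"
  using assms(2)
proof (induction rule: augmentation.induct)
  case (gen h)
  have c: "g \<in> carrier_mat m m" "h \<in> carrier_mat m m" using carrier assms gen by auto
  have "(g - 1\<^sub>m m) * (h - 1\<^sub>m m) = g * (h - 1\<^sub>m m) - 1\<^sub>m m * (h - 1\<^sub>m m)"
    by (rule minus_mult_distrib_mat) (use c in auto)
  also have "g * (h - 1\<^sub>m m) = g * h - g * 1\<^sub>m m"
    by (rule mult_minus_distrib_mat) (use c in auto)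
  also have "g * h - g * 1\<^sub>m m - 1\<^sub>m m * (h - 1\<^sub>m m) =
      (g * h - 1\<^sub>m m) + ((-1) \<cdot>\<^sub>m (g - 1\<^sub>m m) + (-1) \<cdot>\<^sub>m (h - 1\<^sub>m m))"
    using c by (intro eq_matI) (auto simp: algebra_simps)
  finally show ?case using assms(1) gen closed by (auto intro!: augmentation.intros)
next
  case (add a b)
  have "(g - 1\<^sub>m m) * (a + b) = (g - 1\<^sub>m m) * a + (g - 1\<^sub>m m) * b"
    by (rule mult_add_distrib_mat[where nr = m and n = m and nc = m])
      (simp_all add: add.hyps aug_carrier minus_carrier_mat)
  then show ?case using add by (auto intro!: augmentation.intros)
next
  case (smult a c)
  have "(g - 1\<^sub>m m) * (c \<cdot>\<^sub>m a) = c \<cdot>\<^sub>m ((g - 1\<^sub>m m) * a)"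
    by (rule mult_smult_distrib[where nr = m and n = m and nc = m]) (simp_all add: smult.hyps aug_carrier minus_carrier_mat)
  then show ?case using smult by (auto intro!: augmentation.intros)
qed

lemma aug_mult:
  assumes "a \<in> augmentation m G" "b \<in> augmentation m G"
  shows "a * b \<in> augmentation m G"
  using assms(1)
proof (induction rule: augmentation.induct)
  case (gen g)
  then show ?case using aug_mult_gen assms(2) by simp
next
  case (add a a')
  have "(a + a') * b = a * b + a' * b"
    by (rule add_mult_distrib_mat[where nr = m and n = m and nc = m]) (simp_all add: add.hyps assms(2) aug_carrier)
  then show ?case using add by (auto intro!: augmentation.intros)
next
  case (smult a c)
  have "(c \<cdot>\<^sub>m a) * b = c \<cdot>\<^sub>m (a * b)"
    by (rule mult_smult_assoc_mat[where nr = m and n = m and nc = m]) (simp_all add: smult.hyps assms(2) aug_carrier)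
  then show ?case using smult by (auto intro!: augmentation.intros)
qed

text \<open>All powers of \<open>b\<close> have trace zero, so \<open>b\<close> is nilpotent.\<close>

lemma aug_no_fixed_vector:
  assumes b: "b \<in> augmentation m G" and w: "w \<in> carrier_vec m" "b *\<^sub>v w = w"
  shows "w = 0\<^sub>v m"
proof (cases "m = 0")
  case False
  have bc: "b \<in> carrier_mat m m" using aug_carrier[OF b] .
  have pow: "b ^\<^sub>m Suc j \<in> augmentation m G" for j
  proof (induction j)
    case 0
    then show ?case using b bc by simp
  next
    case (Suc j)
    then show ?case using aug_mult[OF Suc b] by simp
  qed
  interpret char_adj m b using bc False by unfold_locales auto
  have "mat_trace (b ^\<^sub>m j) = 0" if "j \<ge> 1" for j
    using aug_trace[OF pow[of "j - 1"]] that by simp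
  then have "char_poly b = monom 1 m" by (rule char_poly_if_traces_0)
  then have "\<not> eigenvalue b 1" using eigenvalue_root_char_poly[OF bc] by (simp add: poly_monom)
  then show ?thesis using w bc by (auto simp: eigenvalue_def eigenvector_def)
qed (use w in auto)

text \<open>Let \<open>B\<close> be the span
of the \<open>g - 1\<close>. The spaces \<open>B w\<^sub>j\<close> descend, hence \<open>B w\<^sub>j = B w\<^bsub>j+1\<^esub>\<close> for some \<open>j\<close>. The vector
\<open>w\<^bsub>j+1\<^esub>\<close> lies in the former, so it equals \<open>b w\<^bsub>j+1\<^esub>\<close> for some \<open>b \<in> B\<close>, which forces it to vanish.\<close>

theorem kolchin:
  fixes w :: "nat \<Rightarrow> 'a vec"
  assumes w: "w 0 \<in> carrier_vec m" "\<And>j. w (Suc j) = (h j - 1\<^sub>m m) *\<^sub>v w j" and h: "\<And>j. h j \<in> G"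
  shows "\<exists>j. w j = 0\<^sub>v m"
proof -
  define \<phi> where "\<phi> = (\<lambda>(v :: 'a vec) i. if i < m then v $ i else 0)"
  define e where "e = (\<lambda>j i :: nat. if i = j then 1 else 0 :: 'a)"
  define W where "W = (\<lambda>j. {\<phi> (a *\<^sub>v w j) | a. a \<in> augmentation m G})"
  have wc: "w j \<in> carrier_vec m" for j
    by (induction j) (use w h carrier in \<open>auto intro!: mult_mat_vec_carrier\<close>)
  have \<phi>_add: "\<phi> (u + v) = \<phi> u + \<phi> v" if "v \<in> carrier_vec m" for u v
    using that by (auto simp: \<phi>_def fun_eq_iff)
  have \<phi>_smult: "\<phi> (c \<cdot>\<^sub>v v) = (\<lambda>i. c * \<phi> v i)" if "v \<in> carrier_vec m" for c v
    using that by (auto simp: \<phi>_def fun_eq_iff)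
  have sub: "fv.subspace (W j)" for j
  proof (rule fv.subspaceI)
    let ?z = "0 \<cdot>\<^sub>m (1\<^sub>m m - 1\<^sub>m m :: 'a mat)"
    have "?z *\<^sub>v w j = 0\<^sub>v m" using wc[of j] by (intro eq_vecI) (auto simp: scalar_prod_def)
    then have "\<phi> (?z *\<^sub>v w j) = 0" by (auto simp: \<phi>_def)
    moreover have "?z \<in> augmentation m G" using one by (intro augmentation.intros)
    ultimately show "0 \<in> W j" unfolding W_def by (metis (mono_tags, lifting) mem_Collect_eq)
  next
    fix x y assume "x \<in> W j" "y \<in> W j"
    then obtain a b where ab: "a \<in> augmentation m G" "b \<in> augmentation m G" "x = \<phi> (a *\<^sub>v w j)" "y = \<phi> (b *\<^sub>v w j)"
      by (auto simp: W_def)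
    have "(a + b) *\<^sub>v w j = a *\<^sub>v w j + b *\<^sub>v w j"
      by (rule add_mult_distrib_mat_vec[where nr = m and nc = m]) (simp_all add: ab aug_carrier wc)
    then have "x + y = \<phi> ((a + b) *\<^sub>v w j)"
      using ab \<phi>_add[of "b *\<^sub>v w j" "a *\<^sub>v w j"] aug_carrier wc by (metis mult_mat_vec_carrier)
    then show "x + y \<in> W j" using ab augmentation.add unfolding W_def by blast
  next
    fix c x assume "x \<in> W j"
    then obtain a where a: "a \<in> augmentation m G" "x = \<phi> (a *\<^sub>v w j)" by (auto simp: W_def)
    have "(c \<cdot>\<^sub>m a) *\<^sub>v w j = c \<cdot>\<^sub>v (a *\<^sub>v w j)"
      using aug_carrier[OF a(1)] wc[of j] by (intro eq_vecI) (auto simp: smult_scalar_prod_distrib[of _ m])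
    then have "(\<lambda>i. c * x i) = \<phi> ((c \<cdot>\<^sub>m a) *\<^sub>v w j)"
      using a \<phi>_smult[of "a *\<^sub>v w j" c] aug_carrier wc by (metis mult_mat_vec_carrier)
    then show "(\<lambda>i. c * x i) \<in> W j" using a augmentation.smult unfolding W_def by blast
  qed
  have span: "W j \<subseteq> fv.span (e ` {..<m})" for j
  proof
    fix x assume "x \<in> W j"
    then obtain v where x: "x = \<phi> v" by (auto simp: W_def)
    have "x = (\<Sum>i<m. (\<lambda>k. v $ i * e i k))"
      by (auto simp: x \<phi>_def e_def fun_eq_iff sum_fun_apply if_distrib cong: if_cong)
    also have "\<dots> \<in> fv.span (e ` {..<m})"
      by (intro fv.span_sum fv.span_scale fv.span_base) auto
    finally show "x \<in> fv.span (e ` {..<m})" .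
  qed
  have desc: "W (Suc j) \<subseteq> W j" for j
  proof
    fix x assume "x \<in> W (Suc j)"
    then obtain a where a: "a \<in> augmentation m G" "x = \<phi> (a *\<^sub>v w (Suc j))" by (auto simp: W_def)
    have hj: "h j - 1\<^sub>m m \<in> augmentation m G" using h by (intro augmentation.gen)
    have "a *\<^sub>v w (Suc j) = (a * (h j - 1\<^sub>m m)) *\<^sub>v w j"
      unfolding w(2) by (rule assoc_mult_mat_vec[symmetric, of _ m m _ m]) (simp_all add: a(1) hj aug_carrier wc)
    then show "x \<in> W j" using a aug_mult[OF a(1) hj] by (auto simp: W_def)
  qed
  obtain i where i: "\<And>j. i \<le> j \<Longrightarrow> W j = W i"
    using descending_subspaces_stabilise[of "e ` {..<m}" W] sub span desc by blast
  have "\<phi> (w (Suc i)) \<in> W i" unfolding W_def w(2) using h augmentation.gen by blast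
  then have "\<phi> (w (Suc i)) \<in> W (Suc i)" using i[of "Suc i"] by simp
  then obtain b where b: "b \<in> augmentation m G" "\<phi> (w (Suc i)) = \<phi> (b *\<^sub>v w (Suc i))" by (auto simp: W_def)
  have "b *\<^sub>v w (Suc i) = w (Suc i)"
  proof (rule eq_vecI)
    fix k assume "k < dim_vec (w (Suc i))"
    then show "(b *\<^sub>v w (Suc i)) $ k = w (Suc i) $ k"
      using fun_cong[OF b(2), of k] wc[of "Suc i"] by (simp add: \<phi>_def)
  qed (use aug_carrier[OF b(1)] wc[of "Suc i"] in auto)
  then show ?thesis using aug_no_fixed_vector[OF b(1) wc] by blast
qed

end

section \<open>Iterated differences\<close>

text \<open>A function satisfies this if all sequences of differences \<open>f \<circ> h - f\<close> with varying \<open>h \<in> H\<close> reach zero.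
The inductive form expresses this as well-foundedness, which comes with the induction principle for sums
and products below.\<close>

inductive diff_nil ::
    "'h set \<Rightarrow> ('h \<Rightarrow> 'x \<Rightarrow> 'x) \<Rightarrow> 'x set \<Rightarrow> ('x \<Rightarrow> 'a::comm_ring_1) \<Rightarrow> bool"
  for H act X where
  zero: "(\<And>x. x \<in> X \<Longrightarrow> f x = 0) \<Longrightarrow> diff_nil H act X f"
| step: "(\<And>h. h \<in> H \<Longrightarrow> diff_nil H act X (\<lambda>x. f (act h x) - f x)) \<Longrightarrow> diff_nil H act X f"

context
  fixes H :: "'h set" and act :: "'h \<Rightarrow> 'x \<Rightarrow> 'x" and X :: "'x set"
  assumes act: "\<And>h x. h \<in> H \<Longrightarrow> x \<in> X \<Longrightarrow> act h x \<in> X"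
begin

lemma diff_nil_cong:
  assumes "diff_nil H act X f" "\<And>x. x \<in> X \<Longrightarrow> f x = g x"
  shows "diff_nil H act X g"
  using assms
proof (induction arbitrary: g rule: diff_nil.induct)
  case (zero f)
  then show ?case by (intro diff_nil.zero) auto
next
  case (step f)
  show ?case
  proof (rule diff_nil.step)
    fix h assume h: "h \<in> H"
    show "diff_nil H act X (\<lambda>x. g (act h x) - g x)"
      by (rule step.IH[OF h]) (simp add: step.prems act[OF h])
  qed
qed

lemma diff_nil_diff:
  assumes "diff_nil H act X f" "h \<in> H"
  shows "diff_nil H act X (\<lambda>x. f (act h x) - f x)"
  using assms(1)
proof cases
  case zero
  then show ?thesis using act[OF assms(2)] by (intro diff_nil.zero) simp
next
  case step
  then show ?thesis using assms(2) by blast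
qed

lemma diff_nil_const: "diff_nil H act X (\<lambda>_. c)"
  by (rule diff_nil.step, rule diff_nil.zero) simp

lemma diff_nil_add:
  assumes "diff_nil H act X f" "diff_nil H act X g"
  shows "diff_nil H act X (\<lambda>x. f x + g x)"
  using assms
proof (induction arbitrary: g rule: diff_nil.induct)
  case (zero f)
  show ?case by (rule diff_nil_cong[OF zero(2)]) (simp add: zero(1))
next
  case (step f)
  show ?case
  proof (rule diff_nil.step)
    fix h assume h: "h \<in> H"
    have "diff_nil H act X (\<lambda>x. (f (act h x) - f x) + (g (act h x) - g x))"
      by (rule step.IH[OF h diff_nil_diff[OF step.prems h]])
    then show "diff_nil H act X (\<lambda>x. (f (act h x) + g (act h x)) - (f x + g x))"
      by (simp add: algebra_simps)
  qed
qed

text \<open>With \<open>f' = f \<circ> h - f\<close> the product rule is \<open>(f g)' = f' g + f' g' + f g'\<close>, so an outer induction on \<open>f\<close>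
and an inner one on \<open>g\<close> do.\<close>

lemma diff_nil_mult:
  assumes "diff_nil H act X f" "diff_nil H act X g"
  shows "diff_nil H act X (\<lambda>x. f x * g x)"
  using assms
proof (induction arbitrary: g rule: diff_nil.induct)
  case (zero f)
  show ?case by (rule diff_nil.zero) (simp add: zero(1))
next
  case (step f)
  note outer = step.IH
  from step.prems show ?case
  proof (induction rule: diff_nil.induct)
    case (zero g)
    show ?case by (rule diff_nil.zero) (simp add: zero)
  next
    case (step g)
    show ?case
    proof (rule diff_nil.step)
      fix h assume h: "h \<in> H"
      let ?f' = "\<lambda>x. f (act h x) - f x" and ?g' = "\<lambda>x. g (act h x) - g x"
      have g: "diff_nil H act X g" using step.hyps by (rule diff_nil.step)
      have "diff_nil H act X (\<lambda>x. (?f' x * g x + ?f' x * ?g' x) + f x * ?g' x)"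
        by (intro diff_nil_add outer[OF h] step.IH[OF h] g diff_nil_diff[OF g h])
      then show "diff_nil H act X (\<lambda>x. f (act h x) * g (act h x) - f x * g x)"
        by (simp add: algebra_simps)
    qed
  qed
qed

lemma diff_nil_fun_alg:
  assumes "f \<in> fun_alg X S" "\<And>s. s \<in> S \<Longrightarrow> diff_nil H act X s"
  shows "diff_nil H act X f"
  using assms(1)
proof induction
  case (cong f g)
  then show ?case using diff_nil_cong by blast
qed (simp_all add: assms(2) diff_nil_const diff_nil_add diff_nil_mult)

end

text \<open>Keep taking differences that lie outside \<open>R\<close>; the last function reached is invariant modulo \<open>R\<close>.\<close>

lemma diff_nil_imp_invariant_mod:
  assumes "diff_nil H act X f" "f \<notin> R" "\<And>f. (\<And>x. x \<in> X \<Longrightarrow> f x = 0) \<Longrightarrow> f \<in> R"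
    and "f \<in> F" "\<And>f h. f \<in> F \<Longrightarrow> h \<in> H \<Longrightarrow> (\<lambda>x. f (act h x) - f x) \<in> F"
  shows "\<exists>f'\<in>F. f' \<notin> R \<and> (\<forall>h\<in>H. (\<lambda>x. f' (act h x) - f' x) \<in> R)"
  using assms(1,2,4)
proof (induction rule: diff_nil.induct)
  case (zero f)
  then show ?case using assms(3) by blast
next
  case (step f)
  then show ?case using assms(5) by blast
qed

section \<open>Polynomial functions of one variable\<close>

abbreviation poly1 :: "('a::comm_ring_1 \<Rightarrow> 'a) set"
  where "poly1 \<equiv> fun_alg UNIV {\<lambda>t. t}"

lemma poly1_iff_poly: "f \<in> poly1 \<longleftrightarrow> (\<exists>q. \<forall>t. f t = poly q t)"
proof
  assume "f \<in> poly1"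
  then show "\<exists>q. \<forall>t. f t = poly q t"
  proof induction
    case (const c)
    show ?case by (rule exI[of _ "[:c:]"]) simp
  next
    case (gen f)
    show ?case by (rule exI[of _ "[:0, 1:]"]) (use gen in simp)
  qed (metis poly_add, metis poly_mult, simp)
next
  assume "\<exists>q. \<forall>t. f t = poly q t"
  then obtain q where "f = poly q" by auto
  moreover have "poly q \<in> poly1"
  proof (induction q)
    case (pCons c q)
    have "(\<lambda>t. c + t * poly q t) \<in> poly1"
      by (intro fun_alg.add fun_alg.mult fun_alg.const fun_alg.gen pCons.IH) simp
    then show ?case by (rule fun_alg.cong) simp
  next
    case 0
    show ?case by (rule fun_alg.cong[OF fun_alg.const[of 0]]) simp
  qed
  ultimately show "f \<in> poly1" by simp
qed

lemma poly_eq_if_eq_on_nats: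
  fixes p q :: "'a::field_char_0 poly"
  assumes "\<And>s::nat. poly p (of_nat s) = poly q (of_nat s)"
  shows "p = q"
proof (rule ccontr)
  assume "p \<noteq> q"
  then have "finite {x. poly (p - q) x = 0}" by (intro poly_roots_finite) simp
  moreover have "range (of_nat :: nat \<Rightarrow> 'a) \<subseteq> {x. poly (p - q) x = 0}" using assms by auto
  ultimately have "finite (range (of_nat :: nat \<Rightarrow> 'a))" by (rule finite_subset[rotated])
  then show False using finite_imageD[of "of_nat :: nat \<Rightarrow> 'a" UNIV] by (simp add: inj_on_def)
qed

lemma poly1_eq_if_eq_on_nats:
  fixes f g :: "'a::field_char_0 \<Rightarrow> 'a"
  assumes "f \<in> poly1" "g \<in> poly1" "\<And>s::nat. f (of_nat s) = g (of_nat s)"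
  shows "f t = g t"
proof -
  obtain p q where "\<forall>t. f t = poly p t" "\<forall>t. g t = poly q t" using assms by (auto simp: poly1_iff_poly)
  then show ?thesis using poly_eq_if_eq_on_nats[of p q] assms(3) by simp
qed

lemma gbinomial_poly1: "(\<lambda>t :: 'a::field_char_0. t gchoose j) \<in> poly1"
proof -
  have "(\<lambda>t :: 'a. inverse (fact j) * (\<Prod>i=0..<j. t - of_nat i)) \<in> poly1"
    by (intro fun_alg.mult fun_alg.const fun_alg_prod fun_alg_diff fun_alg.gen) simp
  then show ?thesis by (rule fun_alg.cong) (simp add: gbinomial_prod_rev field_simps)
qed

section \<open>Powers of unipotent matrices with exponents in the field\<close>

text \<open>The binomial series for \<open>(1 + (g - 1))^t\<close>. Any exponent \<open>k\<close> with \<open>(g - 1)^k = 0\<close> bounds the sum.\<close>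

definition unipotent_power :: "nat \<Rightarrow> 'a::field_char_0 mat \<Rightarrow> 'a \<Rightarrow> 'a mat"
  where "unipotent_power m g t = mat m m (\<lambda>(a, b).
    \<Sum>j < (SOME k. (g - 1\<^sub>m m) ^\<^sub>m k = 0\<^sub>m m m). (t gchoose j) * ((g - 1\<^sub>m m) ^\<^sub>m j) $$ (a, b))"

lemma unipotent_power_carrier [simp]: "unipotent_power m g t \<in> carrier_mat m m"
  by (simp add: unipotent_power_def)

lemma unipotent_power_poly1:
  assumes "a < m" "b < m"
  shows "(\<lambda>t. unipotent_power m g t $$ (a, b)) \<in> poly1"
  unfolding unipotent_power_def using assms
  by (simp, intro fun_alg_sum fun_alg.mult gbinomial_poly1 fun_alg.const)

lemma unipotent_power_of_nat:
  assumes "unipotent_mat m g"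
  shows "unipotent_power m g (of_nat s) = g ^\<^sub>m s"
proof -
  define N where "N = g - 1\<^sub>m m"
  define k where "k = (SOME k. N ^\<^sub>m k = 0\<^sub>m m m)"
  have g: "g \<in> carrier_mat m m" and ex: "\<exists>k. N ^\<^sub>m k = 0\<^sub>m m m"
    using assms by (auto simp: unipotent_mat_def N_def)
  have k: "N ^\<^sub>m k = 0\<^sub>m m m" using someI_ex[OF ex] unfolding k_def .
  have N: "N \<in> carrier_mat m m" by (simp add: N_def minus_carrier_mat)
  have gN: "g = N + 1\<^sub>m m" using g by (intro eq_matI) (auto simp: N_def)
  have entry: "(g ^\<^sub>m s) $$ (a, b) = (\<Sum>j<k. of_nat (s choose j) * (N ^\<^sub>m j) $$ (a, b))"
    if "a < m" "b < m" for a b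
    using that
  proof (induction s arbitrary: b)
    case 0
    show ?case
    proof (cases k)
      case 0
      then have "(1\<^sub>m m :: 'a mat) $$ (a, b) = 0\<^sub>m m m $$ (a, b)" using k N by simp
      then show ?thesis using 0 g that(1) \<open>b < m\<close> by simp
    next
      case (Suc k')
      then have "(\<Sum>j<k. of_nat (0 choose j) * (N ^\<^sub>m j) $$ (a, b)) =
          (\<Sum>j\<in>{0}. of_nat (0 choose j) * (N ^\<^sub>m j) $$ (a, b))"
        by (intro sum.mono_neutral_right) (auto simp: gr0_conv_Suc)
      then show ?thesis using g N by simp
    qed
  next
    case (Suc s)
    have c: "g ^\<^sub>m s \<in> carrier_mat m m" using g by simp
    have "g ^\<^sub>m Suc s = g ^\<^sub>m s * N + g ^\<^sub>m s * 1\<^sub>m m"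
      using mult_add_distrib_mat[OF c N one_carrier_mat] gN by simp
    then have "g ^\<^sub>m Suc s = g ^\<^sub>m s * N + g ^\<^sub>m s" unfolding right_mult_one_mat[OF c] .
    then have "(g ^\<^sub>m Suc s) $$ (a, b) = (\<Sum>c<m. (g ^\<^sub>m s) $$ (a, c) * N $$ (c, b)) + (g ^\<^sub>m s) $$ (a, b)"
      using Suc.prems carrier_matD[OF c] carrier_matD[OF N]
      by (simp add: scalar_prod_def atLeast0LessThan del: pow_mat_dim)
    also have "(\<Sum>c<m. (g ^\<^sub>m s) $$ (a, c) * N $$ (c, b)) =
        (\<Sum>c<m. \<Sum>j<k. of_nat (s choose j) * ((N ^\<^sub>m j) $$ (a, c) * N $$ (c, b)))"
      using Suc by (intro sum.cong) (simp_all add: sum_distrib_right mult.assoc)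
    also have "\<dots> = (\<Sum>j<k. of_nat (s choose j) * (\<Sum>c<m. (N ^\<^sub>m j) $$ (a, c) * N $$ (c, b)))"
      by (subst sum.swap) (simp add: sum_distrib_left)
    also have "\<dots> = (\<Sum>j<k. of_nat (s choose j) * (N ^\<^sub>m Suc j) $$ (a, b))"
      using Suc.prems N pow_carrier_mat[OF N] by (intro sum.cong) (simp_all add: scalar_prod_def atLeast0LessThan carrier_matD)
    also have "\<dots> = (\<Sum>j<k. (if j = 0 then 0 else of_nat (s choose (j - 1))) * (N ^\<^sub>m j) $$ (a, b))"
      (is "_ = (\<Sum>j<k. ?f j)")
    proof -
      have "(\<Sum>j<k. of_nat (s choose j) * (N ^\<^sub>m Suc j) $$ (a, b)) = (\<Sum>j<k. ?f (Suc j))" by simp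
      also have "\<dots> = (\<Sum>j<Suc k. ?f j) - ?f 0" by (subst sum.lessThan_Suc_shift) simp
      also have "\<dots> = (\<Sum>j<k. ?f j)" using k Suc.prems by simp
      finally show ?thesis .
    qed
    also have "\<dots> + (g ^\<^sub>m s) $$ (a, b) = (\<Sum>j<k. of_nat (Suc s choose j) * (N ^\<^sub>m j) $$ (a, b))"
      unfolding Suc.IH[OF Suc.prems] sum.distrib[symmetric]
    proof (rule sum.cong)
      fix j
      show "(if j = 0 then 0 else of_nat (s choose (j - 1))) * (N ^\<^sub>m j) $$ (a, b) +
          of_nat (s choose j) * (N ^\<^sub>m j) $$ (a, b) = of_nat (Suc s choose j) * (N ^\<^sub>m j) $$ (a, b)"
        by (cases j) (simp_all add: algebra_simps)
    qed simp
    finally show ?case .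
  qed
  show ?thesis
    unfolding unipotent_power_def N_def[symmetric] k_def[symmetric]
    using pow_carrier_mat[OF g, of s]
    by (intro eq_matI) (auto simp: entry binomial_gbinomial carrier_matD simp del: pow_mat_dim)
qed

lemma det_poly1:
  assumes "\<And>t. M t \<in> carrier_mat m m" "\<And>a b. a < m \<Longrightarrow> b < m \<Longrightarrow> (\<lambda>t. M t $$ (a, b)) \<in> poly1"
  shows "(\<lambda>t. det (M t)) \<in> poly1"
  unfolding det_def'[OF assms(1)]
  by (intro fun_alg_sum fun_alg.mult fun_alg_prod fun_alg.const assms(2)) (auto dest: permutes_in_image)

lemma poly1_inverse_const:
  fixes f g :: "'a::field_char_0 \<Rightarrow> 'a"
  assumes "f \<in> poly1" "g \<in> poly1" "\<And>t. f t * g t = 1"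
  shows "f s = f t"
proof -
  obtain p q where pq: "\<forall>t. f t = poly p t" "\<forall>t. g t = poly q t" using assms by (auto simp: poly1_iff_poly)
  then have "poly (p * q) = poly 1" using assms(3) by (simp add: fun_eq_iff)
  then have "p * q = 1" by (simp only: poly_eq_poly_eq_iff)
  then have "p dvd 1" by (metis dvdI)
  then obtain c where "p = [:c:]" by (metis is_unit_poly_iff)
  then show ?thesis using pq by simp
qed

section \<open>Linear coefficients\<close>

text \<open>The derivative of \<open>P\<close> along a polynomial curve through \<open>x\<close> depends linearly on the velocity of the curve,
with coefficients \<open>\<mu>\<close> that are the partial derivatives of \<open>P\<close> at \<open>x\<close>. The value \<open>\<kappa>\<close> of \<open>P\<close> at \<open>x\<close> is
carried along for the product rule.\<close>

lemma linear_coefficient: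
  fixes P :: "('i \<Rightarrow> 'a::field_char_0) \<Rightarrow> 'a"
  assumes "P \<in> fun_alg UNIV ((\<lambda>i v. v i) ` I)" "finite I"
  shows "\<exists>\<kappa> \<mu>. \<forall>M :: 'i \<Rightarrow> 'a poly. (\<forall>i\<in>I. poly (M i) 0 = x i) \<longrightarrow>
    (\<exists>q. (\<forall>t. P (\<lambda>i. poly (M i) t) = poly q t) \<and> coeff q 0 = \<kappa> \<and>
      coeff q 1 = (\<Sum>i\<in>I. \<mu> i * coeff (M i) 1))"
  using assms(1)
proof induction
  case (const c)
  show ?case
    by (rule exI[of _ c], rule exI[of _ "\<lambda>_. 0"], intro allI impI, rule exI[of _ "[:c:]"]) simp
next
  case (gen f)
  then obtain i where i: "i \<in> I" "f = (\<lambda>v. v i)" by auto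
  show ?case
  proof (rule exI[of _ "x i"], rule exI[of _ "\<lambda>j. if j = i then 1 else 0"], intro allI impI)
    fix M :: "'i \<Rightarrow> 'a poly" assume M: "\<forall>i\<in>I. poly (M i) 0 = x i"
    have "(\<Sum>j\<in>I. (if j = i then 1 else 0) * coeff (M j) 1) = coeff (M i) 1"
      using i(1) assms(2) by (subst sum.mono_neutral_right[of I "{i}"]) auto
    then show "\<exists>q. (\<forall>t. f (\<lambda>i. poly (M i) t) = poly q t) \<and> coeff q 0 = x i \<and>
      coeff q 1 = (\<Sum>j\<in>I. (if j = i then 1 else 0) * coeff (M j) 1)"
      using M i by (intro exI[of _ "M i"]) (auto simp: poly_0_coeff_0)
  qed
next
  case (add f g)
  obtain \<kappa> \<mu> where f: "\<And>M :: 'i \<Rightarrow> 'a poly. (\<forall>i\<in>I. poly (M i) 0 = x i) \<Longrightarrow>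
    (\<exists>q. (\<forall>t. f (\<lambda>i. poly (M i) t) = poly q t) \<and> coeff q 0 = \<kappa> \<and>
      coeff q 1 = (\<Sum>i\<in>I. \<mu> i * coeff (M i) 1))" using add.IH(1) by blast
  obtain \<kappa>' \<mu>' where g: "\<And>M :: 'i \<Rightarrow> 'a poly. (\<forall>i\<in>I. poly (M i) 0 = x i) \<Longrightarrow>
    (\<exists>q. (\<forall>t. g (\<lambda>i. poly (M i) t) = poly q t) \<and> coeff q 0 = \<kappa>' \<and>
      coeff q 1 = (\<Sum>i\<in>I. \<mu>' i * coeff (M i) 1))" using add.IH(2) by blast
  show ?case
  proof (rule exI[of _ "\<kappa> + \<kappa>'"], rule exI[of _ "\<lambda>i. \<mu> i + \<mu>' i"], intro allI impI)
    fix M :: "'i \<Rightarrow> 'a poly" assume M: "\<forall>i\<in>I. poly (M i) 0 = x i"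
    obtain q where q: "\<forall>t. f (\<lambda>i. poly (M i) t) = poly q t" "coeff q 0 = \<kappa>"
      "coeff q 1 = (\<Sum>i\<in>I. \<mu> i * coeff (M i) 1)" using f[OF M] by blast
    obtain r where r: "\<forall>t. g (\<lambda>i. poly (M i) t) = poly r t" "coeff r 0 = \<kappa>'"
      "coeff r 1 = (\<Sum>i\<in>I. \<mu>' i * coeff (M i) 1)" using g[OF M] by blast
    show "\<exists>q. (\<forall>t. f (\<lambda>i. poly (M i) t) + g (\<lambda>i. poly (M i) t) = poly q t) \<and> coeff q 0 = \<kappa> + \<kappa>' \<and>
      coeff q 1 = (\<Sum>i\<in>I. (\<mu> i + \<mu>' i) * coeff (M i) 1)"
      by (rule exI[of _ "q + r"]) (use q r in \<open>simp add: sum.distrib distrib_right\<close>)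
  qed
next
  case (mult f g)
  obtain \<kappa> \<mu> where f: "\<And>M :: 'i \<Rightarrow> 'a poly. (\<forall>i\<in>I. poly (M i) 0 = x i) \<Longrightarrow>
    (\<exists>q. (\<forall>t. f (\<lambda>i. poly (M i) t) = poly q t) \<and> coeff q 0 = \<kappa> \<and>
      coeff q 1 = (\<Sum>i\<in>I. \<mu> i * coeff (M i) 1))" using mult.IH(1) by blast
  obtain \<kappa>' \<mu>' where g: "\<And>M :: 'i \<Rightarrow> 'a poly. (\<forall>i\<in>I. poly (M i) 0 = x i) \<Longrightarrow>
    (\<exists>q. (\<forall>t. g (\<lambda>i. poly (M i) t) = poly q t) \<and> coeff q 0 = \<kappa>' \<and>
      coeff q 1 = (\<Sum>i\<in>I. \<mu>' i * coeff (M i) 1))" using mult.IH(2) by blast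
  show ?case
  proof (rule exI[of _ "\<kappa> * \<kappa>'"], rule exI[of _ "\<lambda>i. \<kappa> * \<mu>' i + \<kappa>' * \<mu> i"], intro allI impI)
    fix M :: "'i \<Rightarrow> 'a poly" assume M: "\<forall>i\<in>I. poly (M i) 0 = x i"
    obtain q where q: "\<forall>t. f (\<lambda>i. poly (M i) t) = poly q t" "coeff q 0 = \<kappa>"
      "coeff q 1 = (\<Sum>i\<in>I. \<mu> i * coeff (M i) 1)" using f[OF M] by blast
    obtain r where r: "\<forall>t. g (\<lambda>i. poly (M i) t) = poly r t" "coeff r 0 = \<kappa>'"
      "coeff r 1 = (\<Sum>i\<in>I. \<mu>' i * coeff (M i) 1)" using g[OF M] by blast
    have "coeff (q * r) 1 = coeff q 0 * coeff r 1 + coeff q 1 * coeff r 0"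
      by (simp add: coeff_mult)
    then have "coeff (q * r) 1 = (\<Sum>i\<in>I. (\<kappa> * \<mu>' i + \<kappa>' * \<mu> i) * coeff (M i) 1)"
      by (simp only: q r) (simp add: algebra_simps sum.distrib sum_distrib_left)
    then show "\<exists>q. (\<forall>t. f (\<lambda>i. poly (M i) t) * g (\<lambda>i. poly (M i) t) = poly q t) \<and> coeff q 0 = \<kappa> * \<kappa>' \<and>
      coeff q 1 = (\<Sum>i\<in>I. (\<kappa> * \<mu>' i + \<kappa>' * \<mu> i) * coeff (M i) 1)"
      by (intro exI[of _ "q * r"]) (use q r in \<open>simp add: coeff_mult\<close>)
  qed
next
  case (cong f g)
  then show ?case by simp
qed

section \<open>Automorphisms of affine space\<close>

abbreviation pol :: "nat \<Rightarrow> ('a::field vec \<Rightarrow> 'a) set"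
  where "pol n \<equiv> fun_alg (carrier_vec n) ((\<lambda>i v. v $ i) ` {..<n})"

lemma pol_iff_mpoly:
  "f \<in> pol n \<longleftrightarrow> (\<exists>p\<in>mpolys {..<n}. \<forall>x\<in>carrier_vec n. f x = mpoly_eval p (\<lambda>j. x $ j))"
proof
  assume "f \<in> pol n"
  then show "\<exists>p\<in>mpolys {..<n}. \<forall>x\<in>carrier_vec n. f x = mpoly_eval p (\<lambda>j. x $ j)"
    by (rule fun_alg_imp_mpoly)
next
  assume "\<exists>p\<in>mpolys {..<n}. \<forall>x\<in>carrier_vec n. f x = mpoly_eval p (\<lambda>j. x $ j)"
  then obtain p where p: "p \<in> mpolys {..<n}" "\<And>x. x \<in> carrier_vec n \<Longrightarrow> mpoly_eval p (\<lambda>j. x $ j) = f x"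
    by metis
  have "(\<lambda>x. mpoly_eval p (\<lambda>j. x $ j)) \<in> pol n"
    by (rule mpoly_eval_in_fun_alg[OF p(1)]) (auto intro: fun_alg.gen)
  then show "f \<in> pol n" by (rule fun_alg.cong) (rule p(2))
qed

lemma polynomial_map_iff: "polynomial_map n f \<longleftrightarrow> (\<forall>i<n. (\<lambda>x. f x $ i) \<in> pol n)"
  by (simp add: polynomial_map_def pol_iff_mpoly)

lemma pol_comp:
  assumes "h \<in> pol n" "polynomial_map n f" "\<And>x. x \<in> carrier_vec n \<Longrightarrow> f x \<in> carrier_vec n"
  shows "(\<lambda>x. h (f x)) \<in> pol n"
  by (rule fun_alg_comp[OF assms(1,3)]) (use assms(2) in \<open>auto simp: polynomial_map_iff\<close>)

lemma carrier_Aut: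
  "f \<in> carrier (Aut n) \<longleftrightarrow> f \<in> Bij (carrier_vec n) \<and> polynomial_map n f \<and>
    polynomial_map n (\<lambda>x\<in>carrier_vec n. inv_into (carrier_vec n) f x)"
  by (auto simp: Aut_def inv_BijGroup)

lemma polynomial_map_compose:
  assumes "polynomial_map n f" "polynomial_map n g" "g \<in> carrier_vec n \<rightarrow> carrier_vec n"
  shows "polynomial_map n (compose (carrier_vec n) f g)"
  unfolding polynomial_map_iff
proof (intro allI impI)
  fix i assume "i < n"
  then have "(\<lambda>x. f x $ i) \<in> pol n" using assms(1) by (simp add: polynomial_map_iff)
  then have "(\<lambda>x. f (g x) $ i) \<in> pol n" by (rule pol_comp) (use assms in auto)
  then show "(\<lambda>x. compose (carrier_vec n) f g x $ i) \<in> pol n"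
    by (rule fun_alg.cong) (simp add: compose_def)
qed

lemma subgroup_carrier_Aut: "subgroup (carrier (Aut n)) (BijGroup (carrier_vec n))"
proof -
  interpret B: group "BijGroup (carrier_vec n)" by (rule group_BijGroup)
  let ?B = "BijGroup (carrier_vec n) :: ('a vec \<Rightarrow> 'a vec) monoid"
  have mem: "f \<in> carrier (Aut n) \<longleftrightarrow> f \<in> carrier ?B \<and> polynomial_map n f \<and> polynomial_map n (inv\<^bsub>?B\<^esub> f)"
    for f :: "'a vec \<Rightarrow> 'a vec" by (auto simp: Aut_def BijGroup_def)
  have funcset: "f \<in> carrier_vec n \<rightarrow> carrier_vec n" if "f \<in> carrier ?B" for f
    using that Bij_imp_funcset by (auto simp: BijGroup_def)
  have mult: "f \<otimes>\<^bsub>?B\<^esub> g = compose (carrier_vec n) f g" if "f \<in> carrier ?B" "g \<in> carrier ?B" for f g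
    using that by (simp add: BijGroup_def)
  show ?thesis
  proof
    fix f g :: "'a vec \<Rightarrow> 'a vec" assume "f \<in> carrier (Aut n)" "g \<in> carrier (Aut n)"
    then have fg: "f \<in> carrier ?B" "g \<in> carrier ?B" "polynomial_map n f" "polynomial_map n g"
      "polynomial_map n (inv\<^bsub>?B\<^esub> f)" "polynomial_map n (inv\<^bsub>?B\<^esub> g)" by (auto simp: mem)
    show "f \<otimes>\<^bsub>?B\<^esub> g \<in> carrier (Aut n)"
      unfolding mem B.inv_mult_group[OF fg(1,2)]
      using fg B.inv_closed B.m_closed[OF fg(1,2)]
      by (simp add: mult polynomial_map_compose funcset)
  next
    have "polynomial_map n (\<one>\<^bsub>?B\<^esub>)"
      unfolding polynomial_map_iff
    proof (intro allI impI)
      fix i assume "i < n"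
      then have "(\<lambda>x. x $ i) \<in> pol n" by (intro fun_alg.gen) auto
      then show "(\<lambda>x. \<one>\<^bsub>?B\<^esub> x $ i) \<in> pol n" by (rule fun_alg.cong) (simp add: BijGroup_def)
    qed
    then show "\<one>\<^bsub>?B\<^esub> \<in> carrier (Aut n)" by (simp add: mem)
  qed (auto simp: mem)
qed

lemma Aut_eq: "Aut n = (BijGroup (carrier_vec n)) \<lparr>carrier := carrier (Aut n)\<rparr>"
  by (simp add: Aut_def)

lemma group_Aut: "group (Aut n)"
  using group.subgroup_imp_group[OF group_BijGroup subgroup_carrier_Aut] Aut_eq by metis

lemma Aut_mult:
  assumes "f \<in> carrier (Aut n)" "g \<in> carrier (Aut n)"
  shows "f \<otimes>\<^bsub>Aut n\<^esub> g = compose (carrier_vec n) f g"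
  using assms by (simp add: Aut_def BijGroup_def)

lemma Aut_inv:
  assumes "f \<in> carrier (Aut n)"
  shows "inv\<^bsub>Aut n\<^esub> f = (\<lambda>x\<in>carrier_vec n. inv_into (carrier_vec n) f x)"
proof -
  have "inv\<^bsub>Aut n\<^esub> f = inv\<^bsub>BijGroup (carrier_vec n)\<^esub> f"
    using group.m_inv_consistent[OF group_BijGroup subgroup_carrier_Aut assms] Aut_eq by metis
  then show ?thesis using assms by (simp add: carrier_Aut inv_BijGroup)
qed

locale aut_subgroup =
  fixes n :: nat and U :: "('a::field vec \<Rightarrow> 'a vec) set"
  assumes subgroup: "subgroup U (Aut n)"
begin

lemma Aut: "u \<in> U \<Longrightarrow> u \<in> carrier (Aut n)"
  using subgroup.subset[OF subgroup] by blast

lemma in_Bij: "u \<in> U \<Longrightarrow> u \<in> Bij (carrier_vec n)"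
  using Aut by (simp add: carrier_Aut)

lemma polynomial_map: "u \<in> U \<Longrightarrow> polynomial_map n u"
  using Aut by (simp add: carrier_Aut)

lemma maps: "u \<in> U \<Longrightarrow> x \<in> carrier_vec n \<Longrightarrow> u x \<in> carrier_vec n"
  using in_Bij[THEN Bij_imp_funcset] by auto

lemma pol_act: "u \<in> U \<Longrightarrow> f \<in> pol n \<Longrightarrow> (\<lambda>x. f (u x)) \<in> pol n"
  by (rule pol_comp) (simp_all add: polynomial_map maps)

lemma compose: "u \<in> U \<Longrightarrow> v \<in> U \<Longrightarrow> compose (carrier_vec n) u v \<in> U"
  using subgroup.m_closed[OF subgroup, of u v] by (simp add: Aut_mult Aut)

lemma id: "(\<lambda>x\<in>carrier_vec n. x) \<in> U"
  using subgroup.one_closed[OF subgroup] by (simp add: Aut_def BijGroup_def)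

lemma inverse:
  assumes "u \<in> U"
  obtains v where "v \<in> U" "\<And>x. x \<in> carrier_vec n \<Longrightarrow> v (u x) = x" "\<And>x. x \<in> carrier_vec n \<Longrightarrow> u (v x) = x"
proof -
  have bij: "bij_betw u (carrier_vec n) (carrier_vec n)" using in_Bij[OF assms] by (simp add: Bij_def)
  let ?v = "\<lambda>x\<in>carrier_vec n. inv_into (carrier_vec n) u x"
  have "?v \<in> U"
    using subgroup.m_inv_closed[OF subgroup assms] Aut_inv[OF Aut[OF assms]] by simp
  moreover have "?v (u x) = x" "u (?v x) = x" if "x \<in> carrier_vec n" for x
    using that bij maps[OF assms] by (auto simp: bij_betw_def f_inv_into_f)
  ultimately show ?thesis using that by blast
qed

end

section \<open>Unipotent algebraic groups of automorphisms\<close>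

locale unipotent_action =
  fixes n m :: nat and G :: "'a::{alg_closed_field, field_char_0} mat set"
    and \<rho> :: "'a mat \<Rightarrow> 'a vec \<Rightarrow> 'a vec"
  assumes lin: "linear_algebraic_group m G"
    and unip: "\<And>g. g \<in> G \<Longrightarrow> unipotent_mat m g"
    and reg: "regular_action n m G \<rho>"
begin

lemma carrier: "g \<in> G \<Longrightarrow> g \<in> carrier_mat m m"
  using unip by (auto simp: unipotent_mat_def)

lemma carrier_GL:
  "g \<in> carrier (GL m) \<longleftrightarrow> g \<in> carrier_mat m m \<and> (\<exists>h\<in>carrier_mat m m. h * g = 1\<^sub>m m \<and> g * h = 1\<^sub>m m)"
  for g :: "'a mat" by (auto simp: GL_def units_of_carrier Units_def ring_mat_def)

lemma GL_mult: "g \<otimes>\<^bsub>GL m\<^esub> h = g * h" for g h :: "'a mat"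
  by (simp add: GL_def units_of_mult ring_mat_def)

lemma GL_one: "\<one>\<^bsub>GL m\<^esub> = (1\<^sub>m m :: 'a mat)"
  by (simp add: GL_def units_of_one ring_mat_def)

lemma subgroup_G: "subgroup G (GL m)"
  using lin by (simp add: linear_algebraic_group_def)

lemma group_GL: "group (GL m :: 'a mat monoid)"
  unfolding GL_def by (rule monoid.units_group[OF ring.is_monoid[OF ring_mat]])

lemma one: "1\<^sub>m m \<in> G"
  using subgroup.one_closed[OF subgroup_G] by (simp add: GL_one)

lemma mult: "g \<in> G \<Longrightarrow> h \<in> G \<Longrightarrow> g * h \<in> G"
  using subgroup.m_closed[OF subgroup_G] by (simp add: GL_mult)

lemma inverse:
  assumes "g \<in> G" obtains h where "h \<in> G" "g * h = 1\<^sub>m m" "h * g = 1\<^sub>m m"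
proof -
  have "g \<in> carrier (GL m)" using subgroup.subset[OF subgroup_G] assms by blast
  then show ?thesis
    using that subgroup.m_inv_closed[OF subgroup_G assms]
      group.r_inv[OF group_GL, of g] group.l_inv[OF group_GL, of g]
    by (simp add: GL_mult GL_one)
qed

lemma pow_G: "g \<in> G \<Longrightarrow> g ^\<^sub>m s \<in> G"
  by (induction s) (use one mult carrier in \<open>auto simp: carrier_matD\<close>)

lemma pow_inverse:
  assumes "g \<in> G" "h \<in> G" "g * h = 1\<^sub>m m" "h * g = 1\<^sub>m m"
  shows "g ^\<^sub>m s * h ^\<^sub>m s = 1\<^sub>m m"
proof (induction s)
  case 0
  then show ?case using carrier_matD[OF carrier] assms by simp
next
  case (Suc s)
  note c = carrier[OF pow_G[OF assms(1), of s]] carrier[OF pow_G[OF assms(2), of s]]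
    carrier[OF assms(1)] carrier[OF assms(2)]
  have "h ^\<^sub>m Suc s = h * h ^\<^sub>m s" using mat_pow_add[OF c(4), of 1 s] c(4) by simp
  then have "g ^\<^sub>m Suc s * h ^\<^sub>m Suc s = g ^\<^sub>m s * g * (h * h ^\<^sub>m s)" by simp
  also have "\<dots> = g ^\<^sub>m s * (g * (h * h ^\<^sub>m s))"
    using c by (intro assoc_mult_mat[of _ m m _ m _ m]) auto
  also have "g * (h * h ^\<^sub>m s) = g * h * h ^\<^sub>m s"
    using c by (intro assoc_mult_mat[symmetric, of _ m m _ m _ m]) auto
  also have "\<dots> = h ^\<^sub>m s" using c assms(3) by simp
  finally show ?case using Suc by simp
qed

lemma unipotent_power_inverse:
  assumes "g \<in> G" "h \<in> G" "g * h = 1\<^sub>m m" "h * g = 1\<^sub>m m"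
  shows "unipotent_power m g t * unipotent_power m h t = 1\<^sub>m m"
proof (rule eq_matI)
  fix a b assume "a < dim_row (1\<^sub>m m :: 'a mat)" "b < dim_col (1\<^sub>m m :: 'a mat)"
  then have ab: "a < m" "b < m" by auto
  have "(\<lambda>t. \<Sum>c<m. unipotent_power m g t $$ (a, c) * unipotent_power m h t $$ (c, b)) \<in> poly1"
    using ab by (intro fun_alg_sum fun_alg.mult unipotent_power_poly1) auto
  then have "(\<lambda>t. (unipotent_power m g t * unipotent_power m h t) $$ (a, b)) \<in> poly1"
    by (rule fun_alg.cong)
      (use ab in \<open>simp add: scalar_prod_def atLeast0LessThan carrier_matD[OF unipotent_power_carrier]\<close>)
  then show "(unipotent_power m g t * unipotent_power m h t) $$ (a, b) = 1\<^sub>m m $$ (a, b)"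
    by (rule poly1_eq_if_eq_on_nats[OF _ fun_alg.const])
      (simp add: unipotent_power_of_nat[OF unip] assms pow_inverse)
qed (auto simp: carrier_matD[OF unipotent_power_carrier])

text \<open>The equations of \<open>G\<close>, evaluated at \<open>g^t\<close>, become polynomials in \<open>t\<close> that vanish at all natural numbers.\<close>

lemma unipotent_power_in_G:
  assumes "g \<in> G"
  shows "unipotent_power m g t \<in> G"
proof -
  obtain P where P: "P \<subseteq> mpolys ({..<m} \<times> {..<m})"
    "G = {g \<in> carrier (GL m). \<forall>p\<in>P. mpoly_eval p (\<lambda>ij. g $$ ij) = 0}"
    using lin by (auto simp: linear_algebraic_group_def)
  obtain h where h: "h \<in> G" "g * h = 1\<^sub>m m" "h * g = 1\<^sub>m m" using inverse[OF assms] .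
  have "unipotent_power m g t \<in> carrier (GL m)"
    unfolding carrier_GL
    using unipotent_power_inverse[OF assms h] unipotent_power_inverse[OF h(1) assms h(3,2)]
      unipotent_power_carrier by blast
  moreover have "mpoly_eval p (\<lambda>ij. unipotent_power m g t $$ ij) = 0" if "p \<in> P" for p
  proof -
    have "p \<in> mpolys ({..<m} \<times> {..<m})" using P that by blast
    then have "(\<lambda>t. mpoly_eval p (\<lambda>ij. unipotent_power m g t $$ ij)) \<in> poly1"
      by (rule mpoly_eval_in_fun_alg) (auto intro: unipotent_power_poly1)
    moreover have "mpoly_eval p (\<lambda>ij. unipotent_power m g (of_nat s) $$ ij) = 0" for s
    proof -
      have "g ^\<^sub>m s \<in> {g \<in> carrier (GL m). \<forall>p\<in>P. mpoly_eval p (\<lambda>ij. g $$ ij) = 0}"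
        using pow_G[OF assms] P(2) by blast
      then show ?thesis using that by (simp add: unipotent_power_of_nat[OF unip[OF assms]])
    qed
    ultimately show ?thesis by (rule poly1_eq_if_eq_on_nats[OF _ fun_alg.const])
  qed
  ultimately show ?thesis by (subst P(2)) blast
qed

text \<open>The determinants of \<open>g^t\<close> and of its inverse are polynomials in \<open>t\<close> with product \<open>1\<close>, hence constant, and
\<open>g^0 = 1\<close>. It follows that the inverse determinant contributes only a constant to the regular functions
on \<open>G\<close>.\<close>

lemma det: assumes "g \<in> G" shows "det g = 1"
proof -
  obtain h where h: "h \<in> G" "g * h = 1\<^sub>m m" "h * g = 1\<^sub>m m" using inverse[OF assms] .
  have poly1: "(\<lambda>t. det (unipotent_power m g t)) \<in> poly1" for g
    by (intro det_poly1[of _ m] unipotent_power_poly1) auto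
  have "det (unipotent_power m g t) * det (unipotent_power m h t) = 1" for t
    using det_mult[OF unipotent_power_carrier unipotent_power_carrier, of m g t h t]
      unipotent_power_inverse[OF assms h] by simp
  then have "det (unipotent_power m g 1) = det (unipotent_power m g 0)"
    by (rule poly1_inverse_const[OF poly1 poly1])
  then show ?thesis
    using unipotent_power_of_nat[OF unip[OF assms], of 1] unipotent_power_of_nat[OF unip[OF assms], of 0]
      carrier[OF assms] by simp
qed

lemma action: "group_action ((GL m)\<lparr>carrier := G\<rparr>) (carrier_vec n) \<rho>"
  using reg by (simp add: regular_action_def)

lemma \<rho>_mult: "g \<in> G \<Longrightarrow> h \<in> G \<Longrightarrow> x \<in> carrier_vec n \<Longrightarrow> \<rho> (g * h) x = \<rho> g (\<rho> h x)"
  using group_action.composition_rule[OF action] by (simp add: GL_mult)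

lemma \<rho>_one: "x \<in> carrier_vec n \<Longrightarrow> \<rho> (1\<^sub>m m) x = x"
  using group_action.id_eq_one[OF action] by (simp add: GL_one) (metis restrict_apply')

lemma \<rho>_carrier: "g \<in> G \<Longrightarrow> x \<in> carrier_vec n \<Longrightarrow> \<rho> g x \<in> carrier_vec n"
  using group_action.element_image[OF action] by simp

lemma \<rho>_pow: "g \<in> G \<Longrightarrow> x \<in> carrier_vec n \<Longrightarrow> \<rho> (g ^\<^sub>m s) x = (\<rho> g ^^ s) x"
proof (induction s arbitrary: x)
  case 0
  then show ?case using \<rho>_one carrier_matD[OF carrier] by simp
next
  case (Suc s)
  then show ?case using \<rho>_mult[OF pow_G Suc.prems(1,2)] \<rho>_carrier by (simp add: funpow_swap1)
qed

lemma \<rho>_polynomial: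
  obtains q where
    "\<And>i. i < n \<Longrightarrow> q i \<in> fun_alg UNIV ((\<lambda>a v. v a) ` ({..<m} \<times> {..<m} <+> {..<n}))"
    "\<And>i g x. i < n \<Longrightarrow> g \<in> G \<Longrightarrow> x \<in> carrier_vec n \<Longrightarrow>
      \<rho> g x $ i = q i (case_sum (\<lambda>ij. g $$ ij) (\<lambda>j. x $ j))"
proof -
  let ?V = "{..<m} \<times> {..<m} <+> {..<n}"
  have ex: "\<exists>q. q \<in> fun_alg UNIV ((\<lambda>a v. v a) ` ?V) \<and> (\<forall>g\<in>G. \<forall>x\<in>carrier_vec n.
      \<rho> g x $ i = q (case_sum (\<lambda>ij. g $$ ij) (\<lambda>j. x $ j)))" if "i < n" for i
  proof -
    obtain p where p: "p \<in> mpolys ({Entry j k | j k. j < m \<and> k < m} \<union> {Inv_Det} \<union> {Coord j | j. j < n})"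
      "\<forall>g \<in> G. \<forall>x \<in> carrier_vec n. \<rho> g x $ i =
          mpoly_eval p (case_act_var (\<lambda>j k. g $$ (j, k)) (inverse (det g)) (\<lambda>j. x $ j))"
      using reg \<open>i < n\<close> unfolding regular_action_def by blast
    define s where "s = (\<lambda>a (v :: nat \<times> nat + nat \<Rightarrow> 'a).
      case_act_var (\<lambda>j k. v (Inl (j, k))) 1 (\<lambda>j. v (Inr j)) a)"
    have "(\<lambda>v. mpoly_eval p (\<lambda>a. s a v)) \<in> fun_alg UNIV ((\<lambda>a v. v a) ` ?V)"
    proof (rule mpoly_eval_in_fun_alg[OF p(1)])
      fix a assume "a \<in> {Entry j k | j k. j < m \<and> k < m} \<union> {Inv_Det} \<union> {Coord j | j. j < n}"
      then consider j k where "a = Entry j k" "j < m" "k < m" | "a = Inv_Det" | j where "a = Coord j" "j < n"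
        by auto
      then show "s a \<in> fun_alg UNIV ((\<lambda>a v. v a) ` ?V)"
        by cases (auto simp: s_def fun_alg.const intro: fun_alg.gen)
    qed
    moreover have "\<rho> g x $ i = mpoly_eval p (\<lambda>a. s a (case_sum (\<lambda>ij. g $$ ij) (\<lambda>j. x $ j)))"
      if "g \<in> G" "x \<in> carrier_vec n" for g x
    proof -
      have "(\<lambda>a. s a (case_sum (\<lambda>ij. g $$ ij) (\<lambda>j. x $ j))) =
          case_act_var (\<lambda>j k. g $$ (j, k)) (inverse (det g)) (\<lambda>j. x $ j)"
        using det[OF that(1)] by (auto simp: s_def fun_eq_iff split: act_var.split)
      then show ?thesis using p(2) that by simp
    qed
    ultimately show ?thesis by blast
  qed
  have "\<forall>i\<in>{..<n}. \<exists>q. q \<in> fun_alg UNIV ((\<lambda>a v. v a) ` ?V) \<and> (\<forall>g\<in>G. \<forall>x\<in>carrier_vec n.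
      \<rho> g x $ i = q (case_sum (\<lambda>ij. g $$ ij) (\<lambda>j. x $ j)))"
    by (intro ballI ex) simp
  from bchoice[OF this] obtain q where "\<forall>i\<in>{..<n}. q i \<in> fun_alg UNIV ((\<lambda>a v. v a) ` ?V) \<and>
      (\<forall>g\<in>G. \<forall>x\<in>carrier_vec n. \<rho> g x $ i = q i (case_sum (\<lambda>ij. g $$ ij) (\<lambda>j. x $ j)))" ..
  then show ?thesis by (intro that[of q]) simp_all
qed

lemma flow_polynomial:
  assumes "g \<in> G" "i < n"
  shows "(\<lambda>p. \<rho> (unipotent_power m g (fst p)) (snd p) $ i)
    \<in> fun_alg (UNIV \<times> carrier_vec n) (insert fst ((\<lambda>j p. snd p $ j) ` {..<n}))"
    (is "_ \<in> fun_alg ?X ?S")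
proof -
  obtain q where q: "\<And>i. i < n \<Longrightarrow> q i \<in> fun_alg UNIV ((\<lambda>a v. v a) ` ({..<m} \<times> {..<m} <+> {..<n}))"
    "\<And>i g x. i < n \<Longrightarrow> g \<in> G \<Longrightarrow> x \<in> carrier_vec n \<Longrightarrow>
      \<rho> g x $ i = q i (case_sum (\<lambda>ij. g $$ ij) (\<lambda>j. x $ j))"
    by (rule \<rho>_polynomial) blast
  let ?\<phi> = "\<lambda>p. case_sum (\<lambda>ij. unipotent_power m g (fst p) $$ ij) (\<lambda>j. snd p $ j)"
  have "(\<lambda>p. q i (?\<phi> p)) \<in> fun_alg ?X ?S"
  proof (rule fun_alg_comp[OF q(1)[OF assms(2)]])
    fix s :: "(nat \<times> nat + nat \<Rightarrow> 'a) \<Rightarrow> 'a"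
    assume "s \<in> (\<lambda>a v. v a) ` ({..<m} \<times> {..<m} <+> {..<n})"
    then consider a b where "a < m" "b < m" "s = (\<lambda>v. v (Inl (a, b)))" | j where "j < n" "s = (\<lambda>v. v (Inr j))"
      by auto
    then show "(\<lambda>p. s (?\<phi> p)) \<in> fun_alg ?X ?S"
    proof cases
      case 1
      have "(\<lambda>p. unipotent_power m g (fst p) $$ (a, b)) \<in> fun_alg ?X ?S"
        by (rule fun_alg_comp[OF unipotent_power_poly1[OF 1(1,2)], where \<phi> = fst]) (auto intro!: fun_alg.gen)
      then show ?thesis using 1 by simp
    next
      case 2
      then show ?thesis by (auto intro!: fun_alg.gen)
    qed
  qed simp
  then show ?thesis
    by (rule fun_alg.cong) (use q(2) assms unipotent_power_in_G in auto)
qed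

text \<open>The differences of the function \<open>g \<mapsto> (w\<^sup>T g)\<^sub>b\<close> under left translations are functions of the same kind,
with \<open>w\<close> replaced by \<open>(h\<^sup>T - 1) w\<close>. So Kolchin's theorem applies to the group of transposed matrices.\<close>

lemma entry_diff_nil:
  assumes "a < m" "b < m"
  shows "diff_nil G (\<lambda>h p. (h * fst p, snd p)) (G \<times> (carrier_vec n :: 'a vec set)) (\<lambda>p. fst p $$ (a, b))"
proof -
  let ?nil = "diff_nil G (\<lambda>h p. (h * fst p, snd p)) (G \<times> carrier_vec n)"
  let ?T = "transpose_mat ` G"
  define F where "F = (\<lambda>w p. \<Sum>c<m. (w :: 'a vec) $ c * fst (p :: 'a mat \<times> 'a vec) $$ (c, b))"
  have unip_T: "unipotent_monoid m ?T"
  proof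
    fix g assume "g \<in> ?T"
    then obtain h where h: "h \<in> G" "g = transpose_mat h" by auto
    obtain k where k: "(h - 1\<^sub>m m) ^\<^sub>m k = 0\<^sub>m m m" using unip[OF h(1)] by (auto simp: unipotent_mat_def)
    have "transpose_mat ((h - 1\<^sub>m m) ^\<^sub>m j) = (g - 1\<^sub>m m) ^\<^sub>m j" for j
    proof (induction j)
      case (Suc j)
      let ?N = "h - 1\<^sub>m m"
      have N: "?N \<in> carrier_mat m m" by (simp add: minus_carrier_mat)
      have T: "transpose_mat ?N = g - 1\<^sub>m m"
        using carrier[OF h(1)] h(2) by (simp add: transpose_minus[of _ m m])
      have "?N ^\<^sub>m Suc j = ?N * ?N ^\<^sub>m j" using mat_pow_add[OF N, of 1 j] N by simp
      then have "transpose_mat (?N ^\<^sub>m Suc j) = transpose_mat (?N ^\<^sub>m j) * transpose_mat ?N"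
        using transpose_mult[OF N pow_carrier_mat[OF N, of j]] by simp
      then show ?case using Suc T by simp
    qed (use carrier[OF h(1)] h(2) in auto)
    from this[of k] k have "(g - 1\<^sub>m m) ^\<^sub>m k = 0\<^sub>m m m" by (metis transpose_carrier_mat zero_transpose_mat)
    then show "unipotent_mat m g" using carrier[OF h(1)] h(2) by (auto simp: unipotent_mat_def)
  next
    fix g h assume "g \<in> ?T" "h \<in> ?T"
    then obtain g' h' where gh: "g' \<in> G" "h' \<in> G" "g = transpose_mat g'" "h = transpose_mat h'" by auto
    then have "g * h = transpose_mat (h' * g')"
      using transpose_mult[OF carrier carrier, of h' g'] by simp
    then show "g * h \<in> ?T" using mult gh by auto
  next
    show "1\<^sub>m m \<in> ?T" using one transpose_one by (metis image_eqI)
  qed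
  have diff: "F w (h * fst p, snd p) - F w p = F ((transpose_mat h - 1\<^sub>m m) *\<^sub>v w) p"
    if w: "w \<in> carrier_vec m" and h: "h \<in> G" and p: "fst p \<in> G" for w h p
  proof -
    note ch = carrier_matD[OF carrier[OF h]] and cp = carrier_matD[OF carrier[OF p]]
    have "F w (h * fst p, snd p) = (\<Sum>c<m. \<Sum>d<m. w $ c * (h $$ (c, d) * fst p $$ (d, b)))"
      using ch cp assms(2)
      by (simp add: F_def scalar_prod_def atLeast0LessThan sum_distrib_left)
    also have "\<dots> = (\<Sum>d<m. (\<Sum>c<m. w $ c * h $$ (c, d)) * fst p $$ (d, b))"
      by (subst sum.swap) (simp add: sum_distrib_right mult.assoc)
    finally have 1: "F w (h * fst p, snd p) = (\<Sum>d<m. (\<Sum>c<m. w $ c * h $$ (c, d)) * fst p $$ (d, b))" .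
    have 2: "((transpose_mat h - 1\<^sub>m m) *\<^sub>v w) $ d = (\<Sum>c<m. w $ c * h $$ (c, d)) - w $ d" if d: "d < m" for d
    proof -
      have "((transpose_mat h - 1\<^sub>m m) *\<^sub>v w) $ d = (\<Sum>c<m. (h $$ (c, d) - (if d = c then 1 else 0)) * w $ c)"
        using d w ch by (simp add: scalar_prod_def atLeast0LessThan)
      also have "\<dots> = (\<Sum>c<m. w $ c * h $$ (c, d)) - (\<Sum>c<m. if d = c then w $ c else 0)"
        unfolding sum_subtractf[symmetric] by (rule sum.cong) (auto simp: algebra_simps)
      finally show ?thesis using d by simp
    qed
    show ?thesis
      unfolding 1 by (simp add: F_def 2 algebra_simps sum_subtractf del: index_mult_mat_vec)
  qed
  have "?nil (F w)" if "w \<in> carrier_vec m" for w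
  proof (rule ccontr)
    assume "\<not> ?nil (F w)"
    have "\<exists>v. \<forall>j. (v j \<in> carrier_vec m \<and> \<not> ?nil (F (v j)) \<and> (j = 0 \<longrightarrow> v j = w)) \<and>
      (\<exists>h\<in>?T. v (Suc j) = (h - 1\<^sub>m m) *\<^sub>v v j)"
    proof (rule dependent_nat_choice)
      show "\<exists>x. x \<in> carrier_vec m \<and> \<not> ?nil (F x) \<and> (0 = (0::nat) \<longrightarrow> x = w)"
        using that \<open>\<not> ?nil (F w)\<close> by blast
    next
      fix x j assume x: "x \<in> carrier_vec m \<and> \<not> ?nil (F x) \<and> (j = (0::nat) \<longrightarrow> x = w)"
      have "\<exists>h\<in>G. \<not> ?nil (\<lambda>p. F x (h * fst p, snd p) - F x p)"
      proof (rule ccontr)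
        assume *: "\<not> ?thesis"
        have "?nil (F x)" by (rule diff_nil.step) (use * in blast)
        then show False using x by blast
      qed
      then obtain h where h: "h \<in> G" "\<not> ?nil (\<lambda>p. F x (h * fst p, snd p) - F x p)" by blast
      let ?y = "(transpose_mat h - 1\<^sub>m m) *\<^sub>v x"
      have "\<not> ?nil (F ?y)"
      proof
        assume "?nil (F ?y)"
        then have "?nil (\<lambda>p. F x (h * fst p, snd p) - F x p)"
          by (rule diff_nil_cong[rotated]) (use diff[of x h] x h(1) mult in auto)
        then show False using h(2) by blast
      qed
      moreover have "?y \<in> carrier_vec m"
        by (rule mult_mat_vec_carrier[of _ m m]) (use x in \<open>auto simp: minus_carrier_mat\<close>)
      ultimately show "\<exists>y. (y \<in> carrier_vec m \<and> \<not> ?nil (F y) \<and> (Suc j = 0 \<longrightarrow> y = w)) \<and>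
          (\<exists>h\<in>?T. y = (h - 1\<^sub>m m) *\<^sub>v x)"
        using h(1) by blast
    qed
    then obtain v where v: "\<And>j. v j \<in> carrier_vec m" "\<And>j. \<not> ?nil (F (v j))"
      "\<And>j. \<exists>h\<in>?T. v (Suc j) = (h - 1\<^sub>m m) *\<^sub>v v j" by blast
    then obtain h where "\<And>j. h j \<in> ?T" "\<And>j. v (Suc j) = (h j - 1\<^sub>m m) *\<^sub>v v j" by metis
    then obtain j where "v j = 0\<^sub>v m" using unipotent_monoid.kolchin[OF unip_T, of v h] v(1) by blast
    then have "?nil (F (v j))" by (intro diff_nil.zero) (simp add: F_def)
    then show False using v(2) by blast
  qed
  then have "?nil (F (unit_vec m a))" by simp
  then show ?thesis
  proof (rule diff_nil_cong[rotated])
    fix p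
    have "F (unit_vec m a) p = (\<Sum>c<m. if c = a then fst p $$ (c, b) else 0)"
      unfolding F_def by (rule sum.cong) (use assms(1) in auto)
    then show "F (unit_vec m a) p = fst p $$ (a, b)" using assms(1) by simp
  qed (use mult in auto)
qed

text \<open>Translation by \<open>h\<close> on \<open>G\<close> corresponds to \<open>f \<mapsto> f \<circ> \<rho> h\<close>, because \<open>\<rho> (h g) y = \<rho> h (\<rho> g y)\<close>.\<close>

lemma diff_nil_transfer:
  assumes "diff_nil G (\<lambda>h p. (h * fst p, snd p)) (G \<times> carrier_vec n) \<Phi>"
    and "\<And>g y. g \<in> G \<Longrightarrow> y \<in> carrier_vec n \<Longrightarrow> \<Phi> (g, y) = f (\<rho> g y)"
  shows "diff_nil (\<rho> ` G) (\<lambda>u. u) (carrier_vec n) f"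
  using assms
proof (induction arbitrary: f rule: diff_nil.induct)
  case (zero \<Phi>)
  show ?case
  proof (rule diff_nil.zero)
    fix x :: "'a vec" assume x: "x \<in> carrier_vec n"
    then show "f x = 0" using zero(1)[of "(1\<^sub>m m, x)"] zero(2)[OF one x] one \<rho>_one by simp
  qed
next
  case (step \<Phi>)
  show ?case
  proof (rule diff_nil.step)
    fix u assume "u \<in> \<rho> ` G"
    then obtain h where h: "h \<in> G" "u = \<rho> h" by auto
    show "diff_nil (\<rho> ` G) (\<lambda>u. u) (carrier_vec n) (\<lambda>x. f (u x) - f x)"
      by (rule step.IH[OF h(1)]) (use h mult \<rho>_mult step.prems in simp)
  qed
qed

lemma pol_diff_nil:
  assumes "f \<in> pol n"
  shows "diff_nil (\<rho> ` G) (\<lambda>u. u) (carrier_vec n) f"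
proof -
  obtain q where q: "\<And>i. i < n \<Longrightarrow> q i \<in> fun_alg UNIV ((\<lambda>a v. v a) ` ({..<m} \<times> {..<m} <+> {..<n}))"
    "\<And>i g x. i < n \<Longrightarrow> g \<in> G \<Longrightarrow> x \<in> carrier_vec n \<Longrightarrow>
      \<rho> g x $ i = q i (case_sum (\<lambda>ij. g $$ ij) (\<lambda>j. x $ j))"
    by (rule \<rho>_polynomial) blast
  let ?X = "G \<times> carrier_vec n"
  let ?S = "(\<lambda>(a, b) p. fst p $$ (a, b)) ` ({..<m} \<times> {..<m}) \<union> (\<lambda>j p. snd p $ j) ` {..<n}"
  have coord: "(\<lambda>p. \<rho> (fst p) (snd p) $ i) \<in> fun_alg ?X ?S" if "i < n" for i
  proof -
    have "(\<lambda>p. q i (case_sum (\<lambda>ij. fst p $$ ij) (\<lambda>j. snd p $ j))) \<in> fun_alg ?X ?S"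
      by (rule fun_alg_comp[OF q(1)[OF that]]) (auto intro!: fun_alg.gen)
    then show ?thesis by (rule fun_alg.cong) (use q(2) that in auto)
  qed
  have "(\<lambda>p. f (\<rho> (fst p) (snd p))) \<in> fun_alg ?X ?S"
    by (rule fun_alg_comp[OF assms]) (use coord \<rho>_carrier in auto)
  then have "diff_nil G (\<lambda>h p. (h * fst p, snd p)) ?X (\<lambda>p. f (\<rho> (fst p) (snd p)))"
  proof (rule diff_nil_fun_alg[rotated])
    fix s :: "'a mat \<times> 'a vec \<Rightarrow> 'a" assume "s \<in> ?S"
    then consider a b where "a < m" "b < m" "s = (\<lambda>p. fst p $$ (a, b))" | j where "j < n" "s = (\<lambda>p. snd p $ j)"
      by auto
    then show "diff_nil G (\<lambda>h p. (h * fst p, snd p)) ?X s"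
    proof cases
      case 1
      then show ?thesis using entry_diff_nil by simp
    next
      case 2
      show ?thesis by (rule diff_nil.step, rule diff_nil.zero) (simp add: 2)
    qed
  qed (use mult in auto)
  then show ?thesis by (rule diff_nil_transfer) simp
qed

text \<open>The entries of \<open>g^t\<close> are polynomials in \<open>t\<close> whose values at \<open>0\<close> are those of the unit matrix, for every \<open>g\<close>.
Hence the linear coefficient of \<open>f (\<rho> (g^t) x\<^sub>0)\<close> is a combination of the linear coefficients of these
entries with weights that depend on \<open>f\<close> but not on \<open>g\<close>.\<close>

lemma flow_linear_coefficient:
  assumes "x0 \<in> carrier_vec n"
  shows "\<exists>B. finite B \<and> (\<forall>f\<in>pol n. \<exists>b\<in>fv.span B. \<forall>g\<in>G. \<exists>r.
    (\<forall>t. f (\<rho> (unipotent_power m g t) x0) = poly r t) \<and> coeff r 1 = b g)"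
proof -
  obtain q where q: "\<And>i. i < n \<Longrightarrow> q i \<in> fun_alg UNIV ((\<lambda>a v. v a) ` ({..<m} \<times> {..<m} <+> {..<n}))"
    "\<And>i g x. i < n \<Longrightarrow> g \<in> G \<Longrightarrow> x \<in> carrier_vec n \<Longrightarrow>
      \<rho> g x $ i = q i (case_sum (\<lambda>ij. g $$ ij) (\<lambda>j. x $ j))"
    by (rule \<rho>_polynomial) blast
  let ?I = "{..<m} \<times> {..<m}"
  have ex: "\<exists>r. \<forall>t. unipotent_power m g t $$ i = poly r t" if "i \<in> ?I" for g :: "'a mat" and i
    using that unipotent_power_poly1[of "fst i" m "snd i" g] by (auto simp: poly1_iff_poly)
  define M where "M = (\<lambda>(g :: 'a mat) i. SOME r. \<forall>t. unipotent_power m g t $$ i = poly r t)"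
  have M: "unipotent_power m g t $$ i = poly (M g i) t" if "i \<in> ?I" for g :: "'a mat" and i t
    unfolding M_def by (rule someI_ex[OF ex[OF that], THEN spec])
  define B where "B = (\<lambda>i (g :: 'a mat). coeff (M g i) 1) ` ?I"
  have "\<exists>b\<in>fv.span B. \<forall>g\<in>G. \<exists>r.
    (\<forall>t. f (\<rho> (unipotent_power m g t) x0) = poly r t) \<and> coeff r 1 = b g" if f: "f \<in> pol n" for f
  proof -
    define P where "P = (\<lambda>v :: nat \<times> nat \<Rightarrow> 'a. f (vec n (\<lambda>j. q j (case_sum v (\<lambda>j. x0 $ j)))))"
    have "P \<in> fun_alg UNIV ((\<lambda>i v. v i) ` ?I)"
      unfolding P_def
    proof (rule fun_alg_comp[OF f])
      fix s :: "'a vec \<Rightarrow> 'a" assume "s \<in> (\<lambda>i v. v $ i) ` {..<n}"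
      then obtain j where j: "j < n" "s = (\<lambda>v. v $ j)" by auto
      have "(\<lambda>v. q j (case_sum v (\<lambda>j. x0 $ j))) \<in> fun_alg UNIV ((\<lambda>i v. v i) ` ?I)"
        by (rule fun_alg_comp[OF q(1)[OF j(1)]]) (auto simp: fun_alg.const intro: fun_alg.gen)
      then show "(\<lambda>v. s (vec n (\<lambda>j. q j (case_sum v (\<lambda>j. x0 $ j))))) \<in> fun_alg UNIV ((\<lambda>i v. v i) ` ?I)"
        using j by simp
    qed simp
    then obtain \<mu> where \<mu>: "\<And>M :: nat \<times> nat \<Rightarrow> 'a poly. (\<forall>i\<in>?I. poly (M i) 0 = 1\<^sub>m m $$ i) \<Longrightarrow>
      (\<exists>r. (\<forall>t. P (\<lambda>i. poly (M i) t) = poly r t) \<and> coeff r 1 = (\<Sum>i\<in>?I. \<mu> i * coeff (M i) 1))"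
      using linear_coefficient[of P ?I "\<lambda>i. 1\<^sub>m m $$ i"] by blast
    define b where "b = (\<Sum>i\<in>?I. (\<lambda>g. \<mu> i * coeff (M g i) 1))"
    have "b \<in> fv.span B"
      unfolding b_def B_def by (intro fv.span_sum fv.span_scale fv.span_base) auto
    moreover have "\<exists>r. (\<forall>t. f (\<rho> (unipotent_power m g t) x0) = poly r t) \<and> coeff r 1 = b g" if g: "g \<in> G" for g
    proof -
      have "\<forall>i\<in>?I. poly (M g i) 0 = 1\<^sub>m m $$ i"
        using unipotent_power_of_nat[OF unip[OF g], of 0] M[of _ g 0] carrier_matD[OF carrier[OF g]] by simp
      then obtain r where r: "\<And>t. P (\<lambda>i. poly (M g i) t) = poly r t" "coeff r 1 = (\<Sum>i\<in>?I. \<mu> i * coeff (M g i) 1)"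
        using \<mu> by blast
      have "f (\<rho> (unipotent_power m g t) x0) = poly r t" for t
      proof -
        have "q j (case_sum (\<lambda>i. poly (M g i) t) (\<lambda>j. x0 $ j)) =
            q j (case_sum (\<lambda>i. unipotent_power m g t $$ i) (\<lambda>j. x0 $ j))" if "j < n" for j
          by (rule fun_alg_const_on[OF q(1)[OF that]]) (auto simp: M)
        then have "vec n (\<lambda>j. q j (case_sum (\<lambda>i. poly (M g i) t) (\<lambda>j. x0 $ j))) = \<rho> (unipotent_power m g t) x0"
          using q(2)[OF _ unipotent_power_in_G[OF g] assms] carrier_vecD[OF \<rho>_carrier[OF unipotent_power_in_G[OF g] assms]]
          by (intro eq_vecI) auto
        then show ?thesis using r(1)[of t] unfolding P_def by metis
      qed
      moreover have "coeff r 1 = b g" using r(2) by (simp add: b_def sum_fun_apply)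
      ultimately show ?thesis by blast
    qed
    ultimately show ?thesis by blast
  qed
  moreover have "finite B" by (simp add: B_def)
  ultimately show ?thesis by blast
qed

end

theorem unipotent_algebraic_subgroup_diff_nil:
  fixes f :: "'a::{alg_closed_field, field_char_0} vec \<Rightarrow> 'a"
  assumes "unipotent_algebraic_subgroup n H" "f \<in> pol n"
  shows "diff_nil H (\<lambda>u. u) (carrier_vec n) f"
proof -
  obtain m G \<rho> where *: "linear_algebraic_group m G" "\<forall>g\<in>G. unipotent_mat m g" "regular_action n m G \<rho>" "H = \<rho> ` G"
    using assms by (auto simp: unipotent_algebraic_subgroup_def)
  then interpret unipotent_action n m G \<rho> by unfold_locales auto
  show ?thesis using pol_diff_nil assms *(4) by simp
qed

text \<open>A polynomial one-parameter subgroup of \<open>H\<close> through \<open>u\<close>, which is determined by its values at natural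
numbers. The pair in the last clause consists of the
parameter and the point.\<close>

definition is_flow :: "nat \<Rightarrow> ('a::field vec \<Rightarrow> 'a vec) set \<Rightarrow> ('a vec \<Rightarrow> 'a vec) \<Rightarrow> ('a \<Rightarrow> 'a vec \<Rightarrow> 'a vec) \<Rightarrow> bool"
  where "is_flow n H u \<gamma> \<longleftrightarrow> (\<forall>t. \<gamma> t \<in> H) \<and> (\<forall>s. \<forall>y\<in>carrier_vec n. \<gamma> (of_nat s) y = (u ^^ s) y) \<and>
    (\<forall>i<n. (\<lambda>p. \<gamma> (fst p) (snd p) $ i)
      \<in> fun_alg (UNIV \<times> carrier_vec n) (insert fst ((\<lambda>j p. snd p $ j) ` {..<n})))"

theorem unipotent_algebraic_subgroup_flow:
  fixes H :: "('a::{alg_closed_field, field_char_0} vec \<Rightarrow> 'a vec) set"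
  assumes "unipotent_algebraic_subgroup n H" "x0 \<in> carrier_vec n"
  obtains \<gamma> B where "\<And>u. u \<in> H \<Longrightarrow> is_flow n H u (\<gamma> u)" "finite B"
    "\<And>f. f \<in> pol n \<Longrightarrow> \<exists>b\<in>fv.span B. \<forall>u\<in>H. \<exists>r. (\<forall>t. f (\<gamma> u t x0) = poly r t) \<and> coeff r 1 = b u"
proof -
  obtain m G \<rho> where *: "linear_algebraic_group m G" "\<forall>g\<in>G. unipotent_mat m g" "regular_action n m G \<rho>"
    and H: "H = \<rho> ` G"
    using assms by (auto simp: unipotent_algebraic_subgroup_def)
  then interpret unipotent_action n m G \<rho> by unfold_locales auto
  define g where "g = inv_into G \<rho>"
  have g: "g u \<in> G" "\<rho> (g u) = u" if "u \<in> H" for u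
    using that by (auto simp: H g_def inv_into_into f_inv_into_f)
  define \<gamma> where "\<gamma> = (\<lambda>u t. \<rho> (unipotent_power m (g u) t))"
  obtain B where B: "finite B" "\<forall>f\<in>pol n. \<exists>b\<in>fv.span B. \<forall>g\<in>G. \<exists>r.
      (\<forall>t. f (\<rho> (unipotent_power m g t) x0) = poly r t) \<and> coeff r 1 = b g"
    using flow_linear_coefficient[OF assms(2)] by blast
  have "is_flow n H u (\<gamma> u)" if "u \<in> H" for u
    unfolding is_flow_def \<gamma>_def
    using g[OF that] unipotent_power_in_G[OF g(1)[OF that]] flow_polynomial[OF g(1)[OF that]]
      \<rho>_pow[OF g(1)[OF that]] unipotent_power_of_nat[OF unip[OF g(1)[OF that]]] H by auto
  moreover have "finite ((\<lambda>b. b \<circ> g) ` B)" using B by simp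
  moreover have "\<exists>b\<in>fv.span ((\<lambda>b. b \<circ> g) ` B). \<forall>u\<in>H. \<exists>r. (\<forall>t. f (\<gamma> u t x0) = poly r t) \<and> coeff r 1 = b u"
    if f: "f \<in> pol n" for f
  proof -
    obtain b where b: "b \<in> fv.span B" "\<forall>g\<in>G. \<exists>r.
      (\<forall>t. f (\<rho> (unipotent_power m g t) x0) = poly r t) \<and> coeff r 1 = b g"
      using bspec[OF B(2) f] by blast
    have "b \<circ> g \<in> fv.span ((\<lambda>b. b \<circ> g) ` B)" using b(1)
    proof (induction rule: fv.span_induct_alt)
      case base
      have "0 \<circ> g = 0" by (auto simp: zero_fun_def)
      then show ?case using fv.span_zero by metis
    next
      case (step c x y)
      have "((\<lambda>z. c * x z) + y) \<circ> g = (\<lambda>z. c * (x \<circ> g) z) + (y \<circ> g)" by (auto simp: fun_eq_iff)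
      moreover have "x \<circ> g \<in> fv.span ((\<lambda>b. b \<circ> g) ` B)" using step(1) by (intro fv.span_base imageI)
      ultimately show ?case using fv.span_add[OF fv.span_scale step(2)] by metis
    qed
    then show ?thesis using b(2) g(1) by (intro bexI[of _ "b \<circ> g"]) (auto simp: \<gamma>_def)
  qed
  ultimately show ?thesis using that by blast
qed

section \<open>Orbits of nested unipotent groups\<close>

lemma poly1_integral:
  fixes f g :: "'a::field_char_0 \<Rightarrow> 'a"
  assumes "f \<in> poly1" "g \<in> poly1" "\<And>t. f t * g t = 0"
  shows "(\<forall>t. f t = 0) \<or> (\<forall>t. g t = 0)"
proof -
  obtain p q where pq: "\<forall>t. f t = poly p t" "\<forall>t. g t = poly q t" using assms by (auto simp: poly1_iff_poly)
  then have "poly (p * q) = poly 0" using assms(3) by (simp add: fun_eq_iff)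
  then have "p * q = 0" by (simp only: poly_eq_poly_eq_iff)
  then show ?thesis using pq by auto
qed

locale nested_unipotent = aut_subgroup n U
  for n and U :: "('a::{alg_closed_field, field_char_0} vec \<Rightarrow> 'a vec) set" +
  fixes Us :: "nat \<Rightarrow> ('a vec \<Rightarrow> 'a vec) set" and x0 :: "'a vec"
  assumes unip: "\<And>i. unipotent_algebraic_subgroup n (Us i)"
    and Us_Suc: "\<And>i. Us i \<subseteq> Us (Suc i)" and U_eq: "U = (\<Union>i. Us i)"
    and x0: "x0 \<in> carrier_vec n"
    and dense: "\<And>f. f \<in> pol n \<Longrightarrow> (\<And>u. u \<in> U \<Longrightarrow> f (u x0) = 0) \<Longrightarrow> \<forall>x\<in>carrier_vec n. f x = 0"
begin

lemma Us_mono: "i \<le> j \<Longrightarrow> Us i \<subseteq> Us j"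
  using lift_Suc_mono_le[of Us] Us_Suc by blast

lemma Us_U: "u \<in> Us i \<Longrightarrow> u \<in> U"
  using U_eq by blast

lemma Us_subgroup: "aut_subgroup n (Us i)"
  using unip[of i] by (intro aut_subgroup.intro) (simp add: unipotent_algebraic_subgroup_def)

lemma flow_maps:
  assumes "is_flow n (Us i) u \<gamma>" "y \<in> carrier_vec n"
  shows "\<gamma> t y \<in> carrier_vec n"
proof -
  have "\<gamma> t \<in> Us i" using assms(1) by (simp add: is_flow_def)
  then have "\<gamma> t \<in> U" by (rule Us_U)
  then show ?thesis using maps assms(2) by blast
qed

lemma flow_pol:
  assumes \<gamma>: "is_flow n (Us i) u \<gamma>" and f: "f \<in> pol n"
  shows "(\<lambda>p. f (\<gamma> (fst p) (snd p)))
    \<in> fun_alg (UNIV \<times> carrier_vec n) (insert fst ((\<lambda>j p. snd p $ j) ` {..<n}))"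
  by (rule fun_alg_comp[OF f]) (use \<gamma> flow_maps[OF \<gamma>] in \<open>auto simp: is_flow_def\<close>)

lemma flow_poly1:
  assumes \<gamma>: "is_flow n (Us i) u \<gamma>" and f: "f \<in> pol n" and y: "y \<in> carrier_vec n"
  shows "(\<lambda>t. f (\<gamma> t y)) \<in> poly1"
proof -
  have "(\<lambda>t. (\<lambda>p. f (\<gamma> (fst p) (snd p))) (t, y)) \<in> poly1"
    by (rule fun_alg_comp[OF flow_pol[OF \<gamma> f]]) (use y in \<open>auto simp: fun_alg.const intro: fun_alg.gen\<close>)
  then show ?thesis by simp
qed

lemma flow_of_nat: "is_flow n (Us i) u \<gamma> \<Longrightarrow> y \<in> carrier_vec n \<Longrightarrow> \<gamma> (of_nat s) y = (u ^^ s) y"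
  by (simp add: is_flow_def)

lemma flow_0: "is_flow n (Us i) u \<gamma> \<Longrightarrow> y \<in> carrier_vec n \<Longrightarrow> \<gamma> 0 y = y"
  using flow_of_nat[of i u \<gamma> y 0] by simp

lemma flow_1: "is_flow n (Us i) u \<gamma> \<Longrightarrow> y \<in> carrier_vec n \<Longrightarrow> \<gamma> 1 y = u y"
  using flow_of_nat[of i u \<gamma> y 1] by simp

lemma obtain_flow:
  assumes "u \<in> Us i" obtains \<gamma> where "is_flow n (Us i) u \<gamma>"
proof (rule unipotent_algebraic_subgroup_flow[OF unip x0, of i])
  fix \<gamma> assume "\<And>u. u \<in> Us i \<Longrightarrow> is_flow n (Us i) u (\<gamma> u)"
  then show thesis using that assms by blast
qed

text \<open>If \<open>f (u x\<^sub>0) \<noteq> 0\<close> and \<open>g (v x\<^sub>0) \<noteq> 0\<close>, then the polynomials \<open>f (u\<^sup>s v\<^sup>t x\<^sub>0)\<close> and \<open>g (u\<^sup>s v\<^sup>t x\<^sub>0)\<close> in \<open>s, t\<close>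
are nonzero at \<open>(1, 0)\<close> and \<open>(0, 1)\<close> respectively, and so is their product at some point.\<close>

lemma orbit_irreducible:
  assumes f: "f \<in> pol n" and g: "g \<in> pol n" and fg: "\<And>u. u \<in> Us i \<Longrightarrow> f (u x0) * g (u x0) = 0"
  shows "(\<forall>u\<in>Us i. f (u x0) = 0) \<or> (\<forall>u\<in>Us i. g (u x0) = 0)"
proof (rule ccontr)
  assume "\<not> ?thesis"
  then obtain u v where u: "u \<in> Us i" "f (u x0) \<noteq> 0" and v: "v \<in> Us i" "g (v x0) \<noteq> 0" by blast
  obtain \<gamma> where \<gamma>: "is_flow n (Us i) u \<gamma>" using obtain_flow[OF u(1)] .
  obtain \<delta> where \<delta>: "is_flow n (Us i) v \<delta>" using obtain_flow[OF v(1)] .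
  interpret H: aut_subgroup n "Us i" by (rule Us_subgroup)
  have mem: "\<gamma> s \<in> Us i" "\<delta> t \<in> Us i" for s t using \<gamma> \<delta> by (auto simp: is_flow_def)
  have \<delta>x: "\<delta> t x0 \<in> carrier_vec n" for t by (rule flow_maps[OF \<delta> x0])
  have zero: "f (\<gamma> s (\<delta> t x0)) * g (\<gamma> s (\<delta> t x0)) = 0" for s t
    using fg[OF H.compose[OF mem]] x0 by (simp add: compose_def)
  have "(\<forall>s. f (\<gamma> s (\<delta> t x0)) = 0) \<or> (\<forall>s. g (\<gamma> s (\<delta> t x0)) = 0)" for t
    by (rule poly1_integral[OF flow_poly1[OF \<gamma> f \<delta>x] flow_poly1[OF \<gamma> g \<delta>x] zero])
  then have "f (\<gamma> 1 (\<delta> t x0)) * g (\<gamma> 0 (\<delta> t x0)) = 0" for t by (metis mult_zero_left mult_zero_right)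
  then have "f (u (\<delta> t x0)) * g (\<delta> t x0) = 0" for t
    using flow_0[OF \<gamma> \<delta>x] flow_1[OF \<gamma> \<delta>x] by simp
  then have "(\<forall>t. f (u (\<delta> t x0)) = 0) \<or> (\<forall>t. g (\<delta> t x0) = 0)"
    by (rule poly1_integral[OF flow_poly1[OF \<delta> H.pol_act[OF u(1) f] x0] flow_poly1[OF \<delta> g x0]])
  then have "f (u (\<delta> 0 x0)) = 0 \<or> g (\<delta> 1 x0) = 0" by blast
  then show False using u(2) v(2) flow_0[OF \<delta> x0] flow_1[OF \<delta> x0] by simp
qed

definition orb where "orb i = (\<lambda>u. u x0) ` Us i"

lemma orb_subset: "orb i \<subseteq> carrier_vec n"
  using maps Us_U x0 by (auto simp: orb_def)

lemma fun_alg_restrict: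
  assumes "f \<in> fun_alg X S" "Y \<subseteq> X"
  shows "f \<in> fun_alg Y S"
  using fun_alg_comp[OF assms(1), of Y "\<lambda>x. x" S] assms(2) by (auto intro: fun_alg.gen)

text \<open>Suppose that a nonzero function vanishes on each orbit \<open>U\<^sub>i x\<^sub>0\<close>. By density of the union it does not vanish
on some larger orbit, where it extends any family that is algebraically independent on \<open>U\<^sub>i x\<^sub>0\<close>. So there
are independent families of every size.\<close>

lemma ex_dense_orbit:
  obtains i where "\<And>f. f \<in> pol n \<Longrightarrow> (\<And>u. u \<in> Us i \<Longrightarrow> f (u x0) = 0) \<Longrightarrow> \<forall>x\<in>carrier_vec n. f x = 0"
proof (rule ccontr)
  assume contr: "\<not> thesis"
  have ex: "\<exists>f\<in>pol n. (\<forall>u\<in>Us i. f (u x0) = 0) \<and> \<not> (\<forall>x\<in>carrier_vec n. f x = 0)" for i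
  proof (rule ccontr)
    assume "\<not> ?thesis"
    then have "thesis" by (intro that[of i]) blast
    then show False using contr by blast
  qed
  have "\<exists>i y. (\<forall>j<d. y j \<in> pol n) \<and> alg_indep_on (orb i) d y" for d
  proof (induction d)
    case 0
    have "alg_indep_on (orb 0) 0 y" for y :: "nat \<Rightarrow> 'a vec \<Rightarrow> 'a"
      unfolding alg_indep_on_def
    proof (intro ballI impI allI)
      fix F :: "(nat \<Rightarrow> 'a) \<Rightarrow> 'a" and v assume F: "F \<in> poly_funs 0" and F0: "\<forall>x\<in>orb 0. F (\<lambda>i. y i x) = 0"
      obtain w where "w \<in> orb 0" using aut_subgroup.id[OF Us_subgroup] unfolding orb_def by blast
      then have "F (\<lambda>i. y i w) = 0" using F0 by blast
      moreover have "F v = F (\<lambda>i. y i w)" by (rule fun_alg_const_on[OF F]) auto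
      ultimately show "F v = 0" by simp
    qed
    then show ?case by blast
  next
    case (Suc d)
    then obtain i y where y: "\<And>j. j < d \<Longrightarrow> y j \<in> pol n" "alg_indep_on (orb i) d y" by blast
    obtain f where f: "f \<in> pol n" "\<forall>u\<in>Us i. f (u x0) = 0" "\<not> (\<forall>x\<in>carrier_vec n. f x = 0)" using ex by blast
    then obtain u where u: "u \<in> U" "f (u x0) \<noteq> 0" using dense by blast
    then obtain j where j: "u \<in> Us j" using U_eq by blast
    let ?k = "max i j"
    have sub: "orb i \<subseteq> orb ?k" unfolding orb_def by (intro image_mono Us_mono) simp
    have uk: "u x0 \<in> orb ?k" using j Us_mono[of j ?k] by (auto simp: orb_def)
    have "alg_indep_on (orb ?k) (Suc d) (\<lambda>l. if l < d then y l else f)"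
    proof (rule alg_indep_on_extend[OF y(2) sub _ uk u(2) y(1) f(1)])
      show "f x = 0" if "x \<in> orb i" for x using f(2) that by (auto simp: orb_def)
      show "(\<forall>x\<in>orb ?k. g x = 0) \<or> (\<forall>x\<in>orb ?k. h x = 0)"
        if "g \<in> pol n" "h \<in> pol n" "\<forall>x\<in>orb ?k. g x * h x = 0" for g h
        using orbit_irreducible[OF that(1,2), of ?k] that(3) by (auto simp: orb_def)
    qed
    then show ?case using y(1) f(1)
      by (intro exI[of _ ?k] exI[of _ "\<lambda>l. if l < d then y l else f"]) auto
  qed
  from this[of "Suc n"] obtain i y where y: "\<And>j. j < Suc n \<Longrightarrow> y j \<in> pol n" "alg_indep_on (orb i) (Suc n) y"
    by blast
  have "Suc n \<le> n"
    by (rule alg_indep_on_le[OF y(2), of "\<lambda>i v. v $ i"]) (rule fun_alg_restrict[OF y(1) orb_subset])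
  then show False by simp
qed

end

section \<open>Triangular coordinates\<close>

locale nested_unipotent_dense = nested_unipotent +
  fixes i0 :: nat
  assumes dense_i0: "\<And>f. f \<in> pol n \<Longrightarrow> (\<And>u. u \<in> Us i0 \<Longrightarrow> f (u x0) = 0) \<Longrightarrow> \<forall>x\<in>carrier_vec n. f x = 0"
begin

abbreviation gen_by :: "nat \<Rightarrow> (nat \<Rightarrow> 'a vec \<Rightarrow> 'a) \<Rightarrow> ('a vec \<Rightarrow> 'a) set"
  where "gen_by k x \<equiv> fun_alg (carrier_vec n) (x ` {..<k})"

definition triangular :: "nat \<Rightarrow> (nat \<Rightarrow> 'a vec \<Rightarrow> 'a) \<Rightarrow> bool"
  where "triangular k x \<longleftrightarrow>
    (\<forall>j<k. x j \<in> pol n \<and> (\<forall>u\<in>U. (\<lambda>y. x j (u y) - x j y) \<in> gen_by j x))"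

text \<open>In \<open>z = (p, y)\<close> the first component carries the coordinates and the second the point. Only the first \<open>k\<close>
values of \<open>p\<close> matter to \<open>\<theta> p x0\<close>.\<close>

definition section_of :: "nat \<Rightarrow> (nat \<Rightarrow> 'a vec \<Rightarrow> 'a) \<Rightarrow> ((nat \<Rightarrow> 'a) \<Rightarrow> 'a vec \<Rightarrow> 'a vec) \<Rightarrow> bool"
  where "section_of k x \<theta> \<longleftrightarrow> (\<forall>p. \<theta> p \<in> Us i0) \<and> (\<forall>p. \<forall>j<k. x j (\<theta> p x0) = p j) \<and>
    (\<forall>i<n. (\<lambda>z. \<theta> (fst z) (snd z) $ i) \<in> fun_alg (UNIV \<times> carrier_vec n)
      ((\<lambda>j z. fst z j) ` {..<k} \<union> (\<lambda>j z. snd z $ j) ` {..<n}))"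

text \<open>If the coordinates are triangular, \<open>U\<close> acts on the space of the first \<open>k\<close> of them, and this is the
stabiliser in \<open>Us i0\<close> of the image of \<open>x0\<close>.\<close>

definition stab :: "nat \<Rightarrow> (nat \<Rightarrow> 'a vec \<Rightarrow> 'a) \<Rightarrow> ('a vec \<Rightarrow> 'a vec) set"
  where "stab k x = {w \<in> Us i0. \<forall>j<k. x j (w x0) = x j x0}"

lemma gen_by_mono: "f \<in> gen_by j x \<Longrightarrow> j \<le> k \<Longrightarrow> f \<in> gen_by k x"
  by (erule fun_alg_subset) (auto intro!: fun_alg.gen)

lemma gen_by_pol: "triangular k x \<Longrightarrow> f \<in> gen_by k x \<Longrightarrow> f \<in> pol n"
  by (rule fun_alg_subset) (auto simp: triangular_def)

lemma gen_by_eq: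
  assumes "f \<in> gen_by k x" "y \<in> carrier_vec n" "z \<in> carrier_vec n" "\<And>j. j < k \<Longrightarrow> x j y = x j z"
  shows "f y = f z"
  by (rule fun_alg_const_on[OF assms(1-3)]) (use assms(4) in auto)

text \<open>For triangular coordinates, \<open>u\<close> induces an action on the first \<open>k\<close> coordinates.\<close>

lemma gen_by_act:
  assumes tri: "triangular k x" and f: "f \<in> gen_by k x" and u: "u \<in> U"
  shows "(\<lambda>y. f (u y)) \<in> gen_by k x"
proof (rule fun_alg_comp[OF f])
  fix s assume "s \<in> x ` {..<k}"
  then obtain j where j: "j < k" "s = x j" by auto
  have "(\<lambda>y. (x j (u y) - x j y) + x j y) \<in> gen_by k x"
  proof (rule fun_alg.add)
    show "(\<lambda>y. x j (u y) - x j y) \<in> gen_by k x"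
      by (rule gen_by_mono[of _ _ j]) (use tri j u in \<open>simp_all add: triangular_def\<close>)
    show "x j \<in> gen_by k x" using j by (intro fun_alg.gen) auto
  qed
  then show "(\<lambda>y. s (u y)) \<in> gen_by k x" using j by simp
qed (use maps u in auto)

lemma coord_act_eq:
  assumes tri: "triangular k x" and u: "u \<in> U" and yz: "y \<in> carrier_vec n" "z \<in> carrier_vec n"
    and eq: "\<And>j. j < k \<Longrightarrow> x j y = x j z" and j: "j < k"
  shows "x j (u y) = x j (u z)"
proof -
  have "x j \<in> gen_by k x" using j by (intro fun_alg.gen) auto
  from gen_by_act[OF tri this u] show ?thesis by (rule gen_by_eq[OF _ yz eq])
qed

lemma section_U: "section_of k x \<theta> \<Longrightarrow> \<theta> p \<in> U"
  using Us_U by (auto simp: section_of_def)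

lemma section_point: "section_of k x \<theta> \<Longrightarrow> \<theta> p x0 \<in> carrier_vec n"
  using section_U maps x0 by blast

lemma section_pol:
  assumes "section_of k x \<theta>" "f \<in> pol n"
  shows "(\<lambda>p. f (\<theta> p x0)) \<in> poly_funs k"
proof (rule fun_alg_comp[OF assms(2)])
  fix s :: "'a vec \<Rightarrow> 'a" assume "s \<in> (\<lambda>i v. v $ i) ` {..<n}"
  then obtain i where i: "i < n" "s = (\<lambda>v. v $ i)" by auto
  have "(\<lambda>z. \<theta> (fst z) (snd z) $ i) \<in> fun_alg (UNIV \<times> carrier_vec n)
      ((\<lambda>j z. fst z j) ` {..<k} \<union> (\<lambda>j z. snd z $ j) ` {..<n})"
    using assms(1) i by (simp add: section_of_def)
  then have "(\<lambda>p. (\<lambda>z. \<theta> (fst z) (snd z) $ i) (p, x0)) \<in> poly_funs k"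
    by (rule fun_alg_comp) (use x0 in \<open>auto simp: fun_alg.const intro: fun_alg.gen\<close>)
  then show "(\<lambda>p. s (\<theta> p x0)) \<in> poly_funs k" using i by simp
qed (use section_point[OF assms(1)] in auto)

lemma stab_funpow:
  assumes tri: "triangular k x" and w: "w \<in> stab k x"
  shows "(w ^^ s) x0 \<in> carrier_vec n" "j < k \<Longrightarrow> x j ((w ^^ s) x0) = x j x0"
proof -
  have wU: "w \<in> U" using w Us_U by (auto simp: stab_def)
  have "(w ^^ s) x0 \<in> carrier_vec n \<and> (\<forall>j<k. x j ((w ^^ s) x0) = x j x0)"
  proof (induction s)
    case (Suc s)
    have "x j (w ((w ^^ s) x0)) = x j x0" if "j < k" for j
      using coord_act_eq[OF tri wU _ x0, of "(w ^^ s) x0" j] Suc w that by (auto simp: stab_def)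
    then show ?case using Suc maps[OF wU] by simp
  qed (use x0 in simp)
  then show "(w ^^ s) x0 \<in> carrier_vec n" "j < k \<Longrightarrow> x j ((w ^^ s) x0) = x j x0" by auto
qed

text \<open>At natural numbers the flow consists of powers of \<open>w\<close>, which keep the coordinates of \<open>x0\<close>, and each
further application of \<open>w\<close> adds the same constant to \<open>f\<close>, since \<open>f \<circ> w - f\<close> depends on the coordinates
only. Polynomials that agree at all natural numbers are equal.\<close>

lemma stab_flow:
  assumes tri: "triangular k x" and w: "w \<in> stab k x" and \<gamma>: "is_flow n (Us i0) w \<gamma>"
  shows "j < k \<Longrightarrow> x j (\<gamma> t x0) = x j x0"
    and "f \<in> pol n \<Longrightarrow> (\<lambda>y. f (w y) - f y) \<in> gen_by k x \<Longrightarrow>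
      f (\<gamma> t x0) = f x0 + t * (f (w x0) - f x0)"
proof -
  have nat: "\<gamma> (of_nat s) x0 = (w ^^ s) x0" for s using \<gamma> x0 by (auto simp: is_flow_def)
  show "x j (\<gamma> t x0) = x j x0" if "j < k"
  proof (rule poly1_eq_if_eq_on_nats[where f = "\<lambda>t. x j (\<gamma> t x0)", OF flow_poly1[OF \<gamma> _ x0] fun_alg.const])
    show "x j \<in> pol n" using tri that by (simp add: triangular_def)
    show "x j (\<gamma> (of_nat s) x0) = x j x0" for s using stab_funpow(2)[OF tri w that] by (simp add: nat)
  qed
  assume f: "f \<in> pol n" "(\<lambda>y. f (w y) - f y) \<in> gen_by k x"
  show "f (\<gamma> t x0) = f x0 + t * (f (w x0) - f x0)"
  proof (rule poly1_eq_if_eq_on_nats[where f = "\<lambda>t. f (\<gamma> t x0)", OF flow_poly1[OF \<gamma> f(1) x0]])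
    show "(\<lambda>t. f x0 + t * (f (w x0) - f x0)) \<in> poly1"
      by (intro fun_alg.add fun_alg.mult fun_alg.const fun_alg.gen) simp
    fix s :: nat
    have "f ((w ^^ s) x0) = f x0 + of_nat s * (f (w x0) - f x0)"
    proof (induction s)
      case (Suc s)
      have "f (w ((w ^^ s) x0)) - f ((w ^^ s) x0) = f (w x0) - f x0"
        by (rule gen_by_eq[OF f(2) stab_funpow(1)[OF tri w] x0 stab_funpow(2)[OF tri w]])
      then have "f (w ((w ^^ s) x0)) = f ((w ^^ s) x0) + (f (w x0) - f x0)" by (simp add: algebra_simps)
      then show ?case using Suc by (simp add: algebra_simps)
    qed simp
    then show "f (\<gamma> (of_nat s) x0) = f x0 + of_nat s * (f (w x0) - f x0)" by (simp add: nat)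
  qed
qed

text \<open>Move a point \<open>y = u x\<^sub>0\<close> of the dense orbit by \<open>\<theta>\<^sub>p\<inverse>\<close>, where \<open>p\<close> are its coordinates. The result is \<open>w x\<^sub>0\<close> for
some \<open>w\<close> in the stabiliser, and \<open>f \<circ> \<theta>\<^sub>p - f\<close> takes the same value at \<open>w x\<^sub>0\<close> as at \<open>x\<^sub>0\<close>. Therefore
\<open>f (y) = f (\<theta>\<^sub>p x\<^sub>0)\<close>, a polynomial in \<open>p\<close>.\<close>

lemma in_gen_by:
  assumes tri: "triangular k x" and sec: "section_of k x \<theta>" and f: "f \<in> pol n"
    and inv: "\<And>u. u \<in> Us i0 \<Longrightarrow> (\<lambda>y. f (u y) - f y) \<in> gen_by k x"
    and const: "\<And>w. w \<in> stab k x \<Longrightarrow> f (w x0) = f x0"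
  shows "f \<in> gen_by k x"
proof -
  interpret H: aut_subgroup n "Us i0" by (rule Us_subgroup)
  define F where "F = (\<lambda>y. f (\<theta> (\<lambda>j. x j y) x0))"
  have F: "F \<in> gen_by k x" unfolding F_def
    by (rule fun_alg_comp[OF section_pol[OF sec f]]) (auto intro!: fun_alg.gen)
  have "f (u x0) - F (u x0) = 0" if u: "u \<in> Us i0" for u
  proof -
    let ?y = "u x0" and ?t = "\<theta> (\<lambda>j. x j (u x0))"
    have y: "?y \<in> carrier_vec n" using H.maps u x0 by blast
    have t: "?t \<in> Us i0" using sec by (simp add: section_of_def)
    obtain v where v: "v \<in> Us i0" "\<And>z. z \<in> carrier_vec n \<Longrightarrow> v (?t z) = z" "\<And>z. z \<in> carrier_vec n \<Longrightarrow> ?t (v z) = z"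
      using H.inverse[OF t] by blast
    define w where "w = compose (carrier_vec n) v u"
    have wx: "w x0 = v ?y" using x0 by (simp add: w_def compose_def)
    have w: "w \<in> stab k x"
      unfolding stab_def
    proof (intro CollectI conjI allI impI)
      show "w \<in> Us i0" unfolding w_def by (rule H.compose[OF v(1) u])
      fix j assume j: "j < k"
      have "x j (v ?y) = x j (v (?t x0))"
        by (rule coord_act_eq[OF tri Us_U[OF v(1)] y section_point[OF sec] _ j])
          (use sec in \<open>simp add: section_of_def\<close>)
      then show "x j (w x0) = x j x0" using v(2)[OF x0] wx by simp
    qed
    have vy: "v ?y \<in> carrier_vec n" using H.maps[OF v(1) y] .
    have "f ?y - f (v ?y) = f (?t (v ?y)) - f (v ?y)" using v(3)[OF y] by simp
    also have "\<dots> = f (?t x0) - f x0"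
      by (rule gen_by_eq[OF inv[OF t] vy x0]) (use w wx in \<open>auto simp: stab_def\<close>)
    finally show ?thesis using const[OF w] wx by (simp add: F_def)
  qed
  then have "\<forall>y\<in>carrier_vec n. f y - F y = 0"
    using dense_i0[of "\<lambda>y. f y - F y"] fun_alg_diff[OF f gen_by_pol[OF tri F]] by blast
  then show ?thesis by (intro fun_alg.cong[OF F]) auto
qed

text \<open>The functions \<open>f\<close> that are \<open>Us i\<close>-invariant modulo the coordinates form a descending sequence of spaces \<open>V i\<close>,
each of which contains functions that are not polynomials in the coordinates. For \<open>i \<ge> i0\<close> such an \<open>f\<close> is
determined, up to polynomials in the coordinates, by the function \<open>c f\<close> that maps \<open>u\<close> in the stabiliser to
\<open>f (u x\<^sub>0) - f x\<^sub>0\<close>. These functions range over a finite-dimensional space, so the images of the \<open>V i\<close>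
under \<open>c\<close>, and with them the \<open>V i\<close>, become stationary.\<close>

lemma ex_invariant_mod:
  assumes tri: "triangular k x" and sec: "section_of k x \<theta>" and ne: "\<not> pol n \<subseteq> gen_by k x"
  obtains f where "f \<in> pol n" "f \<notin> gen_by k x" "\<And>u. u \<in> U \<Longrightarrow> (\<lambda>y. f (u y) - f y) \<in> gen_by k x"
proof -
  define V where "V = (\<lambda>i. {f \<in> pol n. \<forall>u\<in>Us i. (\<lambda>y. f (u y) - f y) \<in> gen_by k x})"
  have ex: "\<exists>f\<in>V i. f \<notin> gen_by k x" for i
  proof -
    obtain f where f: "f \<in> pol n" "f \<notin> gen_by k x" using ne by blast
    have "\<exists>f'\<in>pol n. f' \<notin> gen_by k x \<and> (\<forall>h\<in>Us i. (\<lambda>y. f' (h y) - f' y) \<in> gen_by k x)"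
    proof (rule diff_nil_imp_invariant_mod[OF unipotent_algebraic_subgroup_diff_nil[OF unip f(1)] f(2) _ f(1)])
      show "g \<in> gen_by k x" if "\<And>y. y \<in> carrier_vec n \<Longrightarrow> g y = 0" for g
        by (rule fun_alg.cong[OF fun_alg.const[of 0]]) (simp add: that)
      show "(\<lambda>y. g (h y) - g y) \<in> pol n" if "g \<in> pol n" "h \<in> Us i" for g h
        using fun_alg_diff[OF pol_act[OF Us_U[OF that(2)] that(1)] that(1)] .
    qed
    then show ?thesis by (auto simp: V_def)
  qed
  have V_anti: "V j \<subseteq> V i" if "i \<le> j" for i j using Us_mono[OF that] by (auto simp: V_def)
  have V_add: "(\<lambda>y. f y + g y) \<in> V i" if "f \<in> V i" "g \<in> V i" for f g i
  proof -
    have "(\<lambda>y. (f (u y) - f y) + (g (u y) - g y)) \<in> gen_by k x" if "u \<in> Us i" for u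
      using \<open>f \<in> V i\<close> \<open>g \<in> V i\<close> that by (intro fun_alg.add) (auto simp: V_def)
    then show ?thesis using that by (auto simp: V_def algebra_simps intro: fun_alg.add)
  qed
  have V_smult: "(\<lambda>y. c * f y) \<in> V i" if "f \<in> V i" for c f i
  proof -
    have "(\<lambda>y. c * (f (u y) - f y)) \<in> gen_by k x" if "u \<in> Us i" for u
      using \<open>f \<in> V i\<close> that by (intro fun_alg.mult fun_alg.const) (auto simp: V_def)
    then show ?thesis using that by (auto simp: V_def right_diff_distrib intro: fun_alg.mult fun_alg.const)
  qed
  define c where "c = (\<lambda>f u. if u \<in> stab k x then f (u x0) - f x0 else 0 :: 'a)"
  obtain \<gamma> B where flow: "\<And>u. u \<in> Us i0 \<Longrightarrow> is_flow n (Us i0) u (\<gamma> u)" and B: "finite B"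
    "\<And>f. f \<in> pol n \<Longrightarrow> \<exists>b\<in>fv.span B. \<forall>u\<in>Us i0. \<exists>r. (\<forall>t. f (\<gamma> u t x0) = poly r t) \<and> coeff r 1 = b u"
    by (rule unipotent_algebraic_subgroup_flow[OF unip x0, of i0]) blast
  define R where "R = (\<lambda>(b :: ('a vec \<Rightarrow> 'a vec) \<Rightarrow> 'a) u. if u \<in> stab k x then b u else 0)"
  have R_span: "R b \<in> fv.span (R ` B)" if "b \<in> fv.span B" for b
    using that
  proof (induction rule: fv.span_induct_alt)
    case base
    have "R 0 = 0" by (auto simp: R_def fun_eq_iff)
    then show ?case using fv.span_zero by metis
  next
    case (step a b b')
    have "R ((\<lambda>z. a * b z) + b') = (\<lambda>z. a * R b z) + R b'" by (auto simp: R_def fun_eq_iff)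
    moreover have "R b \<in> fv.span (R ` B)" using step(1) by (intro fv.span_base imageI)
    ultimately show ?case using fv.span_add[OF fv.span_scale step(2)] by metis
  qed
  have c_span: "c f \<in> fv.span (R ` B)" if f: "f \<in> V i0" for f
  proof -
    have fp: "f \<in> pol n" using f by (simp add: V_def)
    obtain b where b: "b \<in> fv.span B"
      "\<forall>u\<in>Us i0. \<exists>r. (\<forall>t. f (\<gamma> u t x0) = poly r t) \<and> coeff r 1 = b u" using B(2)[OF fp] by blast
    have "c f u = R b u" for u
    proof (cases "u \<in> stab k x")
      case True
      then have u: "u \<in> Us i0" by (simp add: stab_def)
      then obtain r where r: "\<And>t. f (\<gamma> u t x0) = poly r t" "coeff r 1 = b u" using b(2) by blast
      have "(\<lambda>y. f (u y) - f y) \<in> gen_by k x" using f u by (simp add: V_def)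
      then have "poly r t = poly [:f x0, f (u x0) - f x0:] t" for t
        using stab_flow(2)[OF tri True flow[OF u] fp] r(1) by simp
      then have "r = [:f x0, f (u x0) - f x0:]" by (intro poly_eq_if_eq_on_nats)
      then show ?thesis using r(2) True by (simp add: c_def R_def)
    qed (simp add: c_def R_def)
    then have "c f = R b" by (rule ext)
    then show ?thesis using R_span[OF b(1)] by simp
  qed
  define W where "W = (\<lambda>i. c ` V (i0 + i))"
  have "fv.subspace (W i)" for i
  proof (rule fv.subspaceI)
    have "(\<lambda>y. 0) \<in> V (i0 + i)" by (simp add: V_def fun_alg.const)
    moreover have "c (\<lambda>y. 0) = 0" by (auto simp: c_def)
    ultimately show "0 \<in> W i" unfolding W_def by (metis imageI)
  next
    fix a b assume "a \<in> W i" "b \<in> W i"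
    then obtain f g where fg: "f \<in> V (i0 + i)" "g \<in> V (i0 + i)" "a = c f" "b = c g" by (auto simp: W_def)
    have "c (\<lambda>y. f y + g y) = a + b" by (auto simp: fg c_def fun_eq_iff)
    then show "a + b \<in> W i" using V_add[OF fg(1,2)] unfolding W_def by (metis imageI)
  next
    fix d a assume "a \<in> W i"
    then obtain f where f: "f \<in> V (i0 + i)" "a = c f" by (auto simp: W_def)
    have "c (\<lambda>y. d * f y) = (\<lambda>u. d * a u)" by (auto simp: f c_def fun_eq_iff right_diff_distrib)
    then show "(\<lambda>u. d * a u) \<in> W i" using V_smult[OF f(1)] unfolding W_def by (metis imageI)
  qed
  moreover have "W i \<subseteq> fv.span (R ` B)" for i
    using c_span V_anti[of i0 "i0 + i"] by (auto simp: W_def)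
  moreover have "W (Suc i) \<subseteq> W i" for i
    unfolding W_def by (intro image_mono V_anti) simp
  moreover have "finite (R ` B)" using B(1) by simp
  ultimately obtain i where i: "\<And>j. i \<le> j \<Longrightarrow> W j = W i"
    using descending_subspaces_stabilise[of "R ` B" W] by metis
  obtain f where f: "f \<in> V (i0 + i)" "f \<notin> gen_by k x" using ex by blast
  have "(\<lambda>y. f (u y) - f y) \<in> gen_by k x" if u: "u \<in> U" for u
  proof -
    obtain j where j: "u \<in> Us j" using u U_eq by blast
    have uj: "u \<in> Us (i0 + (i + j))" using j Us_mono[of j "i0 + (i + j)"] by auto
    have "c f \<in> W (i + j)" using f(1) i[of "i + j"] by (auto simp: W_def)
    then obtain g where g: "g \<in> V (i0 + (i + j))" "c g = c f" by (auto simp: W_def)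
    have g0: "g \<in> V i0" by (rule subsetD[OF V_anti g(1)]) simp
    have f0: "f \<in> V i0" by (rule subsetD[OF V_anti f(1)]) simp
    define h where "h = (\<lambda>y. f y + (-1) * g y)"
    have h0: "h \<in> V i0" unfolding h_def by (intro V_add V_smult f0 g0)
    have h: "h \<in> gen_by k x"
    proof (rule in_gen_by[OF tri sec])
      show "h \<in> pol n" using h0 by (simp add: V_def)
      show "(\<lambda>y. h (u y) - h y) \<in> gen_by k x" if "u \<in> Us i0" for u using h0 that by (simp add: V_def)
      show "h (w x0) = h x0" if "w \<in> stab k x" for w
        using fun_cong[OF g(2), of w] that by (simp add: h_def c_def algebra_simps)
    qed
    have "(\<lambda>y. (h (u y) - h y) + (g (u y) - g y)) \<in> gen_by k x"
    proof (rule fun_alg.add)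
      show "(\<lambda>y. h (u y) - h y) \<in> gen_by k x" by (rule fun_alg_diff[OF gen_by_act[OF tri h u] h])
      show "(\<lambda>y. g (u y) - g y) \<in> gen_by k x" using g(1) uj by (simp add: V_def)
    qed
    then show ?thesis by (simp add: h_def)
  qed
  then show ?thesis using that[of f] f by (auto simp: V_def)
qed

text \<open>The new coordinate \<open>f\<close> is not constant along the stabiliser, so it grows linearly along the flow of some
\<open>w\<close> in the stabiliser, which preserves the old coordinates. Following this flow for the time \<open>\<tau> p\<close> before
applying \<open>\<theta> p\<close> adjusts the new coordinate to \<open>p k\<close>.\<close>

lemma extend:
  assumes tri: "triangular k x" and sec: "section_of k x \<theta>" and ne: "\<not> pol n \<subseteq> gen_by k x"
  shows "\<exists>x' \<theta>'. triangular (Suc k) x' \<and> section_of (Suc k) x' \<theta>'"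
proof -
  interpret H: aut_subgroup n "Us i0" by (rule Us_subgroup)
  obtain f where f: "f \<in> pol n" "f \<notin> gen_by k x" "\<And>u. u \<in> U \<Longrightarrow> (\<lambda>y. f (u y) - f y) \<in> gen_by k x"
    using ex_invariant_mod[OF assms] by blast
  have "\<exists>w\<in>stab k x. f (w x0) \<noteq> f x0"
    using in_gen_by[OF tri sec f(1)] f(2,3) Us_U by blast
  then obtain w where w: "w \<in> stab k x" "f (w x0) \<noteq> f x0" by blast
  have wi: "w \<in> Us i0" using w(1) by (simp add: stab_def)
  obtain \<gamma> where \<gamma>: "is_flow n (Us i0) w \<gamma>" using obtain_flow[OF wi] .
  define a where "a = f (w x0) - f x0"
  have a: "a \<noteq> 0" using w(2) by (simp add: a_def)
  define x' where "x' = x(k := f)"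
  define \<tau> where "\<tau> = (\<lambda>p. inverse a * (p k - f (\<theta> p x0)))"
  define \<theta>' where "\<theta>' = (\<lambda>p. compose (carrier_vec n) (\<theta> p) (\<gamma> (\<tau> p)))"
  have gen_x': "gen_by j x' = gen_by j x" if "j \<le> k" for j
  proof -
    have "x' ` {..<j} = x ` {..<j}" using that by (intro image_cong) (auto simp: x'_def)
    then show ?thesis by simp
  qed
  have "triangular (Suc k) x'"
    unfolding triangular_def
  proof (intro allI impI)
    fix j assume "j < Suc k"
    then consider "j < k" "x' j = x j" | "j = k" "x' j = f" by (auto simp: x'_def less_Suc_eq)
    then show "x' j \<in> pol n \<and> (\<forall>u\<in>U. (\<lambda>y. x' j (u y) - x' j y) \<in> gen_by j x')"
      by cases (use tri f(1,3) gen_x' in \<open>auto simp: triangular_def\<close>)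
  qed
  moreover have "section_of (Suc k) x' \<theta>'"
    unfolding section_of_def
  proof (intro conjI allI impI)
    fix p
    have \<theta>i: "\<theta> p \<in> Us i0" using sec by (simp add: section_of_def)
    have \<gamma>i: "\<gamma> t \<in> Us i0" for t using \<gamma> by (simp add: is_flow_def)
    show "\<theta>' p \<in> Us i0" unfolding \<theta>'_def by (rule H.compose[OF \<theta>i \<gamma>i])
    fix j assume j: "j < Suc k"
    have \<theta>'x: "\<theta>' p x0 = \<theta> p (\<gamma> (\<tau> p) x0)" using x0 by (simp add: \<theta>'_def compose_def)
    have \<gamma>x: "\<gamma> (\<tau> p) x0 \<in> carrier_vec n" by (rule flow_maps[OF \<gamma> x0])
    show "x' j (\<theta>' p x0) = p j"
    proof (cases "j = k")
      case False
      then have jk: "j < k" using j by simp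
      have "x j (\<theta> p (\<gamma> (\<tau> p) x0)) = x j (\<theta> p x0)"
        by (rule coord_act_eq[OF tri section_U[OF sec] \<gamma>x x0 stab_flow(1)[OF tri w(1) \<gamma>] jk])
      then show ?thesis using sec jk by (simp add: \<theta>'x x'_def section_of_def)
    next
      case True
      have "f (\<theta> p (\<gamma> (\<tau> p) x0)) - f (\<gamma> (\<tau> p) x0) = f (\<theta> p x0) - f x0"
        by (rule gen_by_eq[OF f(3)[OF section_U[OF sec]] \<gamma>x x0 stab_flow(1)[OF tri w(1) \<gamma>]])
      moreover have "f (\<gamma> (\<tau> p) x0) = f x0 + \<tau> p * a"
        unfolding a_def by (rule stab_flow(2)[OF tri w(1) \<gamma> f(1) f(3)[OF Us_U[OF wi]]])
      moreover have "\<tau> p * a = p k - f (\<theta> p x0)" using a by (simp add: \<tau>_def)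
      ultimately have "f (\<theta> p (\<gamma> (\<tau> p) x0)) = p k" by (simp add: algebra_simps)
      then show ?thesis by (simp add: \<theta>'x x'_def True)
    qed
  next
    fix i assume i: "i < n"
    let ?X = "UNIV \<times> carrier_vec n :: ((nat \<Rightarrow> 'a) \<times> 'a vec) set"
    let ?S = "(\<lambda>j z. fst z j) ` {..<Suc k} \<union> (\<lambda>j z. snd z $ j) ` {..<n} :: ((nat \<Rightarrow> 'a) \<times> 'a vec \<Rightarrow> 'a) set"
    have \<tau>: "(\<lambda>z. \<tau> (fst z)) \<in> fun_alg ?X ?S"
    proof -
      have "(\<lambda>z. f (\<theta> (fst z) x0)) \<in> fun_alg ?X ?S"
        by (rule fun_alg_comp[OF section_pol[OF sec f(1)], where \<phi> = fst]) (auto intro!: fun_alg.gen)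
      moreover have "(\<lambda>z. fst z k) \<in> fun_alg ?X ?S" by (rule fun_alg.gen) auto
      ultimately show ?thesis unfolding \<tau>_def by (intro fun_alg.mult fun_alg.const fun_alg_diff)
    qed
    have \<gamma>_pol: "(\<lambda>z. \<gamma> (\<tau> (fst z)) (snd z) $ j) \<in> fun_alg ?X ?S" if "j < n" for j
    proof -
      have "(\<lambda>p. \<gamma> (fst p) (snd p) $ j) \<in> fun_alg (UNIV \<times> carrier_vec n) (insert fst ((\<lambda>j p. snd p $ j) ` {..<n}))"
        using \<gamma> that by (simp add: is_flow_def)
      then have "(\<lambda>z. (\<lambda>p. \<gamma> (fst p) (snd p) $ j) (\<tau> (fst z), snd z)) \<in> fun_alg ?X ?S"
        by (rule fun_alg_comp) (use \<tau> in \<open>auto intro: fun_alg.gen\<close>)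
      then show ?thesis by simp
    qed
    have "(\<lambda>z. \<theta> (fst z) (snd z) $ i) \<in> fun_alg ?X ((\<lambda>j z. fst z j) ` {..<k} \<union> (\<lambda>j z. snd z $ j) ` {..<n})"
      using sec i by (simp add: section_of_def)
    then have "(\<lambda>z. (\<lambda>z. \<theta> (fst z) (snd z) $ i) (fst z, \<gamma> (\<tau> (fst z)) (snd z))) \<in> fun_alg ?X ?S"
    proof (rule fun_alg_comp)
      show "(fst y, \<gamma> (\<tau> (fst y)) (snd y)) \<in> ?X" if "y \<in> ?X" for y
        using flow_maps[OF \<gamma>] that by auto
      fix s :: "(nat \<Rightarrow> 'a) \<times> 'a vec \<Rightarrow> 'a" assume "s \<in> (\<lambda>j z. fst z j) ` {..<k} \<union> (\<lambda>j z. snd z $ j) ` {..<n}"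
      then consider j where "j < k" "s = (\<lambda>z. fst z j)" | j where "j < n" "s = (\<lambda>z. snd z $ j)" by auto
      then show "(\<lambda>y. s (fst y, \<gamma> (\<tau> (fst y)) (snd y))) \<in> fun_alg ?X ?S"
      proof cases
        case 1
        then show ?thesis by (auto intro!: fun_alg.gen)
      next
        case 2
        then show ?thesis using \<gamma>_pol by simp
      qed
    qed
    then show "(\<lambda>z. \<theta>' (fst z) (snd z) $ i) \<in> fun_alg ?X ?S"
      by (rule fun_alg.cong) (auto simp: \<theta>'_def compose_def)
  qed
  ultimately show ?thesis by blast
qed

text \<open>A section makes the coordinates independent, so there are at most \<open>n\<close> of them. A maximal system generates
all polynomial functions, in particular the given coordinates of affine space, and then consists of \<open>n\<close>
functions by the same count.\<close>

theorem ex_triangular_coordinates: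
  obtains x \<theta> where "triangular n x" "section_of n x \<theta>"
    "\<And>y z. y \<in> carrier_vec n \<Longrightarrow> z \<in> carrier_vec n \<Longrightarrow> (\<And>j. j < n \<Longrightarrow> x j y = x j z) \<Longrightarrow> y = z"
proof -
  define Q where "Q = (\<lambda>k. \<exists>x \<theta>. triangular k x \<and> section_of k x \<theta>)"
  have "Q 0"
  proof -
    have "section_of 0 x (\<lambda>p. \<lambda>y\<in>carrier_vec n. y)" for x
      unfolding section_of_def
    proof (intro conjI allI impI)
      show "(\<lambda>y\<in>carrier_vec n. y) \<in> Us i0" by (rule aut_subgroup.id[OF Us_subgroup])
      fix i assume "i < n"
      then have "(\<lambda>z. snd z $ i) \<in> fun_alg (UNIV \<times> carrier_vec n)
        ((\<lambda>j z. fst z j) ` {..<0} \<union> (\<lambda>j z. snd z $ j) ` {..<n} :: ((nat \<Rightarrow> 'a) \<times> 'a vec \<Rightarrow> 'a) set)"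
        by (intro fun_alg.gen) auto
      then show "(\<lambda>z. (\<lambda>y\<in>carrier_vec n. y) (snd z) $ i) \<in> fun_alg (UNIV \<times> carrier_vec n)
        ((\<lambda>j z. fst z j) ` {..<0} \<union> (\<lambda>j z. snd z $ j) ` {..<n} :: ((nat \<Rightarrow> 'a) \<times> 'a vec \<Rightarrow> 'a) set)"
        by (rule fun_alg.cong) auto
    qed simp
    then show ?thesis unfolding Q_def triangular_def by blast
  qed
  have bound: "k \<le> n" if Q: "Q k" for k
  proof -
    obtain x \<theta> where x: "triangular k x" "section_of k x \<theta>" using Q unfolding Q_def by blast
    have "alg_indep_on (carrier_vec n) k x"
    proof (rule alg_indep_on_surj)
      fix v show "\<exists>y\<in>carrier_vec n. \<forall>i<k. x i y = v i"
        using section_point[OF x(2), of v] x(2) by (auto simp: section_of_def)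
    qed
    then show ?thesis
      by (rule alg_indep_on_le[of _ _ _ "\<lambda>i v. v $ i"]) (use x(1) in \<open>simp add: triangular_def\<close>)
  qed
  define k where "k = (GREATEST k. Q k)"
  have "Q k" unfolding k_def by (rule GreatestI_nat[where P = Q, OF \<open>Q 0\<close> bound])
  moreover have "\<not> Q (Suc k)"
  proof
    assume "Q (Suc k)"
    then have "Suc k \<le> k" unfolding k_def by (rule Greatest_le_nat[where P = Q, OF _ bound])
    then show False by simp
  qed
  ultimately obtain x \<theta> where x: "triangular k x" "section_of k x \<theta>" "pol n \<subseteq> gen_by k x"
    using extend unfolding Q_def by blast
  have coord: "(\<lambda>v. v $ i) \<in> gen_by k x" if "i < n" for i
    by (rule subsetD[OF x(3)], rule fun_alg.gen) (use that in auto)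
  have "alg_indep_on (carrier_vec n) n (\<lambda>i (v :: 'a vec). v $ i)"
  proof (rule alg_indep_on_surj)
    fix v :: "nat \<Rightarrow> 'a" show "\<exists>y\<in>carrier_vec n. \<forall>i<n. y $ i = v i"
      by (rule bexI[of _ "vec n v"]) auto
  qed
  then have "n \<le> k" by (rule alg_indep_on_le) (rule coord)
  then have k: "k = n" using bound[OF \<open>Q k\<close>] by simp
  have "y = z" if yz: "y \<in> carrier_vec n" "z \<in> carrier_vec n" "\<And>j. j < n \<Longrightarrow> x j y = x j z" for y z
  proof (rule eq_vecI)
    fix i assume "i < dim_vec z"
    then have "i < n" using yz by simp
    from coord[OF this] show "y $ i = z $ i" by (rule gen_by_eq) (use yz k in auto)
  qed (use yz in simp)
  then show ?thesis using that x(1,2) k by blast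
qed

end

section \<open>Transitivity and triangulability\<close>

lemma zariski_dense_vanishing:
  assumes S: "zariski_dense n S" and f: "f \<in> pol n" "\<And>x. x \<in> S \<Longrightarrow> f x = 0"
  shows "\<forall>x\<in>carrier_vec n. f x = 0"
proof -
  obtain p where p: "p \<in> mpolys {..<n}" "\<And>x. x \<in> carrier_vec n \<Longrightarrow> f x = mpoly_eval p (\<lambda>j. x $ j)"
    using f(1) by (auto simp: pol_iff_mpoly)
  let ?Z = "{x \<in> carrier_vec n. \<forall>q\<in>{p}. mpoly_eval q (\<lambda>i. x $ i) = 0}"
  have "zariski_closed n ?Z" unfolding zariski_closed_def using p(1) by blast
  moreover have "S \<subseteq> ?Z"
  proof
    fix x assume x: "x \<in> S"
    then have "x \<in> carrier_vec n" using S by (auto simp: zariski_dense_def)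
    then show "x \<in> ?Z" using f(2)[OF x] p(2)[of x] by simp
  qed
  ultimately have "zariski_closure n S \<subseteq> ?Z" unfolding zariski_closure_def by blast
  then show ?thesis using S p(2) by (auto simp: zariski_dense_def)
qed

lemma (in aut_subgroup) group_action:
  "group_action ((Aut n)\<lparr>carrier := U\<rparr>) (carrier_vec n) (\<lambda>u. u)"
proof -
  have "group_hom ((Aut n)\<lparr>carrier := U\<rparr>) (BijGroup (carrier_vec n)) (\<lambda>u. u)"
  proof (intro group_hom.intro group_hom_axioms.intro)
    show "group ((Aut n)\<lparr>carrier := U\<rparr>)"
      by (rule group.subgroup_imp_group[OF group_Aut subgroup])
    show "group (BijGroup (carrier_vec n))" by (rule group_BijGroup)
    show "(\<lambda>u. u) \<in> hom ((Aut n)\<lparr>carrier := U\<rparr>) (BijGroup (carrier_vec n))"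
      using in_Bij by (auto simp: hom_def BijGroup_def Aut_def)
  qed
  then show ?thesis by (rule group_action.intro)
qed

lemma mpoly_eval_cong:
  assumes "p \<in> mpolys V" "\<And>i. i \<in> V \<Longrightarrow> x i = y i"
  shows "mpoly_eval p x = mpoly_eval p y"
proof -
  have "(\<lambda>v. mpoly_eval p (\<lambda>i. v i)) \<in> fun_alg UNIV ((\<lambda>i v. v i) ` V)"
    by (rule mpoly_eval_in_fun_alg[OF assms(1)]) (auto intro: fun_alg.gen)
  then show ?thesis by (rule fun_alg_const_on) (use assms(2) in auto)
qed

lemma (in group) subgroup_conjugate:
  assumes "subgroup H G" "g \<in> carrier G"
  shows "subgroup (g <# H #> inv g) G"
proof -
  have mem: "y \<in> g <# H #> inv g \<longleftrightarrow> (\<exists>h\<in>H. y = g \<otimes> h \<otimes> inv g)" for y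
    by (auto simp: l_coset_def r_coset_def)
  have c: "h \<in> carrier G" if "h \<in> H" for h using subgroup.mem_carrier[OF assms(1) that] .
  show ?thesis
  proof (rule subgroupI)
    show "g <# H #> inv g \<subseteq> carrier G" using c assms(2) by (auto simp: mem)
    show "g <# H #> inv g \<noteq> {}" using subgroup.one_closed[OF assms(1)] mem by blast
  next
    fix a assume "a \<in> g <# H #> inv g"
    then obtain h where h: "h \<in> H" "a = g \<otimes> h \<otimes> inv g" by (auto simp: mem)
    then have "inv a = g \<otimes> inv h \<otimes> inv g"
      using c assms(2) by (simp add: inv_mult_group m_assoc)
    then show "inv a \<in> g <# H #> inv g" using subgroup.m_inv_closed[OF assms(1) h(1)] mem by blast
  next
    fix a b assume "a \<in> g <# H #> inv g" "b \<in> g <# H #> inv g"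
    then obtain h k where h: "h \<in> H" "a = g \<otimes> h \<otimes> inv g" and k: "k \<in> H" "b = g \<otimes> k \<otimes> inv g"
      by (auto simp: mem)
    have "a \<otimes> b = g \<otimes> (h \<otimes> ((inv g \<otimes> g) \<otimes> (k \<otimes> inv g)))"
      using c[OF h(1)] c[OF k(1)] assms(2) by (simp only: h(2) k(2) m_assoc m_closed inv_closed)
    also have "\<dots> = g \<otimes> (h \<otimes> k) \<otimes> inv g"
      using c[OF h(1)] c[OF k(1)] assms(2) by (simp add: m_assoc)
    finally show "a \<otimes> b \<in> g <# H #> inv g" using subgroup.m_closed[OF assms(1) h(1) k(1)] mem by blast
  qed
qed

context nested_unipotent_dense
begin

text \<open>The coordinate map \<open>\<phi>\<close> and the map \<open>\<psi>\<close> that applies the section to \<open>x0\<close> are inverse to each other. As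
\<open>\<psi>\<close> takes values in the orbit of \<open>x0\<close>, this orbit is everything.\<close>

lemma transitive_and_triangulable:
  "transitive_action ((Aut n)\<lparr>carrier := U\<rparr>) (carrier_vec n) (\<lambda>u. u)" "triangulable n U"
proof -
  obtain x \<theta> where tri: "triangular n x" and sec: "section_of n x \<theta>"
    and inj: "\<And>y z. y \<in> carrier_vec n \<Longrightarrow> z \<in> carrier_vec n \<Longrightarrow> (\<And>j. j < n \<Longrightarrow> x j y = x j z) \<Longrightarrow> y = z"
    by (rule ex_triangular_coordinates) blast
  define \<phi> where "\<phi> = (\<lambda>y\<in>carrier_vec n. vec n (\<lambda>j. x j y))"
  define \<psi> where "\<psi> = (\<lambda>v :: 'a vec. \<theta> (\<lambda>j. v $ j) x0)"
  have \<psi>: "\<psi> v \<in> carrier_vec n" "j < n \<Longrightarrow> x j (\<psi> v) = v $ j" for v j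
    using section_point[OF sec] sec by (auto simp: \<psi>_def section_of_def)
  have \<phi>_carrier: "\<phi> y \<in> carrier_vec n" if "y \<in> carrier_vec n" for y using that by (simp add: \<phi>_def)
  have \<psi>\<phi>: "\<psi> (\<phi> y) = y" if "y \<in> carrier_vec n" for y
    by (rule inj) (use that \<psi> in \<open>auto simp: \<phi>_def\<close>)
  have \<phi>\<psi>: "\<phi> (\<psi> v) = v" if "v \<in> carrier_vec n" for v
    by (rule eq_vecI) (use that \<psi> in \<open>auto simp: \<phi>_def\<close>)
  have orbit: "\<exists>u\<in>U. u x0 = y" if "y \<in> carrier_vec n" for y
    using \<psi>\<phi>[OF that] section_U[OF sec] unfolding \<psi>_def by blast
  show "transitive_action ((Aut n)\<lparr>carrier := U\<rparr>) (carrier_vec n) (\<lambda>u. u)"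
  proof (intro transitive_action.intro transitive_action_axioms.intro group_action)
    fix y z :: "'a vec" assume y: "y \<in> carrier_vec n" and z: "z \<in> carrier_vec n"
    obtain u v where u: "u \<in> U" "u x0 = y" and v: "v \<in> U" "v x0 = z" using orbit y z by blast
    obtain w where w: "w \<in> U" "\<And>p. p \<in> carrier_vec n \<Longrightarrow> w (u p) = p" using inverse[OF u(1)] by blast
    have "compose (carrier_vec n) v w y = z" using w(2)[OF x0] u v y by (simp add: compose_def)
    then show "\<exists>g\<in>carrier ((Aut n)\<lparr>carrier := U\<rparr>). g y = z" using compose[OF v(1) w(1)] by auto
  qed
  have bij: "bij_betw \<phi> (carrier_vec n) (carrier_vec n)"
    by (rule bij_betw_byWitness[of _ \<psi>]) (simp_all add: \<psi>\<phi> \<phi>\<psi> \<phi>_carrier \<psi> image_subset_iff)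
  have \<phi>_inv: "(\<lambda>v\<in>carrier_vec n. inv_into (carrier_vec n) \<phi> v) = (\<lambda>v\<in>carrier_vec n. \<psi> v)"
  proof (rule restrict_ext)
    fix v :: "'a vec" assume v: "v \<in> carrier_vec n"
    show "inv_into (carrier_vec n) \<phi> v = \<psi> v"
      by (rule inv_into_f_eq) (use bij \<phi>\<psi>[OF v] \<psi> in \<open>auto simp: bij_betw_def\<close>)
  qed
  have "polynomial_map n \<phi>" unfolding polynomial_map_iff
  proof (intro allI impI)
    fix i assume i: "i < n"
    then have "x i \<in> pol n" using tri by (simp add: triangular_def)
    then show "(\<lambda>y. \<phi> y $ i) \<in> pol n" by (rule fun_alg.cong) (simp add: \<phi>_def i)
  qed
  moreover have "polynomial_map n (\<lambda>v\<in>carrier_vec n. \<psi> v)" unfolding polynomial_map_iff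
  proof (intro allI impI)
    fix i assume i: "i < n"
    have "(\<lambda>v. v $ i) \<in> pol n" using i by (intro fun_alg.gen) auto
    from section_pol[OF sec this] have "(\<lambda>v. \<theta> (\<lambda>j. v $ j) x0 $ i) \<in> pol n"
      by (rule fun_alg_comp) (auto intro: fun_alg.gen)
    then show "(\<lambda>y. (\<lambda>v\<in>carrier_vec n. \<psi> v) y $ i) \<in> pol n" by (rule fun_alg.cong) (simp add: \<psi>_def)
  qed
  ultimately have \<phi>_Aut: "\<phi> \<in> carrier (Aut n)"
    unfolding carrier_Aut \<phi>_inv using bij by (auto simp: Bij_def \<phi>_def)
  then have \<psi>_Aut: "inv\<^bsub>Aut n\<^esub> \<phi> = (\<lambda>v\<in>carrier_vec n. \<psi> v)" by (simp add: Aut_inv \<phi>_inv)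
  interpret A: group "Aut n :: ('a vec \<Rightarrow> 'a vec) monoid" by (rule group_Aut)
  let ?H = "\<phi> <#\<^bsub>Aut n\<^esub> U #>\<^bsub>Aut n\<^esub> inv\<^bsub>Aut n\<^esub> \<phi>"
  have H: "subgroup ?H (Aut n)" by (rule A.subgroup_conjugate[OF subgroup \<phi>_Aut])
  have "?H \<subseteq> Jonq n"
  proof
    fix h assume h: "h \<in> ?H"
    then obtain u where u: "u \<in> U" "h = \<phi> \<otimes>\<^bsub>Aut n\<^esub> u \<otimes>\<^bsub>Aut n\<^esub> inv\<^bsub>Aut n\<^esub> \<phi>"
      by (auto simp: l_coset_def r_coset_def)
    have h_eq: "h v = vec n (\<lambda>j. x j (u (\<psi> v)))" if "v \<in> carrier_vec n" for v
    proof -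
      have "h v = (\<phi> \<otimes>\<^bsub>Aut n\<^esub> u) (\<psi> v)"
        using that u(2) Aut_mult[OF A.m_closed[OF \<phi>_Aut Aut[OF u(1)]] A.inv_closed[OF \<phi>_Aut]] \<psi>_Aut
        by (simp add: compose_def)
      also have "\<dots> = \<phi> (u (\<psi> v))" using \<psi> by (simp add: Aut_mult[OF \<phi>_Aut Aut[OF u(1)]] compose_def)
      also have "\<dots> = vec n (\<lambda>j. x j (u (\<psi> v)))" using maps[OF u(1) \<psi>(1)] by (simp add: \<phi>_def)
      finally show ?thesis .
    qed
    have "\<exists>p. p \<in> mpolys {..<j} \<and> (\<forall>y\<in>carrier_vec n. x j (u y) - x j y = mpoly_eval p (\<lambda>i. x i y))"
      if "j < n" for j
    proof -
      have "(\<lambda>y. x j (u y) - x j y) \<in> gen_by j x" using tri u(1) that by (simp add: triangular_def)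
      from fun_alg_imp_mpoly[OF this] show ?thesis by auto
    qed
    then have "\<forall>j\<in>{..<n}. \<exists>p. p \<in> mpolys {..<j} \<and>
        (\<forall>y\<in>carrier_vec n. x j (u y) - x j y = mpoly_eval p (\<lambda>i. x i y))" by simp
    from bchoice[OF this] obtain f where f: "\<forall>j\<in>{..<n}. f j \<in> mpolys {..<j} \<and>
        (\<forall>y\<in>carrier_vec n. x j (u y) - x j y = mpoly_eval (f j) (\<lambda>i. x i y))" ..
    have "h v = vec n (\<lambda>j. 1 * v $ j + mpoly_eval (f j) (\<lambda>i. v $ i))" if "v \<in> carrier_vec n" for v
      unfolding h_eq[OF that]
    proof (rule eq_vecI)
      fix j assume "j < dim_vec (vec n (\<lambda>j. 1 * v $ j + mpoly_eval (f j) (\<lambda>i. v $ i)))"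
      then have j: "j < n" by simp
      then have fj: "f j \<in> mpolys {..<j}"
        "x j (u (\<psi> v)) - x j (\<psi> v) = mpoly_eval (f j) (\<lambda>i. x i (\<psi> v))"
        using f \<psi>(1) by auto
      have "x j (u (\<psi> v)) = v $ j + mpoly_eval (f j) (\<lambda>i. x i (\<psi> v))"
        using fj(2) \<psi>(2)[OF j] by (simp add: algebra_simps)
      also have "mpoly_eval (f j) (\<lambda>i. x i (\<psi> v)) = mpoly_eval (f j) (\<lambda>i. v $ i)"
        by (rule mpoly_eval_cong[OF fj(1)]) (use j \<psi>(2) in auto)
      finally show "vec n (\<lambda>j. x j (u (\<psi> v))) $ j = vec n (\<lambda>j. 1 * v $ j + mpoly_eval (f j) (\<lambda>i. v $ i)) $ j"
        using j by simp
    qed simp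
    moreover have "h \<in> carrier (Aut n)" using subgroup.mem_carrier[OF H h] .
    ultimately show "h \<in> Jonq n"
      unfolding Jonq_def using f by (intro CollectI conjI exI[of _ "\<lambda>_. 1"] exI[of _ f]) auto
  qed
  then show "triangulable n U" unfolding triangulable_def using \<phi>_Aut H by blast
qed

end

theorem theoremD:
  fixes n :: nat
    and U :: "('a::{alg_closed_field, field_char_0} vec \<Rightarrow> 'a vec) set"
  assumes "nested_unipotent_subgroup n U"
    and "\<exists>S \<in> orbits ((Aut n)\<lparr>carrier := U\<rparr>) (carrier_vec n) (\<lambda>u. u). zariski_dense n S"
  shows "transitive_action ((Aut n)\<lparr>carrier := U\<rparr>) (carrier_vec n) (\<lambda>u. u) \<and> triangulable n U"
proof -
  obtain Us :: "nat \<Rightarrow> ('a vec \<Rightarrow> 'a vec) set" where Us: "subgroup U (Aut n)"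
    "\<And>i. unipotent_algebraic_subgroup n (Us i)" "\<And>i. Us i \<subseteq> Us (Suc i)" "U = (\<Union>i. Us i)"
    using assms(1) unfolding nested_unipotent_subgroup_def by blast
  obtain x0 where x0: "x0 \<in> carrier_vec n" "zariski_dense n {u x0 | u. u \<in> U}"
    using assms(2) unfolding orbits_def orbit_def by auto
  interpret nested_unipotent n U Us x0
  proof (intro nested_unipotent.intro aut_subgroup.intro nested_unipotent_axioms.intro)
    show "\<forall>x\<in>carrier_vec n. f x = 0" if "f \<in> pol n" "\<And>u. u \<in> U \<Longrightarrow> f (u x0) = 0" for f
      by (rule zariski_dense_vanishing[OF x0(2) that(1)]) (use that(2) in auto)
  qed (rule Us x0(1))+
  obtain i0 where i0: "\<And>f. f \<in> pol n \<Longrightarrow> (\<And>u. u \<in> Us i0 \<Longrightarrow> f (u x0) = 0) \<Longrightarrow> \<forall>x\<in>carrier_vec n. f x = 0"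
    by (rule ex_dense_orbit) blast
  interpret nested_unipotent_dense n U Us x0 i0 by unfold_locales (rule i0)
  show ?thesis using transitive_and_triangulable by blast
qed

end
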